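(* There exists a $\mathcal{C}^\infty$ diffeomorphism $f$ of $\mathbb{R}_+=[0,+\infty)$ whose only fixed point is the origin and such that, for every $r$ with $2\le r\le\infty$, the centralizer $\mathcal{Z}^r_f$ is a proper, dense and uncountable subgroup of the one-parameter group $\mathcal{Z}^1_f$.
   Context: $\mathbb{R}_+=[0,+\infty)$ is the closed half-line; smooth means $\mathcal{C}^\infty$ (up to and including $0$). For $1\le r\le\infty$, $\mathcal{D}^r$ is the group of $\mathcal{C}^r$ diffeomorphisms of $\mathbb{R}_+$, and for a smooth diffeomorphism $f$ of $\mathbb{R}_+$, $\mathcal{Z}^r_f=\{g\in\mathcal{D}^r : g\circ f=f\circ g\}$. By theorems of Szekeres and Kopell, if $0$ is the only fixed point of $f$, then $\mathcal{Z}^1_f$ is a one-parameter group $\{f^t,\ t\in\mathbb{R}\}$, namely the flow of a (unique) $\mathcal{C}^1$ vector field on $\mathbb{R}_+$ with $f^1=f$, so that $t\mapsto f^t$ is an isomorphism $\mathbb{R}\cong\mathcal{Z}^1_f$. Density of a subgroup of $\mathcal{Z}^1_f$ means density of the corresponding set of times $t$ in $\mathbb{R}$ (equivalently, density in $\mathcal{Z}^1_f$ for the $\mathcal{C}^1$ compact-open topology). *)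

theory Defs
  imports "HOL-Analysis.Analysis" "HOL-Library.Extended_Nat" "HOL-Algebra.Bij"
begin

primrec C_k_on :: "nat \<Rightarrow> (real \<Rightarrow> real) \<Rightarrow> real set \<Rightarrow> bool" where
  "C_k_on 0 f S \<longleftrightarrow> continuous_on S f"
| "C_k_on (Suc k) f S \<longleftrightarrow>
     (\<exists>f'. (\<forall>x\<in>S. (f has_real_derivative f' x) (at x within S)) \<and> C_k_on k f' S)"

text \<open>Derivatives are taken within \<open>S\<close>; on \<open>{0..}\<close> this means one-sided derivatives at \<open>0\<close>,
  continuous up to \<open>0\<close>. The case \<open>r = \<infinity>\<close> is smoothness.\<close>

definition C_r_on :: "enat \<Rightarrow> (real \<Rightarrow> real) \<Rightarrow> real set \<Rightarrow> bool" where
  "C_r_on r f S \<longleftrightarrow> (\<forall>k. enat k \<le> r \<longrightarrow> C_k_on k f S)"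

text \<open>Self-maps of the half-line are extensional functions (members of \<^const>\<open>Bij\<close> are
  \<^const>\<open>undefined\<close> off \<open>{0..}\<close>), so that two diffeomorphisms are equal iff they agree on \<open>{0..}\<close>
  and cardinalities of sets of diffeomorphisms are the intended ones.\<close>

definition Diff_half_line :: "enat \<Rightarrow> (real \<Rightarrow> real) set" where
  "Diff_half_line r =
     {g \<in> Bij {0..}. C_r_on r g {0..} \<and> C_r_on r (inv_into {0..} g) {0..}}"

definition centralizer :: "enat \<Rightarrow> (real \<Rightarrow> real) \<Rightarrow> (real \<Rightarrow> real) set" where
  "centralizer r f = {g \<in> Diff_half_line r. compose {0..} g f = compose {0..} f g}"

definition centralizer_group :: "enat \<Rightarrow> (real \<Rightarrow> real) \<Rightarrow> (real \<Rightarrow> real) monoid" where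
  "centralizer_group r f = (BijGroup {0..})\<lparr>carrier := centralizer r f\<rparr>"

definition real_add_group :: "real monoid" where
  "real_add_group = \<lparr>carrier = UNIV, monoid.mult = (+), one = 0\<rparr>"

text \<open>\<open>\<phi>\<close> is the (complete) flow on the half-line of the vector field \<open>\<xi>\<close>. For a \<open>C\<^sup>1\<close> field \<open>\<xi>\<close>
  these conditions determine \<open>\<phi>\<close>.\<close>

definition is_flow_of :: "(real \<Rightarrow> real \<Rightarrow> real) \<Rightarrow> (real \<Rightarrow> real) \<Rightarrow> bool" where
  "is_flow_of \<phi> \<xi> \<longleftrightarrow>
     (\<forall>t. \<phi> t \<in> extensional {0..} \<and> \<phi> t ` {0..} \<subseteq> {0..}) \<and>
     (\<forall>x\<ge>0. \<phi> 0 x = x) \<and>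
     (\<forall>x\<ge>0. \<forall>t. ((\<lambda>s. \<phi> s x) has_real_derivative \<xi> (\<phi> t x)) (at t))"

text \<open>\<open>\<phi>\<close> is the parametrization \<open>t \<mapsto> f\<^sup>t\<close> of the \<open>C\<^sup>1\<close> centralizer of \<open>f\<close> as a one-parameter
  group: an isomorphism from the additive reals that is the flow of a \<open>C\<^sup>1\<close> vector field
  and has time-one map \<open>f\<close>. There is at most one such \<open>\<phi>\<close>: any other one is \<open>t \<mapsto> \<phi> (c t)\<close> for a
  continuous additive \<open>c\<close> with \<open>c 1 = 1\<close>.\<close>

definition is_one_param_centralizer :: "(real \<Rightarrow> real \<Rightarrow> real) \<Rightarrow> (real \<Rightarrow> real) \<Rightarrow> bool" where
  "is_one_param_centralizer \<phi> f \<longleftrightarrow>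
     (\<exists>\<xi>. C_r_on 1 \<xi> {0..} \<and> is_flow_of \<phi> \<xi>) \<and> \<phi> 1 = f \<and>
     \<phi> \<in> iso real_add_group (centralizer_group 1 f)"

end

theory Submission
  imports Defs "HOL-Real_Asymp.Real_Asymp"
begin

text \<open>
  The diffeomorphism is the time-one map \<open>f\<close> of a positive vector field \<open>\<xi>\<close> on \<open>(0, \<infinity>)\<close> that is smooth there
  and extends to a \<open>C\<^sup>1\<close> field that vanishes at \<open>0\<close> together with its derivative. Such a field is \<open>1 / A'\<close> for an Abel
  function \<open>A\<close>, and its flow \<open>f\<^sup>t\<close> is \<open>A\<close>-conjugate to the translation by \<open>t\<close>.

  \<^bold>\<open>Centralizer.\<close> If a \<open>C\<^sup>1\<close> diffeomorphism \<open>g\<close> commutes with \<open>f\<close>, then \<open>P = A \<circ> g \<circ> A\<inverse>\<close> commutes with the unit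
  translation, so \<open>P'\<close> is periodic. Along a backward orbit \<open>x\<^sub>n \<rightarrow> 0\<close> the value \<open>P'\<close> is
  \<open>g'(x\<^sub>n) \<xi>(x\<^sub>n) / \<xi>(f\<^sup>d x\<^sub>n)\<close> for a fixed \<open>d\<close>, and the quotient of the two values of \<open>\<xi>\<close> tends to \<open>1\<close> because
  \<open>\<xi>' \<rightarrow> 0\<close>. Hence \<open>P'\<close> is the constant \<open>g'(0)\<close>, which has to be \<open>1\<close>, and \<open>g\<close> belongs to the flow
  (\<open>centralizer_1_flow\<close>).

  \<^bold>\<open>The field.\<close> Start from the flat field \<open>exp (- 1 / x)\<close>. In the coordinate \<open>1 / x\<close> the half-line is cut into
  intervals of length \<open>10\<close>, the humps. In the middle of the \<open>n\<close>-th hump the field is lowered to a tiny constant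
  \<open>c\<^sub>n\<close>; let \<open>\<tau>\<close> be an Abel function of the lowered field. Replace \<open>\<tau>\<close> by
  \<open>\<tau> + c\<^sub>n sin (2 \<pi> N\<^sub>n \<tau>)\<close>, the oscillation being switched on before and off after the dip, where the field still is
  \<open>exp (- 1 / x)\<close>. There the field does not depend on \<open>c\<^sub>n\<close>, which can be taken negligible with respect to a high power
  of it, so that the new field is small together with all its derivatives, and so are its time-\<open>t\<close> maps minus the
  identity. This transfer from the field to the flow is \<open>flow_near_identity\<close>; it rests on the variational equation. In the dip the oscillation has
  \<open>\<tau>\<close>-period \<open>1 / N\<^sub>n\<close>, so at the times \<open>m / N\<^sub>n\<close> the flow of \<open>\<xi>\<close> agrees with that of the lowered field, for which the
  same transfer applies (\<open>core_flow_eq\<close>).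

  \<^bold>\<open>Good times.\<close> If for all large \<open>n\<close> the time \<open>t\<close> is within \<open>\<eta>\<^sub>n\<close> of a multiple of \<open>1 / N\<^sub>n\<close>, where \<open>\<eta>\<^sub>n\<close> is so
  small that the first \<open>n + 1\<close> derivatives of \<open>\<eta>\<^sub>n \<xi>\<close> on the dip are at most \<open>1 / (n + 1)\<close>, then \<open>f\<^sup>t\<close> is on the dip a composition of two maps
  near the identity, and \<open>f\<^sup>t\<close> is smooth at \<open>0\<close> (\<open>good_time_smooth\<close>). The frequencies \<open>N\<^sub>n\<close> are powers of \<open>3\<close> chosen
  one after the other, \<open>N\<^bsub>n+1\<^esub>\<close> large with respect to \<open>1 / \<eta>\<^sub>n\<close>. Then all triadic rationals are good, which gives
  density, and so are all sums of \<open>1 / N\<^sub>n\<close> over sets of indices, which gives uncountably many good times.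

  \<^bold>\<open>A bad time.\<close> Since \<open>N\<^sub>n\<close> is odd, the time \<open>1 / 2\<close> shifts the oscillation by half a period: two points of the dip at
  distance \<open>c\<^sub>n / 2\<close> have derivatives of \<open>f\<^bsup>1/2\<^esup>\<close> that differ by at least \<open>8 \<pi> N\<^sub>n c\<^sub>n\<close>. As \<open>N\<^sub>n \<rightarrow> \<infinity>\<close>, \<open>f\<^bsup>1/2\<^esup>\<close> is not
  \<open>C\<^sup>2\<close> (\<open>flow_half_not_C2\<close>).
\<close>

section \<open>Families of functions with bounded derivatives\<close>

text \<open>The parameter ranges over \<open>{0..1}\<close>: families arise as rescaled time intervals of flows, and the derivative of
  a flow map is an integral over the earlier times, so that estimates have to be uniform in time.\<close>

definition bdd_cont_fam :: "real \<Rightarrow> (real \<Rightarrow> real \<Rightarrow> real) \<Rightarrow> real set \<Rightarrow> bool" where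
  "bdd_cont_fam M G S \<longleftrightarrow> continuous_on ({0..1} \<times> S) (\<lambda>p. G (fst p) (snd p)) \<and>
     (\<forall>s\<in>{0..1}. \<forall>x\<in>S. \<bar>G s x\<bar> \<le> M)"

text \<open>One constant bounds all derivatives in \<open>x\<close> up to order \<open>k\<close>. Joint continuity is
  part of the notion because it is what differentiation under an integral over the parameter requires.\<close>

primrec Ck_bdd_fam :: "nat \<Rightarrow> real \<Rightarrow> (real \<Rightarrow> real \<Rightarrow> real) \<Rightarrow> real set \<Rightarrow> bool" where
  "Ck_bdd_fam 0 M G S \<longleftrightarrow> bdd_cont_fam M G S"
| "Ck_bdd_fam (Suc k) M G S \<longleftrightarrow> bdd_cont_fam M G S \<and>
     (\<exists>G'. (\<forall>s\<in>{0..1}. \<forall>x\<in>S. (G s has_real_derivative G' s x) (at x)) \<and> Ck_bdd_fam k M G' S)"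

abbreviation Ck_bdd :: "nat \<Rightarrow> real \<Rightarrow> (real \<Rightarrow> real) \<Rightarrow> real set \<Rightarrow> bool" where
  "Ck_bdd k M g S \<equiv> Ck_bdd_fam k M (\<lambda>_. g) S"

declare Ck_bdd_fam.simps(2) [simp del]

lemma Ck_bdd_fam_SucE:
  assumes "Ck_bdd_fam (Suc k) M G S"
  obtains G' where "bdd_cont_fam M G S" "Ck_bdd_fam k M G' S"
    "\<And>s x. s \<in> {0..1} \<Longrightarrow> x \<in> S \<Longrightarrow> (G s has_real_derivative G' s x) (at x)"
  using assms unfolding Ck_bdd_fam.simps by blast

lemma Ck_bdd_famD0: "Ck_bdd_fam k M G S \<Longrightarrow> bdd_cont_fam M G S"
  by (cases k) (auto elim: Ck_bdd_fam_SucE)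

lemma Ck_bdd_fam_SucI:
  assumes "bdd_cont_fam M G S" "\<And>s x. s \<in> {0..1} \<Longrightarrow> x \<in> S \<Longrightarrow> (G s has_real_derivative G' s x) (at x)"
    "Ck_bdd_fam k M G' S"
  shows "Ck_bdd_fam (Suc k) M G S"
  unfolding Ck_bdd_fam.simps using assms by blast

lemma Ck_bdd_fam_bound: "Ck_bdd_fam k M G S \<Longrightarrow> s \<in> {0..1} \<Longrightarrow> x \<in> S \<Longrightarrow> \<bar>G s x\<bar> \<le> M"
  using Ck_bdd_famD0 bdd_cont_fam_def by blast

lemma Ck_bdd_bound: "Ck_bdd k M g S \<Longrightarrow> x \<in> S \<Longrightarrow> \<bar>g x\<bar> \<le> M"
  using Ck_bdd_fam_bound[of k M "\<lambda>_. g" S 0 x] by simp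

lemma Ck_bdd_fam_cont: "Ck_bdd_fam k M G S \<Longrightarrow> continuous_on ({0..1} \<times> S) (\<lambda>p. G (fst p) (snd p))"
  using Ck_bdd_famD0 bdd_cont_fam_def by blast

lemma Ck_bdd_fam_cont1:
  assumes "Ck_bdd_fam k M G S" "s \<in> {0..1}"
  shows "continuous_on S (G s)"
proof -
  have "continuous_on S ((\<lambda>p. G (fst p) (snd p)) \<circ> (\<lambda>x. (s, x)))"
    by (rule continuous_on_compose, intro continuous_intros)
       (rule continuous_on_subset[OF Ck_bdd_fam_cont[OF assms(1)]], use assms(2) in auto)
  then show ?thesis by (simp add: o_def)
qed

lemma Ck_bdd_cont: "Ck_bdd k M g S \<Longrightarrow> continuous_on S g"
  using Ck_bdd_fam_cont1[of k M "\<lambda>_. g" S 0] by simp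

lemma Ck_bdd_fam_pred: "Ck_bdd_fam (Suc k) M G S \<Longrightarrow> Ck_bdd_fam k M G S"
proof (induction k arbitrary: G)
  case 0 then show ?case using Ck_bdd_famD0 by simp
next
  case (Suc k)
  obtain G' where G': "bdd_cont_fam M G S" "Ck_bdd_fam (Suc k) M G' S"
      "\<And>s x. s \<in> {0..1} \<Longrightarrow> x \<in> S \<Longrightarrow> (G s has_real_derivative G' s x) (at x)"
    by (rule Ck_bdd_fam_SucE[OF Suc.prems]) (rule that)
  show ?case by (rule Ck_bdd_fam_SucI[OF G'(1,3) Suc.IH[OF G'(2)]])
qed

lemma Ck_bdd_fam_order: "Ck_bdd_fam l M G S \<Longrightarrow> k \<le> l \<Longrightarrow> Ck_bdd_fam k M G S"
proof (induction l)
  case (Suc l)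
  show ?case
  proof (cases "k = Suc l")
    case False
    then show ?thesis using Suc.IH[OF Ck_bdd_fam_pred[OF Suc.prems(1)]] Suc.prems(2) by linarith
  qed (use Suc.prems in blast)
qed simp

lemma bdd_cont_fam_mono:
  assumes "bdd_cont_fam M G S" "M \<le> L" "S' \<subseteq> S"
  shows "bdd_cont_fam L G S'"
proof -
  have "continuous_on ({0..1} \<times> S') (\<lambda>p. G (fst p) (snd p))"
    using assms unfolding bdd_cont_fam_def by (blast intro: continuous_on_subset)
  moreover have "\<bar>G s x\<bar> \<le> L" if "s \<in> {0..1}" "x \<in> S'" for s x
    using assms that unfolding bdd_cont_fam_def by (meson order_trans subsetD)
  ultimately show ?thesis by (simp add: bdd_cont_fam_def)
qed

lemma Ck_bdd_fam_mono: "Ck_bdd_fam k M G S \<Longrightarrow> M \<le> L \<Longrightarrow> S' \<subseteq> S \<Longrightarrow> Ck_bdd_fam k L G S'"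
proof (induction k arbitrary: G)
  case 0 then show ?case by (simp add: bdd_cont_fam_mono)
next
  case (Suc k)
  obtain G' where G': "bdd_cont_fam M G S" "Ck_bdd_fam k M G' S"
      "\<And>s x. s \<in> {0..1} \<Longrightarrow> x \<in> S \<Longrightarrow> (G s has_real_derivative G' s x) (at x)"
    by (rule Ck_bdd_fam_SucE[OF Suc.prems(1)]) (rule that)
  show ?case 
    using G'(3) Suc.prems(3)
    by (intro Ck_bdd_fam_SucI[OF bdd_cont_fam_mono[OF G'(1) Suc.prems(2,3)] _ Suc.IH[OF G'(2) Suc.prems(2,3)]]) blast
qed

lemma Ck_bdd_fam_cong:
  assumes "open S" "\<And>s x. s \<in> {0..1} \<Longrightarrow> x \<in> S \<Longrightarrow> G s x = H s x" and a: "Ck_bdd_fam k M G S"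
  shows "Ck_bdd_fam k M H S"
proof -
  have "continuous_on ({0..1} \<times> S) (\<lambda>p. H (fst p) (snd p))"
    by (rule continuous_on_eq[OF Ck_bdd_fam_cont[OF a]]) (simp add: assms(2) mem_Times_iff)
  moreover have "\<bar>H s x\<bar> \<le> M" if "s \<in> {0..1}" "x \<in> S" for s x
    using Ck_bdd_fam_bound[OF a that] assms(2)[OF that] by simp
  ultimately have H: "bdd_cont_fam M H S" by (simp add: bdd_cont_fam_def)
  show ?thesis
  proof (cases k)
    case 0 then show ?thesis using H by simp
  next
    case (Suc l)
    note a' = a[unfolded Suc]
    obtain G' where G': "Ck_bdd_fam l M G' S"
      "\<And>s x. s \<in> {0..1} \<Longrightarrow> x \<in> S \<Longrightarrow> (G s has_real_derivative G' s x) (at x)"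
      by (rule Ck_bdd_fam_SucE[OF a']) (rule that)
    have d: "(H s has_real_derivative G' s x) (at x)" if "s \<in> {0..1}" "x \<in> S" for s x
      by (rule has_field_derivative_transform_within_open[OF G'(2)[OF that] assms(1) that(2)])
         (rule assms(2)[OF that(1)])
    show ?thesis unfolding Suc by (rule Ck_bdd_fam_SucI[OF H d G'(1)])
  qed
qed

lemma Ck_bdd_fam_DERIV:
  assumes "Ck_bdd_fam (Suc k) M G S" "s \<in> {0..1}" "x \<in> S"
  shows "(G s has_real_derivative deriv (G s) x) (at x)"
proof -
  obtain G' where "(G s has_real_derivative G' s x) (at x)"
    using Ck_bdd_fam_SucE[OF assms(1)] assms(2,3) by blast
  then show ?thesis using DERIV_imp_deriv by metis
qed

lemma Ck_bdd_fam_deriv: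
  assumes "open S" "Ck_bdd_fam (Suc k) M G S"
  shows "Ck_bdd_fam k M (\<lambda>s. deriv (G s)) S"
proof -
  obtain G' where G': "Ck_bdd_fam k M G' S"
      "\<And>s x. s \<in> {0..1} \<Longrightarrow> x \<in> S \<Longrightarrow> (G s has_real_derivative G' s x) (at x)"
    by (rule Ck_bdd_fam_SucE[OF assms(2)]) (rule that)
  show ?thesis by (rule Ck_bdd_fam_cong[OF assms(1) _ G'(1)]) (rule DERIV_imp_deriv[OF G'(2), symmetric])
qed

lemma Ck_bdd_DERIV:
  assumes "Ck_bdd (Suc k) M g S" "x \<in> S"
  shows "(g has_real_derivative deriv g x) (at x)"
  by (rule Ck_bdd_fam_DERIV[OF assms(1) _ assms(2), of 0]) simp

lemma Ck_bdd_deriv: "open S \<Longrightarrow> Ck_bdd (Suc k) M g S \<Longrightarrow> Ck_bdd k M (deriv g) S"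
  by (rule Ck_bdd_fam_deriv[where G = "\<lambda>_. g"])

lemma continuous_on_snd: "continuous_on S g \<Longrightarrow> continuous_on ({0..1::real} \<times> S) (\<lambda>p. g (snd p))"
  by (rule continuous_on_compose2[of S g]) (auto intro!: continuous_intros)

lemma Ck_bdd_fam_at: "Ck_bdd_fam k M G S \<Longrightarrow> s \<in> {0..1} \<Longrightarrow> Ck_bdd k M (G s) S"
proof (induction k arbitrary: G)
  case 0 
  show ?case
    using continuous_on_snd[OF Ck_bdd_fam_cont1[OF 0]] Ck_bdd_fam_bound[OF 0] by (simp add: bdd_cont_fam_def)
next
  case (Suc k)
  have b: "bdd_cont_fam M (\<lambda>_. G s) S"
    using continuous_on_snd[OF Ck_bdd_fam_cont1[OF Suc.prems]] Ck_bdd_fam_bound[OF Suc.prems] by (simp add: bdd_cont_fam_def)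
  obtain G' where G': "Ck_bdd_fam k M G' S"
    "\<And>s x. s \<in> {0..1} \<Longrightarrow> x \<in> S \<Longrightarrow> (G s has_real_derivative G' s x) (at x)"
    by (rule Ck_bdd_fam_SucE[OF Suc.prems(1)]) (rule that)
  show ?case by (rule Ck_bdd_fam_SucI[OF b G'(2)[OF Suc.prems(2)] Suc.IH[OF G'(1) Suc.prems(2)]])
qed

lemma Ck_bdd_fam_const: "\<bar>a\<bar> \<le> M \<Longrightarrow> Ck_bdd_fam k M (\<lambda>s x. a) S"
proof (induction k arbitrary: a)
  case (Suc k)
  show ?case
    by (rule Ck_bdd_fam_SucI[where G'="\<lambda>_ _. 0"]) (use Suc in \<open>simp_all add: bdd_cont_fam_def\<close>)
qed (simp add: bdd_cont_fam_def)

lemma Ck_bdd_id: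
  assumes "\<And>x. x \<in> S \<Longrightarrow> \<bar>x\<bar> \<le> M" "1 \<le> M"
  shows "Ck_bdd k M (\<lambda>x. x) S"
proof -
  have b: "bdd_cont_fam M (\<lambda>_ x. x) S" using assms by (auto simp: bdd_cont_fam_def intro!: continuous_intros)
  show ?thesis
  proof (cases k)
    case (Suc l)
    show ?thesis unfolding Suc
      by (rule Ck_bdd_fam_SucI[OF b, where G'="\<lambda>_ _. 1"]) (use assms in \<open>simp_all add: Ck_bdd_fam_const\<close>)
  qed (use b in simp)
qed

lemma bdd_cont_fam_add:
  assumes "bdd_cont_fam M G S" "bdd_cont_fam L H S"
  shows "bdd_cont_fam (M + L) (\<lambda>s x. G s x + H s x) S"
proof -
  have "\<bar>G s x + H s x\<bar> \<le> M + L" if "s \<in> {0..1}" "x \<in> S" for s x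
    using assms that unfolding bdd_cont_fam_def by (meson abs_triangle_ineq add_mono order_trans)
  with assms show ?thesis unfolding bdd_cont_fam_def by (intro conjI continuous_on_add) simp_all
qed

lemma Ck_bdd_fam_add:
  "Ck_bdd_fam k M G S \<Longrightarrow> Ck_bdd_fam k L H S \<Longrightarrow> Ck_bdd_fam k (M + L) (\<lambda>s x. G s x + H s x) S"
proof (induction k arbitrary: G H)
  case 0 then show ?case by (simp add: bdd_cont_fam_add)
next
  case (Suc k)
  obtain G' where G': "Ck_bdd_fam k M G' S"
    "\<And>s x. s \<in> {0..1} \<Longrightarrow> x \<in> S \<Longrightarrow> (G s has_real_derivative G' s x) (at x)"
    by (rule Ck_bdd_fam_SucE[OF Suc.prems(1)]) (rule that)
  obtain H' where H': "Ck_bdd_fam k L H' S"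
    "\<And>s x. s \<in> {0..1} \<Longrightarrow> x \<in> S \<Longrightarrow> (H s has_real_derivative H' s x) (at x)"
    by (rule Ck_bdd_fam_SucE[OF Suc.prems(2)]) (rule that)
  show ?case
    by (rule Ck_bdd_fam_SucI[OF bdd_cont_fam_add[OF Ck_bdd_famD0 Ck_bdd_famD0] DERIV_add Suc.IH])
       (fact Suc.prems G' H')+
qed

lemma bdd_cont_fam_mult:
  assumes "bdd_cont_fam M G S" "bdd_cont_fam L H S"
  shows "bdd_cont_fam (M * L) (\<lambda>s x. G s x * H s x) S"
proof -
  have "\<bar>G s x * H s x\<bar> \<le> M * L" if "s \<in> {0..1}" "x \<in> S" for s x
    using assms that unfolding bdd_cont_fam_def abs_mult by (meson abs_ge_zero mult_mono' )
  with assms show ?thesis unfolding bdd_cont_fam_def by (intro conjI continuous_on_mult) simp_all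
qed

lemma Ck_bdd_fam_cmult:
  "Ck_bdd_fam k M G S \<Longrightarrow> Ck_bdd_fam k (\<bar>a\<bar> * M) (\<lambda>s x. a * G s x) S"
proof (induction k arbitrary: G)
  case 0 
  have "bdd_cont_fam \<bar>a\<bar> (\<lambda>s x. a) S" by (simp add: bdd_cont_fam_def)
  with 0 show ?case using bdd_cont_fam_mult by fastforce
next
  case (Suc k)
  have b: "bdd_cont_fam \<bar>a\<bar> (\<lambda>s x. a) S" by (simp add: bdd_cont_fam_def)
  obtain G' where G': "Ck_bdd_fam k M G' S"
    "\<And>s x. s \<in> {0..1} \<Longrightarrow> x \<in> S \<Longrightarrow> (G s has_real_derivative G' s x) (at x)"
    by (rule Ck_bdd_fam_SucE[OF Suc.prems(1)]) (rule that)
  show ?case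
    by (rule Ck_bdd_fam_SucI[OF bdd_cont_fam_mult[OF b Ck_bdd_famD0] DERIV_cmult Suc.IH])
       (fact Suc.prems G')+
qed

text \<open>By the Leibniz formula \<open>2 ^ k\<close> suffices: each differentiation doubles the number of terms.\<close>

lemma Ck_bdd_fam_mult:
  "Ck_bdd_fam k M G S \<Longrightarrow> Ck_bdd_fam k L H S \<Longrightarrow> 0 \<le> M \<Longrightarrow> 0 \<le> L \<Longrightarrow>
   Ck_bdd_fam k (2 ^ k * M * L) (\<lambda>s x. G s x * H s x) S"
proof (induction k arbitrary: G H)
  case 0 then show ?case by (simp add: bdd_cont_fam_mult)
next
  case (Suc k)
  have "1 * (M * L) \<le> 2 ^ Suc k * (M * L)"
    using Suc.prems by (intro mult_right_mono one_le_power) auto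
  then have b: "bdd_cont_fam (2 ^ Suc k * M * L) (\<lambda>s x. G s x * H s x) S"
    using bdd_cont_fam_mono[OF bdd_cont_fam_mult[OF Suc.prems(1,2)[THEN Ck_bdd_famD0]] _ order_refl]
    by (simp add: mult.assoc)
  obtain G' where G': "Ck_bdd_fam k M G' S"
    "\<And>s x. s \<in> {0..1} \<Longrightarrow> x \<in> S \<Longrightarrow> (G s has_real_derivative G' s x) (at x)"
    by (rule Ck_bdd_fam_SucE[OF Suc.prems(1)]) (rule that)
  obtain H' where H': "Ck_bdd_fam k L H' S"
    "\<And>s x. s \<in> {0..1} \<Longrightarrow> x \<in> S \<Longrightarrow> (H s has_real_derivative H' s x) (at x)"
    by (rule Ck_bdd_fam_SucE[OF Suc.prems(2)]) (rule that)
  have "Ck_bdd_fam k (2 ^ k * M * L + 2 ^ k * M * L) (\<lambda>s x. G' s x * H s x + H' s x * G s x) S"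
    using Ck_bdd_fam_add[OF Suc.IH[OF G'(1) Ck_bdd_fam_pred[OF Suc.prems(2)] Suc.prems(3,4)]
       Suc.IH[OF Ck_bdd_fam_pred[OF Suc.prems(1)] H'(1) Suc.prems(3,4)]] by (simp add: mult.commute)
  then have "Ck_bdd_fam k (2 ^ Suc k * M * L) (\<lambda>s x. G' s x * H s x + H' s x * G s x) S"
    by (simp add: algebra_simps)
  then show ?case
    by (intro Ck_bdd_fam_SucI[OF b DERIV_mult[OF G'(2) H'(2)]])
qed

text \<open>The chain rule expresses the derivative of \<open>h \<circ> G\<close> through \<open>h' \<circ> G\<close>, to which the induction
  hypothesis applies. Two features of the constant matter later: it is linear in \<open>M\<close>, so that smallness of the outer
  function survives, and it is polynomial in \<open>L\<close>, so that a polynomially growing inner function is harmless when \<open>M\<close>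
  decays exponentially.\<close>

lemma Ck_bdd_fam_comp:
  "Ck_bdd k M h U \<Longrightarrow> Ck_bdd_fam k L G S \<Longrightarrow> (\<And>s x. s \<in> {0..1} \<Longrightarrow> x \<in> S \<Longrightarrow> G s x \<in> U) \<Longrightarrow>
    0 \<le> M \<Longrightarrow> 1 \<le> L \<Longrightarrow> Ck_bdd_fam k ((2 ^ k * L) ^ k * M) (\<lambda>s x. h (G s x)) S"
proof (induction k arbitrary: h)
  case 0
  have "continuous_on ({0..1} \<times> S) (\<lambda>p. h (G (fst p) (snd p)))"
    by (rule continuous_on_compose2[OF Ck_bdd_cont[OF 0(1)] Ck_bdd_fam_cont[OF 0(2)]]) (use 0(3) in auto)
  with Ck_bdd_bound[OF 0(1)] 0(3) show ?case by (simp add: bdd_cont_fam_def)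
next
  case (Suc k)
  let ?K = "(2 ^ Suc k * L) ^ Suc k * M"
  have "1 * 1 \<le> 2 ^ Suc k * L" using Suc.prems(5) by (intro mult_mono one_le_power) auto
  then have e: "1 \<le> (2 ^ Suc k * L) ^ Suc k" 
    by (intro one_le_power) simp
  have c: "continuous_on ({0..1} \<times> S) (\<lambda>p. h (G (fst p) (snd p)))"
    by (rule continuous_on_compose2[OF Ck_bdd_cont[OF Suc.prems(1)] Ck_bdd_fam_cont[OF Suc.prems(2)]])
       (use Suc.prems(3) in auto)
  have "\<bar>h (G s x)\<bar> \<le> ?K" if "s \<in> {0..1}" "x \<in> S" for s x
  proof -
    have "\<bar>h (G s x)\<bar> \<le> 1 * M" using Ck_bdd_bound[OF Suc.prems(1) Suc.prems(3)[OF that]] by simp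
    also have "\<dots> \<le> ?K" using e Suc.prems(4) by (intro mult_right_mono) auto
    finally show ?thesis .
  qed
  with c have 1: "bdd_cont_fam ?K (\<lambda>s x. h (G s x)) S" unfolding bdd_cont_fam_def by blast
  obtain h' where h': "\<And>x. x \<in> U \<Longrightarrow> (h has_real_derivative h' x) (at x)" "Ck_bdd k M h' U"
  proof -
    obtain h'' where h'': "Ck_bdd_fam k M h'' U"
      "\<And>s x. s \<in> {0..1} \<Longrightarrow> x \<in> U \<Longrightarrow> (h has_real_derivative h'' s x) (at x)"
      by (rule Ck_bdd_fam_SucE[OF Suc.prems(1)]) (rule that)
    show ?thesis by (rule that[of "h'' 0"]) (use h''(2)[of 0] Ck_bdd_fam_at[OF h''(1), of 0] in simp_all)
  qed
  obtain G' where d: "Ck_bdd_fam k L G' S"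
    "\<And>s x. s \<in> {0..1} \<Longrightarrow> x \<in> S \<Longrightarrow> (G s has_real_derivative G' s x) (at x)"
    by (rule Ck_bdd_fam_SucE[OF Suc.prems(2)]) (rule that)
  have nn: "0 \<le> (2 ^ k * L) ^ k * M" "0 \<le> L" using Suc.prems(4,5) by auto
  note IH = Suc.IH[OF h'(2) Ck_bdd_fam_pred[OF Suc.prems(2)] Suc.prems(3,4,5)]
  have "Ck_bdd_fam k (2 ^ k * ((2 ^ k * L) ^ k * M) * L) (\<lambda>s x. h' (G s x) * G' s x) S"
    by (rule Ck_bdd_fam_mult[OF IH d(1) nn])
  moreover have "2 ^ k * ((2 ^ k * L) ^ k * M) * L \<le> ?K"
  proof -
    have "2 ^ k * ((2 ^ k * L) ^ k * M) * L = (2 ^ k * L) ^ Suc k * M" by simp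
    also have "\<dots> \<le> ?K" using Suc.prems(4,5) by (intro mult_right_mono power_mono) auto
    finally show ?thesis .
  qed
  ultimately have "Ck_bdd_fam k ?K (\<lambda>s x. h' (G s x) * G' s x) S"
    by (rule Ck_bdd_fam_mono) simp
  then show ?case 
    by (intro Ck_bdd_fam_SucI[OF 1 DERIV_chain2[OF h'(1)[OF Suc.prems(3)] d(2)]])
qed

lemma Ck_bdd_UN:
  "(\<And>i. i \<in> I \<Longrightarrow> open (S i)) \<Longrightarrow> (\<And>i. i \<in> I \<Longrightarrow> Ck_bdd k M g (S i)) \<Longrightarrow> Ck_bdd k M g (\<Union>i\<in>I. S i)"
proof (induction k arbitrary: g)
  have b: "bdd_cont_fam M (\<lambda>_. g) (\<Union>i\<in>I. S i)"
    if o: "\<And>i. i \<in> I \<Longrightarrow> open (S i)" and g: "\<And>i. i \<in> I \<Longrightarrow> Ck_bdd k M g (S i)" for k g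
  proof -
    have "continuous_on (\<Union>i\<in>I. S i) g" by (rule continuous_on_open_UN[OF o Ck_bdd_cont[OF g]])
    then show ?thesis using continuous_on_snd Ck_bdd_bound[OF g] by (auto simp: bdd_cont_fam_def)
  qed
  {
    case 0
    show ?case using b[of 0 g, OF 0] by simp
  next
    case (Suc k)
    have d: "Ck_bdd k M (deriv g) (\<Union>i\<in>I. S i)"
      by (rule Suc.IH[OF Suc.prems(1) Ck_bdd_deriv[OF Suc.prems(1,2)]])
    have D: "(g has_real_derivative deriv g x) (at x)" if x: "x \<in> (\<Union>i\<in>I. S i)" for x
    proof -
      obtain i where i: "i \<in> I" "x \<in> S i" using x by blast
      show ?thesis by (rule Ck_bdd_DERIV[OF Suc.prems(2)[OF i(1)] i(2)])
    qed
    show ?case by (rule Ck_bdd_fam_SucI[OF b[OF Suc.prems] D d])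
  }
qed

lemma Ck_bdd_Un:
  assumes "open S" "open T" "Ck_bdd k M g S" "Ck_bdd k M g T"
  shows "Ck_bdd k M g (S \<union> T)"
proof -
  have "Ck_bdd k M g (\<Union>i\<in>UNIV. if i then S else T)"
    by (rule Ck_bdd_UN) (use assms in auto)
  then show ?thesis by (simp add: UNIV_bool Un_commute)
qed

section \<open>Flows of small vector fields are close to the identity\<close>

text \<open>The integral of \<open>G r x\<close> over \<open>r \<in> {0..s}\<close>, written over a fixed interval so that the Leibniz rule for
  parameter integrals applies.\<close>

lemma Ck_bdd_fam_integral:
  assumes "open S"
  shows "Ck_bdd_fam k M G S \<Longrightarrow> Ck_bdd_fam k M (\<lambda>s x. integral {0..1} (\<lambda>u. s * G (s * u) x)) S"
proof (induction k arbitrary: G)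
  have cont: "continuous_on (({0..1} \<times> S) \<times> {0..1}) (\<lambda>q. fst (fst q) * G (fst (fst q) * snd q) (snd (fst q)))"
    if G: "bdd_cont_fam M G S" for G :: "real \<Rightarrow> real \<Rightarrow> real"
  proof -
    have "continuous_on (({0..1} \<times> S) \<times> {0..1}) (\<lambda>q. (\<lambda>p. G (fst p) (snd p)) (fst (fst q) * snd q, snd (fst q)))"
      by (rule continuous_on_compose2[where f = "\<lambda>q. (fst (fst q) * snd q, snd (fst q))" and t = "{0..1} \<times> S"])
         (use G in \<open>auto simp: bdd_cont_fam_def mult_le_one intro!: continuous_intros\<close>)
    then show ?thesis by (intro continuous_intros) auto
  qed
  have base: "bdd_cont_fam M (\<lambda>s x. integral {0..1} (\<lambda>u. s * G (s * u) x)) S"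
    if G: "bdd_cont_fam M G S" for G
  proof -
    have "continuous_on ({0..1} \<times> S) (\<lambda>p. integral (cbox 0 1) (\<lambda>u. fst p * G (fst p * u) (snd p)))"
      by (rule integral_continuous_on_param) (use cont[OF G] in \<open>simp add: case_prod_unfold\<close>)
    moreover have "\<bar>integral {0..1} (\<lambda>u. s * G (s * u) x)\<bar> \<le> M" if sx: "s \<in> {0..1}" "x \<in> S" for s x
    proof -
      have "continuous_on {0..1} (\<lambda>u. (\<lambda>q. fst (fst q) * G (fst (fst q) * snd q) (snd (fst q))) ((s, x), u))"
        by (rule continuous_on_compose2[OF cont[OF G]]) (use sx in \<open>auto intro!: continuous_intros\<close>)
      then have c: "continuous_on {0..1} (\<lambda>u. s * G (s * u) x)" by simp
      have "norm (s * G (s * u) x) \<le> M" if "u \<in> {0..1}" for u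
      proof -
        have "\<bar>G (s * u) x\<bar> \<le> M" using G sx that by (auto simp: bdd_cont_fam_def mult_le_one)
        moreover have "\<bar>s\<bar> \<le> 1" using sx by auto
        ultimately have "\<bar>s\<bar> * \<bar>G (s * u) x\<bar> \<le> 1 * M" by (intro mult_mono) auto
        then show ?thesis by (simp add: abs_mult)
      qed
      then have "norm (integral {0..1} (\<lambda>u. s * G (s * u) x)) \<le> M * (1 - 0)"
        by (intro integral_bound[OF _ c]) auto
      then show ?thesis by simp
    qed
    ultimately show ?thesis by (simp add: bdd_cont_fam_def)
  qed
  {
    case 0 then show ?case using base by simp
  next
    case (Suc k)
    obtain G' where G': "Ck_bdd_fam k M G' S"
      "\<And>s x. s \<in> {0..1} \<Longrightarrow> x \<in> S \<Longrightarrow> (G s has_real_derivative G' s x) (at x)"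
      by (rule Ck_bdd_fam_SucE[OF Suc.prems]) (rule that)
    have d: "((\<lambda>x. integral {0..1} (\<lambda>u. s * G (s * u) x)) has_real_derivative integral {0..1} (\<lambda>u. s * G' (s * u) x)) (at x)"
      if sx: "s \<in> {0..1}" "x \<in> S" for s x
    proof -
      obtain e where e: "e > 0" "ball x e \<subseteq> S" using assms sx openE by blast
      have su: "s * u \<in> {0..1}" if "u \<in> {0..1}" for u using sx that by (auto simp: mult_le_one)
      have "((\<lambda>x. integral (cbox 0 1) (\<lambda>u. s * G (s * u) x)) has_real_derivative integral (cbox 0 1) (\<lambda>u. s * G' (s * u) x)) (at x within ball x e)"
      proof (rule leibniz_rule_field_derivative)
        fix y u assume y: "y \<in> ball x e" "u \<in> cbox 0 (1::real)"
        have "(G (s * u) has_real_derivative G' (s * u) y) (at y)"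
          by (rule G'(2)) (use y su e in auto)
        then show "((\<lambda>y. s * G (s * u) y) has_real_derivative s * G' (s * u) y) (at y within ball x e)"
          by (intro DERIV_cmult) (rule has_field_derivative_at_within)
      next
        fix y assume y: "y \<in> ball x e"
        have "continuous_on {0..1} (\<lambda>u. (\<lambda>q. fst (fst q) * G (fst (fst q) * snd q) (snd (fst q))) ((s, y), u))"
          by (rule continuous_on_compose2[OF cont[OF Ck_bdd_famD0[OF Suc.prems]]]) (use sx y e in \<open>auto intro!: continuous_intros\<close>)
        then show "(\<lambda>u. s * G (s * u) y) integrable_on cbox 0 1" by (simp add: integrable_continuous_real)
      next
        have "continuous_on (ball x e \<times> {0..1}) (\<lambda>r. (\<lambda>q. fst (fst q) * G' (fst (fst q) * snd q) (snd (fst q))) ((s, fst r), snd r))"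
          by (rule continuous_on_compose2[OF cont[OF Ck_bdd_famD0[OF G'(1)]]]) (use sx e in \<open>auto intro!: continuous_intros\<close>)
        then show "continuous_on (ball x e \<times> cbox 0 1) (\<lambda>(y, u). s * G' (s * u) y)" by (simp add: case_prod_unfold)
      qed (use e in auto)
      then show ?thesis using at_within_open[of x "ball x e"] e by simp
    qed
    show ?case by (rule Ck_bdd_fam_SucI[OF base[OF Ck_bdd_famD0[OF Suc.prems]] d Suc.IH[OF G'(1)]])
  }
qed

lemma Ck_bdd_exp: "Ck_bdd k (exp R) exp {-R<..<R}"
proof (induction k)
  have b: "bdd_cont_fam (exp R) (\<lambda>_. exp) {-R<..<R}"
    by (auto simp: bdd_cont_fam_def intro!: continuous_intros)
  {
    case 0 show ?case using b by simp
  next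
    case (Suc k)
    show ?case by (rule Ck_bdd_fam_SucI[OF b DERIV_exp Suc.IH])
  }
qed

text \<open>The constant depends on \<open>k\<close> and on \<open>E\<close> only, and the second bound is linear in the size of the exponent.\<close>

lemma exp_minus_one_small:
  fixes k :: nat and E :: real
  assumes "0 \<le> E"
  obtains C where "1 \<le> C"
    "\<And>I S e. Ck_bdd_fam k e I S \<Longrightarrow> 0 \<le> e \<Longrightarrow> e \<le> E \<Longrightarrow> Ck_bdd_fam k C (\<lambda>s x. exp (I s x)) S"
    "\<And>I S e. Ck_bdd_fam k e I S \<Longrightarrow> 0 \<le> e \<Longrightarrow> e \<le> E \<Longrightarrow> Ck_bdd_fam k (C * e) (\<lambda>s x. exp (I s x) - 1) S"
proof -
  define R where "R = E + 1"
  define K where "K = (2 ^ k * (E + 1)) ^ k * exp R"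
  have "1 * 1 \<le> 2 ^ k * (E + 1)" using assms by (intro mult_mono one_le_power) auto
  then have "1 * exp R \<le> K" unfolding K_def by (intro mult_right_mono one_le_power) auto
  then have K1: "exp R \<le> K" by simp
  have R1: "1 \<le> exp R" using assms by (simp add: R_def)
  have K0: "0 \<le> K" using K1 R1 by linarith
  define C where "C = 2 ^ k * K"
  have "1 * K \<le> C" unfolding C_def using K0 by (intro mult_right_mono one_le_power) auto
  then have C1: "K \<le> C" by simp
  show ?thesis
  proof (rule that[of C])
    show "1 \<le> C" using C1 K1 R1 by linarith
    fix I S e assume I: "Ck_bdd_fam k e I S" and e: "0 \<le> e" "e \<le> E"
    have I1: "\<bar>I s x\<bar> \<le> e" if "s \<in> {0..1}" "x \<in> S" for s x using Ck_bdd_fam_bound[OF I that] .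
    have IR: "I s x \<in> {-R<..<R}" if "s \<in> {0..1}" "x \<in> S" for s x
      using I1[OF that] e by (auto simp: R_def)
    have eI: "Ck_bdd_fam k K (\<lambda>s x. exp (I s x)) S"
      unfolding K_def
      by (rule Ck_bdd_fam_comp[OF Ck_bdd_exp Ck_bdd_fam_mono[OF I _ order_refl] IR]) (use e assms in auto)
    show "Ck_bdd_fam k C (\<lambda>s x. exp (I s x)) S" by (rule Ck_bdd_fam_mono[OF eI C1 order_refl])
    have b: "bdd_cont_fam (C * e) (\<lambda>s x. exp (I s x) - 1) S"
    proof -
      have "\<bar>exp (I s x) - 1\<bar> \<le> C * e" if sx: "s \<in> {0..1}" "x \<in> S" for s x
      proof -
        let ?y = "I s x"
        have "\<bar>exp ?y - 1\<bar> \<le> exp R * \<bar>?y\<bar>"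
        proof (cases "?y \<ge> 0")
          case True
          have "exp (-?y) \<ge> 1 + (- ?y)" by (rule exp_ge_add_one_self)
          then have "1 \<ge> exp ?y * (1 - ?y)"
            using mult_left_mono[of "1 - ?y" "exp (-?y)" "exp ?y"] by (simp add: exp_minus)
          then have "exp ?y - 1 \<le> exp ?y * ?y" by (simp add: algebra_simps)
          also have "\<dots> \<le> exp R * ?y" using True IR[OF sx] by (intro mult_right_mono) auto
          finally show ?thesis using True by simp
        next
          case False
          have "1 - exp ?y \<le> - ?y" using exp_ge_add_one_self[of ?y] by linarith
          also have "\<dots> \<le> exp R * (- ?y)" using R1 False by (simp add: mult_le_cancel_right1)
          finally show ?thesis using False by simp
        qed
        also have "\<dots> \<le> C * e" using I1[OF sx] C1 K1 K0 by (intro mult_mono) auto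
        finally show ?thesis .
      qed
      moreover have "continuous_on ({0..1} \<times> S) (\<lambda>p. exp (I (fst p) (snd p)) - 1)"
        by (intro continuous_intros) (rule Ck_bdd_fam_cont[OF I])
      ultimately show ?thesis by (simp add: bdd_cont_fam_def)
    qed
    show "Ck_bdd_fam k (C * e) (\<lambda>s x. exp (I s x) - 1) S"
    proof (cases k)
      case 0 then show ?thesis using b by simp
    next
      case (Suc l)
      note I' = I[unfolded Suc] and eI' = eI[unfolded Suc]
      obtain J where J: "Ck_bdd_fam l e J S"
        "\<And>s x. s \<in> {0..1} \<Longrightarrow> x \<in> S \<Longrightarrow> (I s has_real_derivative J s x) (at x)"
        by (rule Ck_bdd_fam_SucE[OF I']) (rule that)
      have d: "((\<lambda>x. exp (I s x) - 1) has_real_derivative exp (I s x) * J s x) (at x)"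
        if "s \<in> {0..1}" "x \<in> S" for s x
        using J(2)[OF that] by (auto intro!: derivative_eq_intros)
      have "Ck_bdd_fam l (2 ^ l * K * e) (\<lambda>s x. exp (I s x) * J s x) S"
        by (rule Ck_bdd_fam_mult[OF Ck_bdd_fam_pred[OF eI'] J(1)]) (use K1 R1 e in linarith)+
      moreover have "2 ^ l * K * e \<le> C * e"
        unfolding C_def Suc using K0 e by (intro mult_right_mono) auto
      ultimately have "Ck_bdd_fam l (C * e) (\<lambda>s x. exp (I s x) * J s x) S"
        by (rule Ck_bdd_fam_mono) simp
      then show ?thesis unfolding Suc by (intro Ck_bdd_fam_SucI[OF b d])
    qed
  qed
qed

text \<open>If \<open>\<Phi>\<close> is the flow of \<open>\<zeta>\<close> and \<open>\<zeta>'\<close> the derivative of \<open>\<zeta>\<close>, this is the logarithm of the derivative of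
  \<open>\<Phi> s\<close> at \<open>x\<close>: the integral of \<open>\<zeta>'\<close> along the trajectory.\<close>

definition flow_exponent :: "(real \<Rightarrow> real) \<Rightarrow> (real \<Rightarrow> real \<Rightarrow> real) \<Rightarrow> real \<Rightarrow> real \<Rightarrow> real" where
  "flow_exponent \<zeta>' \<Phi> s x = integral {0..1} (\<lambda>u. s * \<zeta>' (\<Phi> (s * u) x))"

text \<open>The only properties of a flow that the estimates use. The trajectories of points of \<open>S\<close> stay in \<open>U\<close>, where the
  field will be controlled.\<close>

definition variational_flow :: "(real \<Rightarrow> real) \<Rightarrow> (real \<Rightarrow> real \<Rightarrow> real) \<Rightarrow> real \<Rightarrow> real set \<Rightarrow> real set \<Rightarrow> bool" where
  "variational_flow \<zeta>' \<Phi> L S U \<longleftrightarrow> open S \<and> continuous_on ({0..1} \<times> S) (\<lambda>p. \<Phi> (fst p) (snd p)) \<and>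
     (\<forall>s\<in>{0..1}. \<forall>x\<in>S. \<Phi> s x \<in> U \<and> \<bar>\<Phi> s x\<bar> \<le> L \<and>
        (\<Phi> s has_real_derivative exp (flow_exponent \<zeta>' \<Phi> s x)) (at x))"

text \<open>A bound on \<open>k\<close> derivatives of the flow gives one on \<open>k\<close> derivatives of \<open>flow_exponent\<close>, hence of the first
  derivative of the flow, which is one more derivative of the flow. Since the variational equation is used in solved
  form, no differential inequality is involved.\<close>

lemma flow_Ck_bdd:
  fixes k :: nat and E L :: real
  assumes E: "0 \<le> E" and L: "1 \<le> L"
  shows "\<exists>C\<ge>1. \<forall>\<zeta>' \<Phi> S U e. variational_flow \<zeta>' \<Phi> L S U \<longrightarrow> Ck_bdd k e \<zeta>' U \<longrightarrow> 0 \<le> e \<longrightarrow> e \<le> E \<longrightarrow>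
           Ck_bdd_fam k C \<Phi> S"
proof (induction k)
  case 0
  show ?case
    by (rule exI[of _ L]) (use L in \<open>auto simp: bdd_cont_fam_def variational_flow_def\<close>)
next
  case (Suc k)
  then obtain C where C: "C \<ge> 1" "\<And>\<zeta>' \<Phi> S U e. variational_flow \<zeta>' \<Phi> L S U \<Longrightarrow> Ck_bdd k e \<zeta>' U \<Longrightarrow> 0 \<le> e \<Longrightarrow> e \<le> E \<Longrightarrow>
           Ck_bdd_fam k C \<Phi> S" by blast
  \<comment> \<open>the constant with which \<open>Ck_bdd_fam_comp\<close> bounds \<open>\<zeta>' \<circ> \<Phi>\<close>\<close>
  define B where "B = (2 ^ k * C) ^ k"
  have "0 \<le> B * E" using C E by (simp add: B_def)
  then obtain D where D: "1 \<le> D" "\<And>I S e. Ck_bdd_fam k e I S \<Longrightarrow> 0 \<le> e \<Longrightarrow> e \<le> B * E \<Longrightarrow> Ck_bdd_fam k D (\<lambda>s x. exp (I s x)) S"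
    using exp_minus_one_small[of "B * E" k] by metis
  show ?case
  proof (rule exI[of _ "max L D"], intro conjI allI impI)
    show "1 \<le> max L D" using L by simp
    fix \<zeta>' \<Phi> S U e assume v: "variational_flow \<zeta>' \<Phi> L S U" and z: "Ck_bdd (Suc k) e \<zeta>' U" and e: "0 \<le> e" "e \<le> E"
    have zk: "Ck_bdd k e \<zeta>' U" by (rule Ck_bdd_fam_pred[OF z])
    note IH = C(2)[OF v zk e]
    have "Ck_bdd_fam k (B * e) (\<lambda>s x. \<zeta>' (\<Phi> s x)) S"
      unfolding B_def by (rule Ck_bdd_fam_comp[OF zk IH _ e(1) C(1)]) (use v in \<open>simp add: variational_flow_def\<close>)
    then have "Ck_bdd_fam k (B * e) (flow_exponent \<zeta>' \<Phi>) S"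
      unfolding flow_exponent_def[abs_def] by (rule Ck_bdd_fam_integral[rotated]) (use v in \<open>simp add: variational_flow_def\<close>)
    then have "Ck_bdd_fam k D (\<lambda>s x. exp (flow_exponent \<zeta>' \<Phi> s x)) S"
      by (rule D(2)) (use C e in \<open>auto simp: B_def intro!: mult_left_mono\<close>)
    then have m: "Ck_bdd_fam k (max L D) (\<lambda>s x. exp (flow_exponent \<zeta>' \<Phi> s x)) S"
      by (rule Ck_bdd_fam_mono) auto
    have b: "bdd_cont_fam (max L D) \<Phi> S"
      using v L unfolding bdd_cont_fam_def variational_flow_def by (simp add: max.coboundedI1)
    show "Ck_bdd_fam (Suc k) (max L D) \<Phi> S"
      by (rule Ck_bdd_fam_SucI[OF b _ m]) (use v in \<open>simp add: variational_flow_def\<close>)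
  qed
qed

text \<open>The bounds of \<open>flow_Ck_bdd\<close> are now inserted once more into the variational equation, keeping
  track of the factor \<open>e\<close> that the exponent carries.\<close>

lemma flow_near_identity:
  fixes k :: nat and E L :: real
  assumes E: "0 \<le> E" and L: "1 \<le> L"
  obtains C where "1 \<le> C"
    "\<And>\<zeta>' \<Phi> S U e. variational_flow \<zeta>' \<Phi> L S U \<Longrightarrow> Ck_bdd k e \<zeta>' U \<Longrightarrow> 0 \<le> e \<Longrightarrow> e \<le> E \<Longrightarrow>
           Ck_bdd k (C * e) (\<lambda>x. deriv (\<Phi> 1) x - 1) S \<and> Ck_bdd k C (\<Phi> 1) S"
proof -
  obtain C where C: "C \<ge> 1" "\<And>\<zeta>' \<Phi> S U e. variational_flow \<zeta>' \<Phi> L S U \<Longrightarrow> Ck_bdd k e \<zeta>' U \<Longrightarrow> 0 \<le> e \<Longrightarrow> e \<le> E \<Longrightarrow>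
           Ck_bdd_fam k C \<Phi> S" using flow_Ck_bdd[OF assms] by metis
  define B where "B = (2 ^ k * C) ^ k"
  have "1 * 1 \<le> 2 ^ k * C" using C(1) by (intro mult_mono one_le_power) auto
  then have B1: "1 \<le> B" unfolding B_def by (intro one_le_power) simp
  then have "0 \<le> B * E" using E by simp
  then obtain D where D: "1 \<le> D" "\<And>I S e. Ck_bdd_fam k e I S \<Longrightarrow> 0 \<le> e \<Longrightarrow> e \<le> B * E \<Longrightarrow> Ck_bdd_fam k (D * e) (\<lambda>s x. exp (I s x) - 1) S"
    using exp_minus_one_small[of "B * E" k] by metis
  define K where "K = max C (D * B)"
  show ?thesis
  proof (rule that[of K])
    show "1 \<le> K" using C(1) by (simp add: K_def)
    fix \<zeta>' \<Phi> S U e assume v: "variational_flow \<zeta>' \<Phi> L S U" and z: "Ck_bdd k e \<zeta>' U" and e: "0 \<le> e" "e \<le> E"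
    have oS: "open S" using v by (simp add: variational_flow_def)
    note F = C(2)[OF v z e]
    have "Ck_bdd_fam k (B * e) (\<lambda>s x. \<zeta>' (\<Phi> s x)) S"
      unfolding B_def by (rule Ck_bdd_fam_comp[OF z F _ e(1) C(1)]) (use v in \<open>simp add: variational_flow_def\<close>)
    then have "Ck_bdd_fam k (B * e) (flow_exponent \<zeta>' \<Phi>) S"
      unfolding flow_exponent_def[abs_def] by (rule Ck_bdd_fam_integral[rotated]) (rule oS)
    then have "Ck_bdd_fam k (D * (B * e)) (\<lambda>s x. exp (flow_exponent \<zeta>' \<Phi> s x) - 1) S"
      by (rule D(2)) (use B1 e in \<open>auto intro!: mult_left_mono\<close>)
    then have "Ck_bdd k (D * (B * e)) (\<lambda>x. exp (flow_exponent \<zeta>' \<Phi> 1 x) - 1) S"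
      using Ck_bdd_fam_at[of k _ _ S 1] by auto
    moreover have "D * (B * e) \<le> K * e" 
      using e by (simp add: K_def mult.assoc[symmetric] mult_right_mono)
    ultimately have "Ck_bdd k (K * e) (\<lambda>x. exp (flow_exponent \<zeta>' \<Phi> 1 x) - 1) S"
      by (rule Ck_bdd_fam_mono) simp
    then have 1: "Ck_bdd k (K * e) (\<lambda>x. deriv (\<Phi> 1) x - 1) S"
    proof (rule Ck_bdd_fam_cong[OF oS, rotated])
      fix x assume "x \<in> S"
      then have "(\<Phi> 1 has_real_derivative exp (flow_exponent \<zeta>' \<Phi> 1 x)) (at x)"
        using v by (simp add: variational_flow_def)
      then show "exp (flow_exponent \<zeta>' \<Phi> 1 x) - 1 = deriv (\<Phi> 1) x - 1" using DERIV_imp_deriv by metis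
    qed
    have "Ck_bdd k C (\<Phi> 1) S" using Ck_bdd_fam_at[OF F, of 1] by simp
    then have "Ck_bdd k K (\<Phi> 1) S" by (rule Ck_bdd_fam_mono) (auto simp: K_def)
    with 1 show "Ck_bdd k (K * e) (\<lambda>x. deriv (\<Phi> 1) x - 1) S \<and> Ck_bdd k K (\<Phi> 1) S" by blast
  qed
qed

section \<open>Smooth functions on open sets\<close>

text \<open>Smoothness is phrased through local bounds, so that its closure properties are inherited from those of
  \<open>Ck_bdd\<close>.\<close>

definition smooth_on :: "real set \<Rightarrow> (real \<Rightarrow> real) \<Rightarrow> bool" where
  "smooth_on S g \<longleftrightarrow> (\<forall>x\<in>S. \<forall>k. \<exists>V M. open V \<and> x \<in> V \<and> Ck_bdd k M g V)"

lemma smooth_onE: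
  assumes "smooth_on S g" "x \<in> S"
  obtains V M where "open V" "x \<in> V" "1 \<le> M" "Ck_bdd k M g V"
proof -
  obtain V M where V: "open V" "x \<in> V" "Ck_bdd k M g V" using assms unfolding smooth_on_def by blast
  have "Ck_bdd k (max 1 M) g V" by (rule Ck_bdd_fam_mono[OF V(3)]) auto
  with V show ?thesis using that[of V "max 1 M"] by simp
qed

lemma smooth_onI:
  assumes "\<And>x k. x \<in> S \<Longrightarrow> \<exists>V M. open V \<and> x \<in> V \<and> Ck_bdd k M g V"
  shows "smooth_on S g"
  using assms unfolding smooth_on_def by blast

lemma smooth_on_subset: "smooth_on S g \<Longrightarrow> T \<subseteq> S \<Longrightarrow> smooth_on T g"
  unfolding smooth_on_def by blast

lemma smooth_on_cong_local:
  assumes "\<And>x. x \<in> S \<Longrightarrow> \<exists>h T. open T \<and> x \<in> T \<and> smooth_on T h \<and> (\<forall>y\<in>T. g y = h y)"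
  shows "smooth_on S g"
proof (rule smooth_onI)
  fix x and k :: nat assume "x \<in> S"
  then obtain h T where h: "open T" "x \<in> T" "smooth_on T h" "\<And>y. y \<in> T \<Longrightarrow> g y = h y" using assms by meson
  obtain V M where V: "open V" "x \<in> V" "1 \<le> M" "Ck_bdd k M h V" using smooth_onE[OF h(3,2)] by blast
  have o: "open (V \<inter> T)" using V h by auto
  have "Ck_bdd k M h (V \<inter> T)" by (rule Ck_bdd_fam_mono[OF V(4)]) auto
  then have "Ck_bdd k M g (V \<inter> T)" by (rule Ck_bdd_fam_cong[OF o, rotated]) (simp add: h)
  then show "\<exists>V M. open V \<and> x \<in> V \<and> Ck_bdd k M g V" using o V(2) h(2) by blast
qed

lemma smooth_on_cong:
  assumes "open S" "smooth_on S h" "\<And>x. x \<in> S \<Longrightarrow> g x = h x"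
  shows "smooth_on S g"
  using assms by (intro smooth_on_cong_local) blast

lemma smooth_on_DERIV:
  assumes "smooth_on S g" "x \<in> S" shows "(g has_real_derivative deriv g x) (at x)"
proof -
  obtain V M where "x \<in> V" "Ck_bdd (Suc 0) M g V" using smooth_onE[OF assms, of "Suc 0"] by metis
  then show ?thesis using Ck_bdd_DERIV by blast
qed

lemma smooth_on_cont: "smooth_on S g \<Longrightarrow> continuous_on S g"
  by (meson DERIV_isCont continuous_at_imp_continuous_on smooth_on_DERIV)

lemma smooth_on_deriv:
  assumes "smooth_on S g" shows "smooth_on S (deriv g)"
proof (rule smooth_onI)
  fix x and k :: nat assume "x \<in> S"
  then obtain V M where "open V" "x \<in> V" "Ck_bdd (Suc k) M g V" using smooth_onE[OF assms, of x "Suc k"] by metis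
  then show "\<exists>V M. open V \<and> x \<in> V \<and> Ck_bdd k M (deriv g) V" using Ck_bdd_deriv by blast
qed

lemma smooth_on_const [simp]: "smooth_on S (\<lambda>x. a)"
proof (rule smooth_onI)
  fix x :: real and k :: nat
  have "Ck_bdd k \<bar>a\<bar> (\<lambda>x. a) UNIV" by (rule Ck_bdd_fam_const) simp
  then show "\<exists>V M. open V \<and> x \<in> V \<and> Ck_bdd k M (\<lambda>x. a) V" by blast
qed

lemma smooth_on_id [simp]: "smooth_on S (\<lambda>x. x)"
proof (rule smooth_onI)
  fix x :: real and k :: nat
  have "Ck_bdd k (\<bar>x\<bar> + 1) (\<lambda>x. x) (ball x 1)" 
    by (rule Ck_bdd_id) (auto simp: dist_real_def)
  then show "\<exists>V M. open V \<and> x \<in> V \<and> Ck_bdd k M (\<lambda>x. x) V" by (intro exI[of _ "ball x 1"]) auto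
qed

lemma smooth_on_add:
  assumes "smooth_on S g" "smooth_on S h" shows "smooth_on S (\<lambda>x. g x + h x)"
proof (rule smooth_onI)
  fix x and k :: nat assume x: "x \<in> S"
  obtain V M where V: "open V" "x \<in> V" "1 \<le> M" "Ck_bdd k M g V" using smooth_onE[OF assms(1) x] by blast
  obtain W L where W: "open W" "x \<in> W" "1 \<le> L" "Ck_bdd k L h W" using smooth_onE[OF assms(2) x] by blast
  have "Ck_bdd k (M + L) (\<lambda>x. g x + h x) (V \<inter> W)"
    by (rule Ck_bdd_fam_add[OF Ck_bdd_fam_mono[OF V(4)] Ck_bdd_fam_mono[OF W(4)]]) auto
  then show "\<exists>V M. open V \<and> x \<in> V \<and> Ck_bdd k M (\<lambda>x. g x + h x) V" using V W by blast
qed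

lemma smooth_on_mult:
  assumes "smooth_on S g" "smooth_on S h" shows "smooth_on S (\<lambda>x. g x * h x)"
proof (rule smooth_onI)
  fix x and k :: nat assume x: "x \<in> S"
  obtain V M where V: "open V" "x \<in> V" "1 \<le> M" "Ck_bdd k M g V" using smooth_onE[OF assms(1) x] by blast
  obtain W L where W: "open W" "x \<in> W" "1 \<le> L" "Ck_bdd k L h W" using smooth_onE[OF assms(2) x] by blast
  have "Ck_bdd k (2 ^ k * M * L) (\<lambda>x. g x * h x) (V \<inter> W)"
    by (rule Ck_bdd_fam_mult[OF Ck_bdd_fam_mono[OF V(4)] Ck_bdd_fam_mono[OF W(4)]]) (use V W in auto)
  then show "\<exists>V M. open V \<and> x \<in> V \<and> Ck_bdd k M (\<lambda>x. g x * h x) V" using V W by blast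
qed

lemma smooth_on_minus: "smooth_on S g \<Longrightarrow> smooth_on S (\<lambda>x. - g x)"
  using smooth_on_mult[OF smooth_on_const[of _ "-1"], of S g] by simp

lemma smooth_on_diff: "smooth_on S g \<Longrightarrow> smooth_on S h \<Longrightarrow> smooth_on S (\<lambda>x. g x - h x)"
  using smooth_on_add[OF _ smooth_on_minus, of S g h] by simp

lemma smooth_on_comp:
  assumes "smooth_on U h" "smooth_on S g" "\<And>x. x \<in> S \<Longrightarrow> g x \<in> U" shows "smooth_on S (\<lambda>x. h (g x))"
proof (rule smooth_onI)
  fix x and k :: nat assume x: "x \<in> S"
  obtain W L where W: "open W" "g x \<in> W" "1 \<le> L" "Ck_bdd k L h W" using smooth_onE[OF assms(1) assms(3)[OF x]] by blast
  obtain V M where V: "open V" "x \<in> V" "1 \<le> M" "Ck_bdd k M g V" using smooth_onE[OF assms(2) x] by blast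
  let ?V = "V \<inter> g -` W"
  have o: "open ?V" using Ck_bdd_cont[OF V(4)] V(1) W(1) continuous_on_open_vimage by (metis inf_commute)
  have "Ck_bdd k M g ?V" by (rule Ck_bdd_fam_mono[OF V(4)]) auto
  then have "Ck_bdd k ((2 ^ k * M) ^ k * L) (\<lambda>x. h (g x)) ?V"
    by (rule Ck_bdd_fam_comp[OF W(4)]) (use V W in auto)
  then show "\<exists>V M. open V \<and> x \<in> V \<and> Ck_bdd k M (\<lambda>x. h (g x)) V" using o V W by (intro exI[of _ ?V]) auto
qed

text \<open>The values of an antiderivative are bounded on a compact ball by continuity; all other bounds are those of
  its derivative.\<close>

lemma smooth_on_antideriv:
  assumes "open S" "smooth_on S g" "\<And>x. x \<in> S \<Longrightarrow> (h has_real_derivative g x) (at x)"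
  shows "smooth_on S h"
proof (rule smooth_onI)
  fix x and k :: nat assume x: "x \<in> S"
  obtain V M where V: "open V" "x \<in> V" "1 \<le> M" "Ck_bdd k M g V" using smooth_onE[OF assms(2) x] by blast
  obtain e where e: "e > 0" "cball x e \<subseteq> V \<inter> S" using V assms(1) x open_contains_cball[of "V \<inter> S"] by blast
  have hS: "continuous_on S h" using assms(3) DERIV_isCont continuous_at_imp_continuous_on by blast
  have "compact (h ` cball x e)" by (rule compact_continuous_image) (use e in \<open>auto intro: continuous_on_subset[OF hS]\<close>)
  then obtain B where B: "\<And>y. y \<in> cball x e \<Longrightarrow> \<bar>h y\<bar> \<le> B"
    by (metis compact_imp_bounded bounded_iff image_eqI real_norm_def)
  let ?V = "ball x e" and ?M = "max M B"
  have sub: "?V \<subseteq> S" "?V \<subseteq> V" using e(2) ball_subset_cball by blast+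
  have b: "bdd_cont_fam ?M (\<lambda>_. h) ?V"
    using B continuous_on_snd[OF continuous_on_subset[OF hS sub(1)]] by (auto simp: bdd_cont_fam_def max.coboundedI2)
  have "Ck_bdd k ?M g ?V" by (rule Ck_bdd_fam_mono[OF V(4) _ sub(2)]) simp
  then have "Ck_bdd (Suc k) ?M h ?V" 
    by (intro Ck_bdd_fam_SucI[OF b, where G'="\<lambda>_. g"] assms(3)) (use sub in blast)+
  then have "Ck_bdd k ?M h ?V" by (rule Ck_bdd_fam_pred)
  then show "\<exists>V M. open V \<and> x \<in> V \<and> Ck_bdd k M h V" using e by (intro exI[of _ ?V]) auto
qed

lemma smooth_on_exp [simp]: "smooth_on S exp"
proof (rule smooth_onI)
  fix x :: real and k :: nat
  have "Ck_bdd k (exp (\<bar>x\<bar> + 1)) exp {-(\<bar>x\<bar> + 1)<..<\<bar>x\<bar> + 1}" by (rule Ck_bdd_exp)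
  then show "\<exists>V M. open V \<and> x \<in> V \<and> Ck_bdd k M exp V" 
    by (intro exI[of _ "{-(\<bar>x\<bar> + 1)<..<\<bar>x\<bar> + 1}"]) auto
qed

lemma Ck_bdd_sin_cos: "Ck_bdd k 1 sin UNIV \<and> Ck_bdd k 1 cos UNIV"
proof (induction k)
  have b: "bdd_cont_fam 1 (\<lambda>_. sin) UNIV" "bdd_cont_fam 1 (\<lambda>_. cos) UNIV"
    by (auto simp: bdd_cont_fam_def intro!: continuous_intros)
  {
    case 0 show ?case using b by simp
  next
    case (Suc k)
    have "Ck_bdd k (\<bar>-1\<bar> * 1) (\<lambda>x. (-1) * sin x) UNIV" by (rule Ck_bdd_fam_cmult) (use Suc in blast)
    then have m: "Ck_bdd k 1 (\<lambda>x. - sin x) UNIV" by simp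
    show ?case using Ck_bdd_fam_SucI[OF b(1) DERIV_sin] Ck_bdd_fam_SucI[OF b(2) DERIV_cos m] Suc by blast
  }
qed

lemma smooth_on_sin [simp]: "smooth_on S sin"
proof (rule smooth_onI)
  fix x :: real and k :: nat
  show "\<exists>V M. open V \<and> x \<in> V \<and> Ck_bdd k M sin V"
    using Ck_bdd_sin_cos[of k] by (intro exI[of _ UNIV] exI[of _ 1]) simp
qed

lemma smooth_on_cos [simp]: "smooth_on S cos"
proof (rule smooth_onI)
  fix x :: real and k :: nat
  show "\<exists>V M. open V \<and> x \<in> V \<and> Ck_bdd k M cos V"
    using Ck_bdd_sin_cos[of k] by (intro exI[of _ UNIV] exI[of _ 1]) simp
qed

lemma smooth_on_sin_comp: "smooth_on S g \<Longrightarrow> smooth_on S (\<lambda>x. sin (g x))"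
  by (rule smooth_on_comp[OF smooth_on_sin[of UNIV]]) auto

lemma smooth_on_cos_comp: "smooth_on S g \<Longrightarrow> smooth_on S (\<lambda>x. cos (g x))"
  by (rule smooth_on_comp[OF smooth_on_cos[of UNIV]]) auto

lemma smooth_on_inverse_fun: "smooth_on (- {0}) inverse"
proof (rule smooth_onI)
  fix x :: real and k :: nat assume x: "x \<in> - {0}"
  let ?V = "ball x (\<bar>x\<bar> / 2)"
  have "\<exists>M\<ge>0. Ck_bdd k M inverse ?V"
  proof (induction k)
    have nz: "y \<noteq> 0" "\<bar>inverse y\<bar> \<le> 2 / \<bar>x\<bar>" if "y \<in> ?V" for y
    proof -
      have "\<bar>x - y\<bar> < \<bar>x\<bar> / 2" using that by (simp add: dist_real_def)
      then have "\<bar>y\<bar> \<ge> \<bar>x\<bar> / 2" using abs_triangle_ineq2[of x y] by linarith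
      moreover show "y \<noteq> 0" using that x by (auto simp: dist_real_def)
      ultimately show "\<bar>inverse y\<bar> \<le> 2 / \<bar>x\<bar>" using x by (simp add: field_simps)
    qed
    have "continuous_on ?V inverse" using nz by (intro continuous_intros) auto
    then have b: "bdd_cont_fam (2 / \<bar>x\<bar>) (\<lambda>_. inverse) ?V"
      using continuous_on_snd nz(2) by (auto simp: bdd_cont_fam_def)
    {
      case 0 show ?case by (rule exI[of _ "2 / \<bar>x\<bar>"]) (use b in simp)
    next
      case (Suc k)
      then obtain M where M: "M \<ge> 0" "Ck_bdd k M inverse ?V" by blast
      let ?M = "max (2 / \<bar>x\<bar>) (2 ^ k * M * M)"
      have "Ck_bdd k (\<bar>-1\<bar> * (2 ^ k * M * M)) (\<lambda>y. (-1) * (inverse y * inverse y)) ?V"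
        by (intro Ck_bdd_fam_cmult Ck_bdd_fam_mult M)
      then have "Ck_bdd k ?M (\<lambda>y. (-1) * (inverse y * inverse y)) ?V" by (rule Ck_bdd_fam_mono) auto
      moreover have "bdd_cont_fam ?M (\<lambda>_. inverse) ?V" by (rule bdd_cont_fam_mono[OF b]) auto
      moreover have "(inverse has_real_derivative (-1) * (inverse y * inverse y)) (at y)" if "y \<in> ?V" for y
        using DERIV_inverse[OF nz(1)[OF that]] by (simp add: power2_eq_square numeral_2_eq_2)
      ultimately have "Ck_bdd (Suc k) ?M inverse ?V"
        by (intro Ck_bdd_fam_SucI[where G'="\<lambda>_ y. (-1) * (inverse y * inverse y)"])
      moreover have "0 \<le> ?M" by (simp add: max.coboundedI1)
      ultimately show ?case by blast
    }
  qed
  then show "\<exists>V M. open V \<and> x \<in> V \<and> Ck_bdd k M inverse V" using x by (intro exI[of _ ?V]) auto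
qed

lemma smooth_on_inverse:
  assumes "smooth_on S g" "\<And>x. x \<in> S \<Longrightarrow> g x \<noteq> 0" shows "smooth_on S (\<lambda>x. inverse (g x))"
  by (rule smooth_on_comp[OF smooth_on_inverse_fun assms(1)]) (use assms(2) in auto)

lemma smooth_on_divide:
  assumes "smooth_on S f" "smooth_on S g" "\<And>x. x \<in> S \<Longrightarrow> g x \<noteq> 0" shows "smooth_on S (\<lambda>x. f x / g x)"
  using smooth_on_mult[OF assms(1) smooth_on_inverse[OF assms(2,3)]] by (simp add: divide_inverse)

lemmas smooth_intros = smooth_on_const smooth_on_id smooth_on_add smooth_on_mult smooth_on_minus smooth_on_diff
  smooth_on_divide

text \<open>This turns qualitative smoothness into the constants on which later choices of parameters depend.\<close>

lemma smooth_on_compact_Ck_bdd: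
  assumes "smooth_on S g" "compact K" "K \<subseteq> S"
  obtains M V where "1 \<le> M" "open V" "K \<subseteq> V" "Ck_bdd k M g V"
proof -
  have "\<exists>V M. open V \<and> x \<in> V \<and> Ck_bdd k M g V" if "x \<in> K" for x
    using assms that unfolding smooth_on_def by blast
  then obtain V M where VM: "\<And>x. x \<in> K \<Longrightarrow> open (V x) \<and> x \<in> V x \<and> Ck_bdd k (M x) g (V x)" by metis
  have "K \<subseteq> (\<Union>x\<in>K. V x)" using VM by blast
  then obtain T where T: "T \<subseteq> K" "finite T" "K \<subseteq> (\<Union>x\<in>T. V x)"
    using compactE_image[OF assms(2), of K V] VM by metis
  have "\<exists>L\<ge>1. open (\<Union>x\<in>T. V x) \<and> Ck_bdd k L g (\<Union>x\<in>T. V x)" using T(2) T(1)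
  proof (induction T)
    case empty
    have "Ck_bdd k 1 g {}" by (induction k arbitrary: g) (auto simp: bdd_cont_fam_def Ck_bdd_fam.simps)
    then show ?case by auto
  next
    case (insert y T)
    then obtain L where L: "L \<ge> 1" "open (\<Union>x\<in>T. V x)" "Ck_bdd k L g (\<Union>x\<in>T. V x)" by blast
    have y: "open (V y)" "Ck_bdd k (M y) g (V y)" using VM insert.prems by auto
    have "Ck_bdd k (max L (M y)) g (V y \<union> (\<Union>x\<in>T. V x))"
      by (rule Ck_bdd_Un[OF y(1) L(2) Ck_bdd_fam_mono[OF y(2)] Ck_bdd_fam_mono[OF L(3)]]) auto
    with L y show ?case by (intro exI[of _ "max L (M y)"]) auto
  qed
  then show ?thesis using that T(3) by metis
qed

section \<open>The flow of a positive vector field on the half-line\<close>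

lemma power2_le_exp: assumes "0 \<le> (y::real)" shows "y ^ 2 \<le> exp y"
proof -
  \<comment> \<open>\<open>exp (y / 2) = exp 1 * exp (y / 2 - 1) \<ge> 2 * (y / 2)\<close>, then square\<close>
  have "2 \<le> exp (1::real)" using exp_ge_add_one_self[of 1] by simp
  moreover have "y / 2 \<le> exp (y / 2 - 1)" using exp_ge_add_one_self[of "y / 2 - 1"] by simp
  ultimately have "2 * (y / 2) \<le> exp 1 * exp (y / 2 - 1)" using assms by (intro mult_mono) auto
  then have "y \<le> exp (y / 2)" by (simp add: exp_add[symmetric])
  then have "y ^ 2 \<le> exp (y / 2) ^ 2" using assms by (intro power_mono) auto
  also have "\<dots> = exp y" by (simp add: power2_eq_square exp_add[symmetric])
  finally show ?thesis .
qed

lemma exp_minus_inverse_le: "0 < (x::real) \<Longrightarrow> exp (- 1 / x) \<le> x"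
  using exp_ge_add_one_self[of "1 / x"] by (simp add: exp_minus field_simps)

text \<open>The bound has two uses. It is at most \<open>2 * x\<close>, which makes the flow complete at both ends, and it
  makes trajectories near \<open>0\<close> almost stationary in the coordinate \<open>1 / x\<close>.\<close>

locale half_line_field =
  fixes \<xi> :: "real \<Rightarrow> real"
  assumes smooth: "smooth_on {0<..} \<xi>"
    and pos: "0 < x \<Longrightarrow> 0 < \<xi> x"
    and le_exp: "0 < x \<Longrightarrow> \<xi> x \<le> 2 * exp (- 1 / x)"
begin

text \<open>An Abel function of the field: it conjugates the flow to translations. It is determined up to an additive
  constant, which never matters.\<close>

definition A :: "real \<Rightarrow> real" where
  "A = (SOME A. \<forall>x>0. (A has_real_derivative 1 / \<xi> x) (at x))"

lemma DERIV_xi: "0 < x \<Longrightarrow> (\<xi> has_real_derivative deriv \<xi> x) (at x)"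
  using smooth_on_DERIV[OF smooth] by simp

lemma DERIV_A: assumes "0 < x" shows "(A has_real_derivative 1 / \<xi> x) (at x)"
proof -
  have "\<exists>A. \<forall>x. ereal 0 < ereal x \<longrightarrow> ereal x < \<infinity> \<longrightarrow> (A has_vector_derivative 1 / \<xi> x) (at x)"
  proof (rule einterval_antiderivative)
    fix x assume "ereal 0 < ereal x"
    then have "0 < x" by simp
    then show "isCont (\<lambda>x. 1 / \<xi> x) x"
      using DERIV_isCont[OF DERIV_xi] pos by (intro continuous_intros) (auto simp: less_imp_neq[symmetric])
  qed simp
  then have "\<exists>A. \<forall>x>0. (A has_real_derivative 1 / \<xi> x) (at x)"
    by (simp add: has_real_derivative_iff_has_vector_derivative)
  then show ?thesis using someI_ex[of "\<lambda>A. \<forall>x>0. (A has_real_derivative 1 / \<xi> x) (at x)"] assms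
    unfolding A_def by blast
qed

lemma A_less: assumes "0 < x" "x < y" shows "A x < A y"
proof (rule DERIV_pos_imp_increasing[OF assms(2)])
  fix z assume "x \<le> z" "z \<le> y"
  then show "\<exists>l. (A has_real_derivative l) (at z) \<and> l > 0"
    using DERIV_A[of z] pos[of z] assms by (intro exI[of _ "1 / \<xi> z"]) auto
qed

lemma A_less_iff: "0 < x \<Longrightarrow> 0 < y \<Longrightarrow> A x < A y \<longleftrightarrow> x < y"
  using A_less by (metis less_irrefl less_trans linorder_neqE_linordered_idom)

lemma A_eq_iff: "0 < x \<Longrightarrow> 0 < y \<Longrightarrow> A x = A y \<longleftrightarrow> x = y"
  using A_less by (metis less_irrefl linorder_neqE_linordered_idom)

text \<open>Comparison with the linear field \<open>2 * x\<close>, whose Abel function is \<open>ln x / 2\<close>; it yields surjectivity of \<open>A\<close>.\<close>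

lemma A_ln_mono: assumes "0 < x" "x \<le> y" shows "A x - ln x / 2 \<le> A y - ln y / 2"
proof (rule DERIV_nonneg_imp_nondecreasing[OF assms(2)])
  fix z assume z: "x \<le> z" "z \<le> y"
  have "\<xi> z \<le> 2 * z" using le_exp[of z] exp_minus_inverse_le[of z] z assms by simp
  then have "1 / (2 * z) \<le> 1 / \<xi> z" using pos[of z] z assms by (intro divide_left_mono mult_pos_pos) auto
  then have "0 \<le> 1 / \<xi> z - (1 / z) / 2" by simp
  moreover have "((\<lambda>x. A x - ln x / 2) has_real_derivative 1 / \<xi> z - (1 / z) / 2) (at z)"
    using z assms by (intro DERIV_diff DERIV_A DERIV_cdivide DERIV_ln_divide) auto
  ultimately show "\<exists>l. ((\<lambda>x. A x - ln x / 2) has_real_derivative l) (at z) \<and> l \<ge> 0" by blast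
qed

lemma continuous_A: "continuous_on {0<..} A"
  using DERIV_A DERIV_isCont by (auto intro!: continuous_at_imp_continuous_on)

lemma A_surj: obtains x where "0 < x" "A x = s"
proof -
  define d where "d = 2 * \<bar>s - A 1\<bar> + 1"
  have d0: "0 \<le> d" unfolding d_def by (intro add_nonneg_nonneg mult_nonneg_nonneg) auto
  have d2: "\<bar>s - A 1\<bar> \<le> d / 2" by (simp add: d_def)
  have "A (exp (- d)) - ln (exp (- d)) / 2 \<le> A 1 - ln 1 / 2" by (rule A_ln_mono) (use d0 in auto)
  then have "A (exp (- d)) + d / 2 \<le> A 1" by simp
  then have 1: "A (exp (- d)) \<le> s" using d2 by linarith
  have "A 1 - ln 1 / 2 \<le> A (exp d) - ln (exp d) / 2" by (rule A_ln_mono) (use d0 in auto)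
  then have "A 1 + d / 2 \<le> A (exp d)" by simp
  then have 2: "s \<le> A (exp d)" using d2 by linarith
  have "exp (- d) \<le> exp d" using d0 by simp
  moreover have "continuous_on {exp (- d)..exp d} A" 
    by (rule continuous_on_subset[OF continuous_A]) (auto intro: less_le_trans[OF exp_gt_zero])
  ultimately obtain x where "exp (- d) \<le> x" "A x = s" using IVT'[of A "exp (-d)" s "exp d"] 1 2 by blast
  then show ?thesis using that[of x] exp_gt_zero[of "- d"] by linarith
qed

definition B :: "real \<Rightarrow> real" where "B s = (THE x. 0 < x \<and> A x = s)"

lemma B: "0 < B s" "A (B s) = s"
proof -
  have "\<exists>!x. 0 < x \<and> A x = s" using A_surj[of s] A_eq_iff by metis
  from theI'[OF this] show "0 < B s" "A (B s) = s" by (simp_all add: B_def)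
qed

lemma B_A: "0 < x \<Longrightarrow> B (A x) = x"
  using B A_eq_iff by blast

lemma isCont_B: "isCont B s"
proof -
  have "isCont B (A (B s))"
  proof (rule isCont_inverse_function2[where f=A and g=B and x="B s" and a="B s / 2" and b="2 * B s"])
    show "B s / 2 < B s" "B s < 2 * B s" using B(1)[of s] by auto
    fix z assume "B s / 2 \<le> z" "z \<le> 2 * B s"
    then have "0 < z" using B(1)[of s] by linarith
    then show "B (A z) = z" "isCont A z" using B_A DERIV_isCont[OF DERIV_A] by auto
  qed
  then show ?thesis using B by simp
qed

lemma DERIV_B: "(B has_real_derivative \<xi> (B s)) (at s)"
proof -
  have "(B has_real_derivative inverse (1 / \<xi> (B s))) (at s)"
  proof (rule DERIV_inverse_function)
    show "(A has_real_derivative 1 / \<xi> (B s)) (at (B s))" by (rule DERIV_A[OF B(1)])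
    show "1 / \<xi> (B s) \<noteq> 0" using pos[OF B(1), of s] by simp
    show "s - 1 < s" "s < s + 1" by auto
  qed (use B isCont_B in auto)
  then show ?thesis by simp
qed

text \<open>The time-\<open>t\<close> map of the field. The value \<open>0\<close> off the open half-line makes \<open>0\<close> a fixed point.\<close>

definition F :: "real \<Rightarrow> real \<Rightarrow> real" where "F t x = (if 0 < x then B (A x + t) else 0)"

lemma F_pos: "0 < x \<Longrightarrow> 0 < F t x" by (simp add: F_def B)
lemma F_0 [simp]: "F t 0 = 0" by (simp add: F_def)
lemma F_nonneg: "0 \<le> F t x" by (simp add: F_def less_imp_le[OF B(1)])
lemma F_zero: "0 \<le> x \<Longrightarrow> F 0 x = x" by (auto simp: F_def B_A)
lemma A_F: "0 < x \<Longrightarrow> A (F t x) = A x + t" by (simp add: F_def B)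
lemma F_eqI: "0 < x \<Longrightarrow> 0 < y \<Longrightarrow> A y = A x + t \<Longrightarrow> F t x = y" by (metis A_F A_eq_iff F_pos)
lemma F_add: "F (s + t) x = F s (F t x)"
  by (cases "0 < x") (auto simp: F_def B B_A add_ac)

lemma DERIV_F_time: assumes "0 < x" shows "((\<lambda>t. F t x) has_real_derivative \<xi> (F t x)) (at t)"
proof -
  have "((\<lambda>t. B (A x + t)) has_real_derivative \<xi> (B (A x + t)) * (0 + 1)) (at t)"
    by (rule DERIV_chain2[OF DERIV_B]) (intro derivative_intros)
  then show ?thesis using assms by (simp add: F_def)
qed

lemma DERIV_F: assumes "0 < x" shows "(F t has_real_derivative \<xi> (F t x) / \<xi> x) (at x)"
proof -
  have "((\<lambda>x. B (A x + t)) has_real_derivative \<xi> (B (A x + t)) * (1 / \<xi> x + 0)) (at x)"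
    by (rule DERIV_chain2[OF DERIV_B]) (intro derivative_intros DERIV_A assms)
  then have "((\<lambda>x. B (A x + t)) has_real_derivative \<xi> (F t x) / \<xi> x) (at x)" using assms by (simp add: F_def)
  then show ?thesis
    by (rule has_field_derivative_transform_within_open[where S = "{0<..}"]) (use assms in \<open>auto simp: F_def\<close>)
qed

lemma deriv_F: "0 < x \<Longrightarrow> deriv (F t) x = \<xi> (F t x) / \<xi> x"
  by (rule DERIV_imp_deriv[OF DERIV_F])

lemma continuous_on_F: "continuous_on (UNIV \<times> {0<..}) (\<lambda>p. F (fst p) (snd p))"
proof -
  have "continuous_on (UNIV \<times> {0<..}) (\<lambda>p. A (snd p))"
    by (rule continuous_on_compose2[OF continuous_A]) (auto intro!: continuous_intros)
  then have "continuous_on (UNIV \<times> {0<..}) (\<lambda>p. A (snd p) + fst p)" by (intro continuous_intros)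
  then have "continuous_on (UNIV \<times> {0<..}) (\<lambda>p. B (A (snd p) + fst p))"
    by (rule continuous_on_compose2[rotated, where t=UNIV]) (auto intro!: continuous_at_imp_continuous_on isCont_B)
  then show ?thesis by (rule continuous_on_eq) (auto simp: F_def)
qed

text \<open>Bootstrapping on \<open>B' = \<xi> \<circ> B\<close>: each bound on \<open>k\<close> derivatives of \<open>B\<close> yields one on \<open>k + 1\<close> derivatives.\<close>

lemma smooth_on_B: "smooth_on UNIV B"
proof (rule smooth_onI)
  fix s :: real and k :: nat
  show "\<exists>V M. open V \<and> s \<in> V \<and> Ck_bdd k M B V"
  proof (induction k arbitrary: s)
    have b: "\<exists>M. bdd_cont_fam M (\<lambda>_. B) (ball s 1)" for s
    proof -
      have cB: "continuous_on T B" for T by (intro continuous_at_imp_continuous_on ballI isCont_B)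
      then have "compact (B ` cball s 1)" by (intro compact_continuous_image) auto
      then obtain M where "\<And>y. y \<in> cball s 1 \<Longrightarrow> \<bar>B y\<bar> \<le> M"
        by (metis compact_imp_bounded bounded_iff image_eqI real_norm_def)
      then have "bdd_cont_fam M (\<lambda>_. B) (ball s 1)"
        using continuous_on_snd[OF cB] ball_subset_cball[of s 1] unfolding bdd_cont_fam_def by blast
      then show ?thesis by blast
    qed
    {
      case 0
      obtain M where "bdd_cont_fam M (\<lambda>_. B) (ball s 1)" using b by blast
      then show ?case by (intro exI[of _ "ball s 1"] exI[of _ M]) simp
    next
      case (Suc k)
      obtain M where M: "bdd_cont_fam M (\<lambda>_. B) (ball s 1)" using b by blast
      obtain V L0 where V: "open V" "s \<in> V" and L0: "Ck_bdd k L0 B V" using Suc.IH[of s] by blast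
      define L where "L = max 1 L0"
      have L: "1 \<le> L" "Ck_bdd k L B V" using Ck_bdd_fam_mono[OF L0 _ order_refl] by (auto simp: L_def)
      have "B s \<in> {0<..}" using B(1) by simp
      then obtain W K where W: "open W" "B s \<in> W" "1 \<le> K" "Ck_bdd k K \<xi> W" using smooth_onE[OF smooth] by metis
      let ?V = "V \<inter> B -` W \<inter> ball s 1"
      have o: "open ?V" using V(1) W(1) isCont_B continuous_on_open_vimage[of UNIV B]
        by (intro open_Int) (auto intro!: continuous_at_imp_continuous_on simp: vimage_def)
      have "Ck_bdd k ((2 ^ k * L) ^ k * K) (\<lambda>s. \<xi> (B s)) ?V"
        by (rule Ck_bdd_fam_comp[OF W(4) Ck_bdd_fam_mono[OF L(2)]]) (use L W(3) in auto)
      then have "Ck_bdd k (max M ((2 ^ k * L) ^ k * K)) (\<lambda>s. \<xi> (B s)) ?V" by (rule Ck_bdd_fam_mono) auto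
      then have "Ck_bdd (Suc k) (max M ((2 ^ k * L) ^ k * K)) B ?V"
        by (intro Ck_bdd_fam_SucI[OF bdd_cont_fam_mono[OF M] DERIV_B]) auto
      then show ?case using o V(2) W(2) by (intro exI[of _ ?V] exI[of _ "max M ((2 ^ k * L) ^ k * K)"]) auto
    }
  qed
qed

lemma smooth_on_F: "smooth_on {0<..} (F t)"
proof -
  have "smooth_on {0<..} A"
  proof (rule smooth_on_antideriv)
    show "smooth_on {0<..} (\<lambda>x. 1 / \<xi> x)" by (intro smooth_intros smooth) (use pos in force)
  qed (auto intro: DERIV_A)
  then have "smooth_on {0<..} (\<lambda>x. B (A x + t))"
    by (intro smooth_on_comp[OF smooth_on_B] smooth_intros) auto
  then show ?thesis by (rule smooth_on_cong[rotated]) (auto simp: F_def)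
qed

lemma DERIV_ln_xi_F:
  assumes "0 < x"
  shows "((\<lambda>s. ln (\<xi> (F s x))) has_real_derivative deriv \<xi> (F s x)) (at s)"
proof -
  have "((\<lambda>s. \<xi> (F s x)) has_real_derivative deriv \<xi> (F s x) * \<xi> (F s x)) (at s)"
    by (rule DERIV_chain2[OF DERIV_xi DERIV_F_time]) (use assms F_pos in auto)
  then have "((\<lambda>s. ln (\<xi> (F s x))) has_real_derivative 1 / \<xi> (F s x) * (deriv \<xi> (F s x) * \<xi> (F s x))) (at s)"
    by (intro DERIV_chain2[OF DERIV_ln_divide]) (use pos[OF F_pos[OF assms]] in auto)
  then show ?thesis using pos[OF F_pos[OF assms], of s] by simp
qed

text \<open>Along a trajectory the logarithm of \<open>\<xi>\<close> has time derivative \<open>\<xi>'\<close>, so the derivative \<open>\<xi> (F t x) / \<xi> x\<close> of the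
  time-\<open>t\<close> map solves the variational equation.\<close>

lemma deriv_F_exponent:
  assumes "0 < x"
  shows "\<xi> (F (t * s) x) / \<xi> x = exp (flow_exponent (\<lambda>y. t * deriv \<xi> y) (\<lambda>s. F (t * s)) s x)"
proof -
  have "((\<lambda>u. s * (t * deriv \<xi> (F (t * (s * u)) x))) has_integral
      (ln (\<xi> (F (t * s * 1) x)) - ln (\<xi> (F (t * s * 0) x)))) {0..1}"
  proof (rule fundamental_theorem_of_calculus)
    fix u :: real assume "u \<in> {0..1}"
    have "((\<lambda>u. ln (\<xi> (F (t * s * u) x))) has_real_derivative deriv \<xi> (F (t * s * u) x) * (t * s * 1)) (at u)"
      by (rule DERIV_chain2[OF DERIV_ln_xi_F[OF assms] DERIV_cmult[OF DERIV_ident]])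
    then show "((\<lambda>u. ln (\<xi> (F (t * s * u) x))) has_vector_derivative s * (t * deriv \<xi> (F (t * (s * u)) x))) (at u within {0..1})"
      by (simp add: has_real_derivative_iff_has_vector_derivative[symmetric] has_field_derivative_at_within mult_ac)
  qed simp
  then have "flow_exponent (\<lambda>y. t * deriv \<xi> y) (\<lambda>s. F (t * s)) s x = ln (\<xi> (F (t * s) x)) - ln (\<xi> x)"
    unfolding flow_exponent_def by (simp only: integral_unique mult_1_right mult_zero_right F_zero[OF less_imp_le[OF assms]])
  also have "\<dots> = ln (\<xi> (F (t * s) x) / \<xi> x)" 
    using pos[OF assms] pos[OF F_pos[OF assms], of "t * s"] by (simp add: ln_div)
  finally show ?thesis using pos[OF assms] pos[OF F_pos[OF assms], of "t * s"] by simp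
qed

lemma variational_flow_F:
  assumes "open S" "S \<subseteq> {0<..}" "\<And>s x. s \<in> {0..1} \<Longrightarrow> x \<in> S \<Longrightarrow> F (t * s) x \<in> U" "U \<subseteq> {..L}"
  shows "variational_flow (\<lambda>y. t * deriv \<xi> y) (\<lambda>s. F (t * s)) L S U"
  unfolding variational_flow_def
proof (intro conjI ballI)
  have "continuous_on ({0..1} \<times> S) (\<lambda>q. (\<lambda>p. F (fst p) (snd p)) (t * fst q, snd q))"
    by (rule continuous_on_compose2[OF continuous_on_F]) (use assms in \<open>auto intro!: continuous_intros\<close>)
  then show "continuous_on ({0..1} \<times> S) (\<lambda>p. F (t * fst p) (snd p))" by simp
  fix s x assume sx: "s \<in> {0..(1::real)}" "x \<in> S"
  show "F (t * s) x \<in> U" using assms sx by blast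
  then show "\<bar>F (t * s) x\<bar> \<le> L" using assms(4) F_nonneg[of "t * s" x] by auto
  have "0 < x" using assms sx by auto
  then show "(F (t * s) has_real_derivative exp (flow_exponent (\<lambda>y. t * deriv \<xi> y) (\<lambda>s. F (t * s)) s x)) (at x)"
    using DERIV_F deriv_F_exponent by metis
qed (rule assms)

text \<open>The same computation, used as a mean value estimate.\<close>

lemma F_ratio:
  assumes "0 < x" "0 \<le> e" "\<And>s. \<bar>s\<bar> \<le> \<bar>t\<bar> \<Longrightarrow> \<bar>deriv \<xi> (F s x)\<bar> \<le> e"
  shows "\<bar>ln (\<xi> (F t x)) - ln (\<xi> x)\<bar> \<le> \<bar>t\<bar> * e"
proof -
  have "norm ((\<lambda>s. ln (\<xi> (F s x))) t - (\<lambda>s. ln (\<xi> (F s x))) 0) \<le> e * norm (t - 0)"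
  proof (rule field_differentiable_bound[where S = "{-\<bar>t\<bar>..\<bar>t\<bar>}"])
    fix s assume "s \<in> {-\<bar>t\<bar>..\<bar>t\<bar>}"
    then show "norm (deriv \<xi> (F s x)) \<le> e" using assms(3)[of s] by auto
    show "((\<lambda>s. ln (\<xi> (F s x))) has_field_derivative deriv \<xi> (F s x)) (at s within {-\<bar>t\<bar>..\<bar>t\<bar>})"
      by (rule has_field_derivative_at_within[OF DERIV_ln_xi_F[OF assms(1)]])
  qed auto
  then show ?thesis using assms(1) by (simp add: F_zero mult.commute)
qed

text \<open>The coordinate \<open>y = 1 / x\<close> moves with speed \<open>\<xi> * y\<^sup>2\<close>, at most \<open>2 * y\<^sup>2 * exp (- y)\<close>.\<close>

lemma inverse_F_dist:
  assumes x: "0 < x" and t: "\<bar>t\<bar> \<le> T" and e: "\<And>s. \<bar>s\<bar> \<le> T \<Longrightarrow> 2 * (1 / F s x) ^ 2 * exp (- (1 / F s x)) \<le> e"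
  shows "\<bar>1 / F t x - 1 / x\<bar> \<le> T * e"
proof -
  have T0: "0 \<le> T" using t by simp
  have "0 \<le> 2 * (1 / F 0 x) ^ 2 * exp (- (1 / F 0 x))" by simp
  then have e0: "0 \<le> e" using e[of 0] T0 by linarith
  have "norm ((\<lambda>s. 1 / F s x) t - (\<lambda>s. 1 / F s x) 0) \<le> e * norm (t - 0)"
  proof (rule field_differentiable_bound[where S = "{-T..T}"])
    fix s assume s: "s \<in> {-T..T}"
    have p: "0 < F s x" by (rule F_pos[OF x])
    have "((\<lambda>s. 1 / F s x) has_field_derivative - \<xi> (F s x) * (1 / F s x) ^ 2) (at s)"
      using DERIV_divide[OF DERIV_const DERIV_F_time[OF x], of s 1] p by (simp add: power2_eq_square divide_simps)
    then show "((\<lambda>s. 1 / F s x) has_field_derivative - \<xi> (F s x) * (1 / F s x) ^ 2) (at s within {-T..T})"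
      by (rule has_field_derivative_at_within)
    have "\<xi> (F s x) * (1 / F s x) ^ 2 \<le> 2 * exp (- (1 / F s x)) * (1 / F s x) ^ 2"
      using le_exp[OF p] by (intro mult_right_mono) auto
    also have "\<dots> \<le> e" using e[of s] s by (simp add: mult_ac abs_le_iff)
    finally show "norm (- \<xi> (F s x) * (1 / F s x) ^ 2) \<le> e" using pos[OF p] by (simp add: abs_mult)
  qed (use t in \<open>auto simp: abs_le_iff\<close>)
  also have "\<dots> \<le> T * e" using mult_right_mono[OF t e0] by (simp add: mult.commute)
  finally show ?thesis using x by (simp add: F_zero)
qed

lemma inverse_F_dist_crude: assumes "0 < x" "\<bar>t\<bar> \<le> T" shows "\<bar>1 / F t x - 1 / x\<bar> \<le> 2 * T"
proof -
  have "\<bar>1 / F t x - 1 / x\<bar> \<le> T * 2"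
  proof (rule inverse_F_dist[OF assms])
    fix s
    let ?y = "1 / F s x"
    have "0 \<le> ?y" using F_nonneg[of s x] by simp
    then have "?y ^ 2 * exp (- ?y) \<le> exp ?y * exp (- ?y)" by (intro mult_right_mono power2_le_exp) auto
    also have "\<dots> = 1" by (simp add: exp_minus)
    finally show "2 * ?y ^ 2 * exp (- ?y) \<le> 2" by simp
  qed
  then show ?thesis by simp
qed

text \<open>The crude bound first confines the trajectory to the region where the speed is at most \<open>e\<close>.\<close>

lemma inverse_F_dist_fine:
  assumes "0 < x" "\<bar>t\<bar> \<le> T" "Y + 2 * T \<le> 1 / x" "\<And>y. Y \<le> y \<Longrightarrow> 2 * y ^ 2 * exp (- y) \<le> e"
  shows "\<bar>1 / F t x - 1 / x\<bar> \<le> T * e"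
proof (rule inverse_F_dist[OF assms(1,2)])
  fix s assume "\<bar>s\<bar> \<le> T"
  then have "Y \<le> 1 / F s x" using inverse_F_dist_crude[OF assms(1), of s T] assms(3) by linarith
  then show "2 * (1 / F s x) ^ 2 * exp (- (1 / F s x)) \<le> e" by (rule assms(4))
qed

end

section \<open>Differentiability up to the boundary point and groups of diffeomorphisms\<close>

lemma C_k_on_SucI:
  assumes "\<And>x. x \<in> S \<Longrightarrow> (f has_real_derivative f' x) (at x within S)" "C_k_on k f' S"
  shows "C_k_on (Suc k) f S"
  unfolding C_k_on.simps by (rule exI[of _ f']) (use assms in simp)

lemma C_k_on_pred: "C_k_on (Suc k) f S \<Longrightarrow> C_k_on k f S"
proof (induction k arbitrary: f)
  case 0
  then obtain f' where "\<forall>x\<in>S. (f has_real_derivative f' x) (at x within S)" by auto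
  then show ?case using DERIV_continuous_on[of S f f'] by simp
next
  case (Suc k)
  then obtain f' where "\<forall>x\<in>S. (f has_real_derivative f' x) (at x within S)" "C_k_on (Suc k) f' S"
    by (subst (asm) C_k_on.simps(2)) blast
  then show ?case using C_k_on_SucI[OF _ Suc.IH[of f']] by blast
qed

lemma C_k_on_cong:
  assumes "\<And>x. x \<in> S \<Longrightarrow> f x = g x" "C_k_on k f S" shows "C_k_on k g S"
proof (cases k)
  case 0
  then show ?thesis using assms continuous_on_eq by (metis C_k_on.simps(1))
next
  case (Suc l)
  then obtain f' where f': "\<forall>x\<in>S. (f has_real_derivative f' x) (at x within S)" "C_k_on l f' S"
    using assms(2) by auto
  have "(g has_real_derivative f' x) (at x within S)" if "x \<in> S" for x
    by (rule has_field_derivative_transform_within[of f _ x S 1]) (use f' that assms(1) in auto)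
  then show ?thesis using Suc f' by auto
qed

lemma C_k_on_const: "C_k_on k (\<lambda>x. c) S"
  by (induction k arbitrary: c) (auto intro!: exI[of _ "\<lambda>_. 0"])

lemma C_k_on_id: "C_k_on k (\<lambda>x. x) S"
  by (cases k) (auto intro!: exI[of _ "\<lambda>_. 1"] C_k_on_const DERIV_ident)

lemma C_k_on_add: "C_k_on k f S \<Longrightarrow> C_k_on k g S \<Longrightarrow> C_k_on k (\<lambda>x. f x + g x) S"
proof (induction k arbitrary: f g)
  case (Suc k)
  obtain f' g' where d: "\<forall>x\<in>S. (f has_real_derivative f' x) (at x within S)" "C_k_on k f' S"
    "\<forall>x\<in>S. (g has_real_derivative g' x) (at x within S)" "C_k_on k g' S"
    using Suc.prems by auto
  then show ?case using Suc.IH[of f' g'] by (auto intro!: exI[of _ "\<lambda>x. f' x + g' x"] DERIV_add)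
qed (auto intro: continuous_on_add)

lemma C_k_on_mult: "C_k_on k f S \<Longrightarrow> C_k_on k g S \<Longrightarrow> C_k_on k (\<lambda>x. f x * g x) S"
proof (induction k arbitrary: f g)
  case (Suc k)
  obtain f' g' where d: "\<forall>x\<in>S. (f has_real_derivative f' x) (at x within S)" "C_k_on k f' S"
    "\<forall>x\<in>S. (g has_real_derivative g' x) (at x within S)" "C_k_on k g' S"
    using Suc.prems by auto
  have "C_k_on k (\<lambda>x. f' x * g x + g' x * f x) S"
    using d Suc.IH C_k_on_pred[OF Suc.prems(1)] C_k_on_pred[OF Suc.prems(2)] by (intro C_k_on_add) auto
  then show ?case using d by (auto intro!: exI[of _ "\<lambda>x. f' x * g x + g' x * f x"] DERIV_mult)
qed (auto intro: continuous_on_mult)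

lemma C_k_on_comp: "C_k_on k f T \<Longrightarrow> C_k_on k g S \<Longrightarrow> g ` S \<subseteq> T \<Longrightarrow> C_k_on k (\<lambda>x. f (g x)) S"
proof (induction k arbitrary: f)
  case 0 then show ?case by (auto intro: continuous_on_compose2)
next
  case (Suc k)
  obtain f' g' where d: "\<forall>x\<in>T. (f has_real_derivative f' x) (at x within T)" "C_k_on k f' T"
    "\<forall>x\<in>S. (g has_real_derivative g' x) (at x within S)" "C_k_on k g' S"
    using Suc.prems by auto
  have c: "C_k_on k (\<lambda>x. f' (g x) * g' x) S"
    by (rule C_k_on_mult[OF Suc.IH[OF d(2) C_k_on_pred[OF Suc.prems(2)] Suc.prems(3)] d(4)])
  have D: "((\<lambda>x. f (g x)) has_real_derivative f' (g x) * g' x) (at x within S)" if "x \<in> S" for x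
  proof -
    have "g x \<in> T" using Suc.prems(3) that by blast
    then have 1: "(f has_real_derivative f' (g x)) (at (g x) within g ` S)"
      by (intro DERIV_subset[OF bspec[OF d(1)] Suc.prems(3)])
    show ?thesis using DERIV_image_chain[OF 1 bspec[OF d(3) that]] unfolding o_def .
  qed
  show ?case by (rule C_k_on_SucI[OF D c])
qed

lemma DERIV_at_right_end:
  fixes g :: "real \<Rightarrow> real"
  assumes d: "\<And>x. 0 < x \<Longrightarrow> (g has_real_derivative g' x) (at x)"
    and g0: "(g \<longlongrightarrow> g 0) (at_right 0)" and g': "(g' \<longlongrightarrow> c) (at_right 0)"
  shows "(g has_real_derivative c) (at 0 within {0..})"
proof -
  have "((\<lambda>x. (g x - g 0) / x) \<longlongrightarrow> c) (at_right 0)"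
  proof (rule lhopital_right_0[where f'=g' and g'="\<lambda>_. 1"])
    show "((\<lambda>x. g x - g 0) \<longlongrightarrow> 0) (at_right 0)" using tendsto_diff[OF g0 tendsto_const[of "g 0"]] by simp
    show "\<forall>\<^sub>F x in at_right 0. ((\<lambda>x. g x - g 0) has_real_derivative g' x) (at x)"
      using eventually_at_right_less[of 0] by eventually_elim (auto intro!: derivative_eq_intros d)
  qed (use g' in \<open>auto intro!: tendsto_eq_intros simp: eventually_at_right_less eventually_at_filter\<close>)
  then show ?thesis by (simp add: has_field_derivative_iff at_within_Ici_at_right)
qed

lemma continuous_at_0I:
  fixes g :: "real \<Rightarrow> real"
  assumes "continuous_on {0<..} g" "(g \<longlongrightarrow> g 0) (at_right 0)" shows "continuous_on {0..} g"
proof -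
  have "continuous (at x within {0..}) g" if "0 \<le> x" for x
  proof (cases "x = 0")
    case True
    then show ?thesis using assms(2) by (simp add: continuous_within at_within_Ici_at_right)
  next
    case False
    then have "isCont g x" using assms(1) that by (simp add: continuous_on_eq_continuous_at)
    then show ?thesis by (rule continuous_at_imp_continuous_within)
  qed
  then show ?thesis by (simp add: continuous_on_eq_continuous_within)
qed

text \<open>If \<open>g\<close> is continuous at the boundary point and all derivatives of \<open>g - c * x\<close> tend to \<open>0\<close> there, the derivatives of \<open>g\<close>, extended by
  their limits, are derivatives of each other up to the boundary. The statement with a general slope \<open>c\<close> makes the
  induction work: the derivative satisfies the hypothesis with slope \<open>0\<close>.\<close>

lemma C_k_on_extend_to_0:
  "smooth_on {0<..} g \<Longrightarrow> (g \<longlongrightarrow> g 0) (at_right 0) \<Longrightarrow>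
    (\<And>k \<epsilon>. 0 < \<epsilon> \<Longrightarrow> \<exists>d>0. Ck_bdd k \<epsilon> (\<lambda>x. deriv g x - c) {0<..<d}) \<Longrightarrow> C_k_on k g {0..}"
proof (induction k arbitrary: g c)
  case 0
  then show ?case using continuous_at_0I smooth_on_cont by simp
next
  case (Suc k)
  let ?g = "\<lambda>x. if 0 < x then deriv g x else c"
  have lim: "(deriv g \<longlongrightarrow> c) (at_right 0)"
  proof (rule tendstoI)
    fix e :: real assume "0 < e"
    then obtain d where d: "0 < d" "Ck_bdd 0 (e / 2) (\<lambda>x. deriv g x - c) {0<..<d}" using Suc.prems(3)[of "e / 2" 0] by auto
    have "\<forall>\<^sub>F x in at_right 0. x \<in> {0<..<d}" using d(1) by (auto simp: eventually_at_right)
    then show "\<forall>\<^sub>F x in at_right 0. dist (deriv g x) c < e"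
    proof eventually_elim
      case (elim x)
      from Ck_bdd_bound[OF d(2) elim] show ?case using \<open>0 < e\<close> by (simp add: dist_real_def)
    qed
  qed
  have D: "(g has_real_derivative ?g x) (at x within {0..})" if "x \<in> {0..}" for x
  proof (cases "x = 0")
    case True
    then show ?thesis using DERIV_at_right_end[OF smooth_on_DERIV[OF Suc.prems(1)] Suc.prems(2) lim] by simp
  next
    case False
    then show ?thesis using smooth_on_DERIV[OF Suc.prems(1), of x] that by (auto intro: has_field_derivative_at_within)
  qed
  have c: "C_k_on k ?g {0..}"
  proof (rule Suc.IH)
    show "smooth_on {0<..} ?g" by (rule smooth_on_cong[OF _ smooth_on_deriv[OF Suc.prems(1)]]) auto
    have "\<forall>\<^sub>F x in at_right 0. deriv g x = ?g x" using eventually_at_right_less[of "0::real"] by eventually_elim simp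
    then show "(?g \<longlongrightarrow> ?g 0) (at_right 0)" using lim tendsto_cong by fastforce
    fix l and \<epsilon> :: real assume "0 < \<epsilon>"
    then obtain d where d: "0 < d" "Ck_bdd (Suc l) \<epsilon> (\<lambda>x. deriv g x - c) {0<..<d}" using Suc.prems(3) by blast
    have "Ck_bdd l \<epsilon> (deriv (\<lambda>x. deriv g x - c)) {0<..<d}" by (rule Ck_bdd_deriv[OF _ d(2)]) simp
    then have "Ck_bdd l \<epsilon> (\<lambda>x. deriv ?g x - 0) {0<..<d}"
    proof (rule Ck_bdd_fam_cong[rotated 2])
      fix x assume x: "x \<in> {0<..<d}"
      have a: "(deriv g has_real_derivative deriv (deriv g) x) (at x)"
        using smooth_on_DERIV[OF smooth_on_deriv[OF Suc.prems(1)], of x] x by simp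
      have "((\<lambda>x. deriv g x - c) has_real_derivative deriv (deriv g) x) (at x)"
        using DERIV_diff[OF a DERIV_const] by simp
      moreover have "(?g has_real_derivative deriv (deriv g) x) (at x)"
        by (rule has_field_derivative_transform_within_open[OF a, where S="{0<..}"]) (use x in auto)
      ultimately show "deriv (\<lambda>x. deriv g x - c) x = deriv ?g x - 0" by (simp add: DERIV_imp_deriv)
    qed simp
    with d(1) show "\<exists>d>0. Ck_bdd l \<epsilon> (\<lambda>x. deriv ?g x - 0) {0<..<d}" by blast
  qed
  show ?case by (rule C_k_on_SucI[OF D c])
qed

lemma C1_half_lineI:
  assumes "\<And>x. 0 < x \<Longrightarrow> (g has_real_derivative g' x) (at x)" "continuous_on {0<..} g'"
    "(g \<longlongrightarrow> g 0) (at_right 0)" "(g' \<longlongrightarrow> c) (at_right 0)"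
  shows "C_r_on 1 g {0..}"
proof -
  let ?g = "\<lambda>x. if 0 < x then g' x else c"
  have D: "(g has_real_derivative ?g x) (at x within {0..})" if "x \<in> {0..}" for x
    using DERIV_at_right_end[OF assms(1,3,4)] assms(1)[of x] that
    by (cases "x = 0") (auto intro: has_field_derivative_at_within)
  have c: "continuous_on {0..} ?g"
  proof (rule continuous_at_0I)
    show "continuous_on {0<..} ?g" by (rule continuous_on_eq[OF assms(2)]) auto
    have "\<forall>\<^sub>F x in at_right 0. g' x = ?g x" using eventually_at_right_less[of "0::real"] by eventually_elim simp
    then show "(?g \<longlongrightarrow> ?g 0) (at_right 0)" using assms(4) tendsto_cong by fastforce
  qed
  have 1: "C_k_on (Suc 0) g {0..}" by (rule C_k_on_SucI[OF D]) (simp_all add: c)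
  have "C_k_on k g {0..}" if "enat k \<le> 1" for k
  proof -
    have "k = 0 \<or> k = Suc 0" using that by (auto simp: one_enat_def)
    then show ?thesis by (elim disjE) (simp_all only: 1 C_k_on_pred[OF 1])
  qed
  then show ?thesis by (simp add: C_r_on_def)
qed

lemma inv_into_eqI:
  assumes "g \<in> Bij S" "y \<in> S" "g y = x" shows "inv_into S g x = y"
  using assms by (auto simp: Bij_def bij_betw_def)

lemma C_r_on_cong: "(\<And>x. x \<in> S \<Longrightarrow> f x = g x) \<Longrightarrow> C_r_on r f S \<Longrightarrow> C_r_on r g S"
  unfolding C_r_on_def using C_k_on_cong by blast

lemma C_r_on_comp: "C_r_on r f T \<Longrightarrow> C_r_on r g S \<Longrightarrow> g ` S \<subseteq> T \<Longrightarrow> C_r_on r (\<lambda>x. f (g x)) S"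
  unfolding C_r_on_def using C_k_on_comp by blast

text \<open>Inverses are \<open>C\<^sup>r\<close> by definition, so the chain rule is the only analytic ingredient.\<close>

lemma subgroup_Diff_half_line: "subgroup (Diff_half_line r) (BijGroup {0..})"
proof (rule group.subgroupI[OF group_BijGroup])
  show "Diff_half_line r \<subseteq> carrier (BijGroup {0..})" by (auto simp: Diff_half_line_def BijGroup_def)
  have "inv_into {0..} (\<lambda>x\<in>{0..}. x) x = x" if "x \<in> {0..}" for x :: real
    by (rule inv_into_eqI[OF id_Bij]) (use that in auto)
  then have "C_r_on r (\<lambda>x. x) {0..}" "C_r_on r (inv_into {0..} (\<lambda>x\<in>{0..}. x)) {0..}"
    by (auto simp: C_r_on_def C_k_on_id intro!: C_r_on_cong[of _ "\<lambda>x. x"] C_k_on_cong[OF _ C_k_on_id])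
  then have "(\<lambda>x\<in>{0..}. x) \<in> Diff_half_line r"
    unfolding Diff_half_line_def using id_Bij by (auto intro: C_r_on_cong[of _ "\<lambda>x. x"])
  then show "Diff_half_line r \<noteq> {}" by blast
  fix g assume g: "g \<in> Diff_half_line r"
  then have gB: "g \<in> Bij {0..}" and gC: "C_r_on r g {0..}" "C_r_on r (inv_into {0..} g) {0..}"
    by (auto simp: Diff_half_line_def)
  let ?h = "\<lambda>x\<in>{0..}. inv_into {0..} g x"
  have hB: "?h \<in> Bij {0..}" by (rule restrict_inv_into_Bij[OF gB])
  have "C_r_on r ?h {0..}" by (rule C_r_on_cong[OF _ gC(2)]) simp
  moreover have "inv_into {0..} ?h x = g x" if "x \<in> {0..}" for x
    by (rule inv_into_eqI[OF hB]) (use gB that Bij_imp_funcset[OF gB] in \<open>auto simp: Bij_def bij_betw_def\<close>)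
  then have "C_r_on r (inv_into {0..} ?h) {0..}" by (intro C_r_on_cong[OF _ gC(1)]) simp
  ultimately have "?h \<in> Diff_half_line r" using hB by (simp add: Diff_half_line_def)
  then show "inv\<^bsub>BijGroup {0..}\<^esub> g \<in> Diff_half_line r" using inv_BijGroup[OF gB] by simp
  fix k assume k: "k \<in> Diff_half_line r"
  then have kB: "k \<in> Bij {0..}" and kC: "C_r_on r k {0..}" "C_r_on r (inv_into {0..} k) {0..}"
    by (auto simp: Diff_half_line_def)
  have cB: "compose {0..} g k \<in> Bij {0..}" by (rule compose_Bij[OF gB kB])
  have mem: "inv_into {0..} g ` {0..} \<subseteq> {0..}" "k ` {0..} \<subseteq> {0..}"
    using gB kB by (auto simp: Bij_def bij_betw_def intro: inv_into_into) (metis atLeast_iff imageI inv_into_into)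
  have "C_r_on r (compose {0..} g k) {0..}"
    by (rule C_r_on_cong[OF _ C_r_on_comp[OF gC(1) kC(1) mem(2)]]) (simp add: compose_def)
  moreover have "inv_into {0..} (compose {0..} g k) x = inv_into {0..} k (inv_into {0..} g x)" if "x \<in> {0..}" for x
  proof (rule inv_into_eqI[OF cB])
    have y: "inv_into {0..} g x \<in> {0..}" using mem(1) that by blast
    then have z: "inv_into {0..} k (inv_into {0..} g x) \<in> {0..}" using kB by (metis Bij_def bij_betw_def Int_iff inv_into_into mem_Collect_eq)
    have "k (inv_into {0..} k (inv_into {0..} g x)) = inv_into {0..} g x"
      using y kB by (metis Bij_def bij_betw_def Int_iff f_inv_into_f mem_Collect_eq)
    moreover have "g (inv_into {0..} g x) = x"
      using that gB by (metis Bij_def bij_betw_def Int_iff f_inv_into_f mem_Collect_eq)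
    ultimately show "compose {0..} g k (inv_into {0..} k (inv_into {0..} g x)) = x"
      using z by (simp add: compose_def)
    show "inv_into {0..} k (inv_into {0..} g x) \<in> {0..}" by (rule z)
  qed
  then have "C_r_on r (inv_into {0..} (compose {0..} g k)) {0..}"
    by (intro C_r_on_cong[OF _ C_r_on_comp[OF kC(2) gC(2) mem(1)]]) simp
  ultimately have "compose {0..} g k \<in> Diff_half_line r" using cB by (simp add: Diff_half_line_def)
  then show "g \<otimes>\<^bsub>BijGroup {0..}\<^esub> k \<in> Diff_half_line r" using gB kB by (simp add: BijGroup_def)
qed

lemma subgroup_centralizer:
  assumes f: "f \<in> Bij {0..}" shows "subgroup (centralizer r f) (BijGroup {0..})"
proof -
  let ?G = "BijGroup {0..} :: (real \<Rightarrow> real) monoid"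
  interpret group ?G by (rule group_BijGroup)
  interpret D: subgroup "Diff_half_line r" ?G by (rule subgroup_Diff_half_line)
  have fc: "f \<in> carrier ?G" using f by (simp add: BijGroup_def)
  have eq: "centralizer r f = {g \<in> Diff_half_line r. g \<otimes>\<^bsub>?G\<^esub> f = f \<otimes>\<^bsub>?G\<^esub> g}"
    using f by (auto simp: centralizer_def BijGroup_def Diff_half_line_def)
  show ?thesis
  proof (rule subgroupI)
    show "centralizer r f \<subseteq> carrier ?G" using D.subset by (auto simp: eq)
    have "\<one>\<^bsub>?G\<^esub> \<in> centralizer r f" using fc by (simp add: eq)
    then show "centralizer r f \<noteq> {}" by blast
    fix g assume g: "g \<in> centralizer r f"
    then have gD: "g \<in> Diff_half_line r" "g \<otimes>\<^bsub>?G\<^esub> f = f \<otimes>\<^bsub>?G\<^esub> g" by (auto simp: eq)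
    have gc: "g \<in> carrier ?G" by (rule D.mem_carrier[OF gD(1)])
    have "inv\<^bsub>?G\<^esub> g \<otimes>\<^bsub>?G\<^esub> f = inv\<^bsub>?G\<^esub> g \<otimes>\<^bsub>?G\<^esub> (f \<otimes>\<^bsub>?G\<^esub> g) \<otimes>\<^bsub>?G\<^esub> inv\<^bsub>?G\<^esub> g"
      using gc fc by (simp add: m_assoc)
    also have "\<dots> = inv\<^bsub>?G\<^esub> g \<otimes>\<^bsub>?G\<^esub> (g \<otimes>\<^bsub>?G\<^esub> f) \<otimes>\<^bsub>?G\<^esub> inv\<^bsub>?G\<^esub> g" using gD by simp
    also have "\<dots> = f \<otimes>\<^bsub>?G\<^esub> inv\<^bsub>?G\<^esub> g" using gc fc by (simp add: m_assoc[symmetric])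
    finally show "inv\<^bsub>?G\<^esub> g \<in> centralizer r f" using gD D.m_inv_closed by (simp add: eq)
    fix k assume k: "k \<in> centralizer r f"
    then have kD: "k \<in> Diff_half_line r" "k \<otimes>\<^bsub>?G\<^esub> f = f \<otimes>\<^bsub>?G\<^esub> k" by (auto simp: eq)
    have kc: "k \<in> carrier ?G" by (rule D.mem_carrier[OF kD(1)])
    have "g \<otimes>\<^bsub>?G\<^esub> k \<otimes>\<^bsub>?G\<^esub> f = g \<otimes>\<^bsub>?G\<^esub> (f \<otimes>\<^bsub>?G\<^esub> k)" using gc kc fc kD by (simp add: m_assoc)
    also have "\<dots> = f \<otimes>\<^bsub>?G\<^esub> (g \<otimes>\<^bsub>?G\<^esub> k)" using gc kc fc gD by (simp add: m_assoc[symmetric])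
    finally show "g \<otimes>\<^bsub>?G\<^esub> k \<in> centralizer r f" using gD kD D.m_closed by (simp add: eq)
  qed
qed

lemma subgroup_centralizer_group:
  assumes f: "f \<in> Bij {0..}" and r: "1 \<le> r"
  shows "subgroup (centralizer r f) (centralizer_group 1 f)"
proof -
  have "centralizer r f \<subseteq> centralizer 1 f"
    using r by (auto simp: centralizer_def Diff_half_line_def C_r_on_def intro: order_trans)
  then show ?thesis unfolding centralizer_group_def
    by (intro group.subgroup_incl[OF group_BijGroup] subgroup_centralizer f)
qed

section \<open>The centralizer of the time-one map\<close>

context half_line_field
begin

definition flow :: "real \<Rightarrow> real \<Rightarrow> real" where "flow t = restrict (F t) {0..}"

lemma flow_eq: "0 \<le> x \<Longrightarrow> flow t x = F t x" by (simp add: flow_def)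

lemma flow_Bij: "flow t \<in> Bij {0..}"
proof -
  have "bij_betw (F t) {0..} {0..}"
    by (rule bij_betw_byWitness[where f' = "F (- t)"]) (auto simp: F_add[symmetric] F_zero F_nonneg)
  then show ?thesis by (simp add: Bij_def flow_def bij_betw_def inj_on_restrict_eq image_restrict_eq)
qed

lemma inv_into_flow: "x \<in> {0..} \<Longrightarrow> inv_into {0..} (flow t) x = F (- t) x"
  by (rule inv_into_eqI[OF flow_Bij]) (auto simp: flow_eq F_nonneg F_add[symmetric] F_zero)

lemma flow_in_Diff:
  assumes "C_r_on r (F t) {0..}" "C_r_on r (F (- t)) {0..}" shows "flow t \<in> Diff_half_line r"
proof -
  have "C_r_on r (flow t) {0..}" by (rule C_r_on_cong[OF _ assms(1)]) (simp add: flow_eq)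
  moreover have "C_r_on r (inv_into {0..} (flow t)) {0..}"
    by (rule C_r_on_cong[OF _ assms(2)]) (simp add: inv_into_flow)
  ultimately show ?thesis using flow_Bij by (simp add: Diff_half_line_def)
qed

lemma Diff_flowD: "flow t \<in> Diff_half_line r \<Longrightarrow> C_r_on r (F t) {0..}"
  by (auto simp: Diff_half_line_def flow_eq intro: C_r_on_cong[of _ "flow t"])

lemma flow_compose: "compose {0..} (flow s) (flow t) = flow (s + t)"
  by (auto simp: compose_def flow_def F_add F_nonneg)

lemma flow_commute: "compose {0..} (flow s) (flow t) = compose {0..} (flow t) (flow s)"
  by (simp add: flow_compose add.commute)

lemma flow_in_centralizer_iff: "flow t \<in> centralizer r (flow s) \<longleftrightarrow> flow t \<in> Diff_half_line r"
  by (auto simp: centralizer_def intro: flow_commute)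

lemma inj_flow: "inj flow"
proof (rule injI)
  fix s t assume "flow s = flow t"
  then have eq: "F s 1 = F t 1" using flow_eq[of 1 s] flow_eq[of 1 t] by simp
  have "A 1 + s = A (F s 1)" by (simp add: A_F)
  also have "\<dots> = A 1 + t" unfolding eq by (simp add: A_F)
  finally show "s = t" by simp
qed

lemma F_1_neq: "0 < x \<Longrightarrow> F 1 x \<noteq> x"
  using A_F[of x 1] by auto

lemma F_tendsto_0: "(F t \<longlongrightarrow> 0) (at_right 0)"
proof (rule tendstoI)
  fix e :: real assume e: "0 < e"
  \<comment> \<open>\<open>1 / x\<close> changes by at most \<open>2 * \<bar>t\<bar>\<close> in time \<open>t\<close>; likewise below\<close>
  let ?d = "1 / (1 / e + 2 * \<bar>t\<bar> + 1)"
  have p: "0 < 1 / e + 2 * \<bar>t\<bar> + 1" using e by (intro add_nonneg_pos add_nonneg_nonneg) auto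
  then have "0 < ?d" by simp
  then have "\<forall>\<^sub>F x in at_right 0. x \<in> {0<..<?d}" by (rule eventually_at_right_real)
  then show "\<forall>\<^sub>F x in at_right 0. dist (F t x) 0 < e"
  proof eventually_elim
    case (elim x)
    then have "1 / e + 2 * \<bar>t\<bar> + 1 < 1 / x" using p by (simp add: field_simps)
    moreover have "\<bar>1 / F t x - 1 / x\<bar> \<le> 2 * \<bar>t\<bar>" using elim by (intro inverse_F_dist_crude) auto
    ultimately have "1 / e < 1 / F t x" by linarith
    then have "F t x < e" using e F_pos[of x t] elim by (simp add: field_simps)
    then show ?case using F_pos[of x t] elim by simp
  qed
qed

end

text \<open>With this condition the field, extended by \<open>0\<close>, is \<open>C\<^sup>1\<close> on the closed half-line.\<close>

locale half_line_C1_field = half_line_field +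
  assumes deriv_tendsto_0: "(deriv \<xi> \<longlongrightarrow> 0) (at_right 0)"
begin

text \<open>The derivative of every time-\<open>t\<close> map tends to \<open>1\<close> at the boundary point. This is both the \<open>C\<^sup>1\<close>
  regularity of the flow and the key to the computation of the centralizer.\<close>

lemma xi_F_ratio_tendsto: "((\<lambda>x. \<xi> (F t x) / \<xi> x) \<longlongrightarrow> 1) (at_right 0)"
proof -
  have "((\<lambda>x. ln (\<xi> (F t x)) - ln (\<xi> x)) \<longlongrightarrow> 0) (at_right 0)"
  proof (rule tendstoI)
    fix e :: real assume e: "0 < e"
    define e' where "e' = e / (\<bar>t\<bar> + 1)"
    have t1: "0 < \<bar>t\<bar> + 1" by (intro add_nonneg_pos) auto
    have e': "0 < e'" using e t1 by (simp add: e'_def)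
    have "\<bar>t\<bar> * e' < (\<bar>t\<bar> + 1) * e'" using e' by (intro mult_strict_right_mono) auto
    also have "\<dots> = e" using t1 by (simp add: e'_def)
    finally have te: "\<bar>t\<bar> * e' < e" .
    have "\<forall>\<^sub>F x in at_right 0. dist (deriv \<xi> x) 0 < e'" using deriv_tendsto_0 e' by (rule tendstoD)
    then obtain d where d: "0 < d" "\<And>x. 0 < x \<Longrightarrow> x < d \<Longrightarrow> \<bar>deriv \<xi> x\<bar> < e'"
      unfolding eventually_at_right_field by auto
    let ?d = "1 / (1 / d + 2 * \<bar>t\<bar> + 1)"
    have p: "0 < 1 / d + 2 * \<bar>t\<bar> + 1" using d by (intro add_nonneg_pos add_nonneg_nonneg) auto
    then have "0 < ?d" by simp
    then have "\<forall>\<^sub>F x in at_right 0. x \<in> {0<..<?d}" by (rule eventually_at_right_real)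
    then show "\<forall>\<^sub>F x in at_right 0. dist (ln (\<xi> (F t x)) - ln (\<xi> x)) 0 < e"
    proof eventually_elim
      case (elim x)
      then have x: "0 < x" and i: "1 / d + 2 * \<bar>t\<bar> + 1 < 1 / x" using p by (simp_all add: field_simps)
      have "\<bar>ln (\<xi> (F t x)) - ln (\<xi> x)\<bar> \<le> \<bar>t\<bar> * e'"
      proof (rule F_ratio[OF x])
        fix s assume s: "\<bar>s\<bar> \<le> \<bar>t\<bar>"
        have "1 / d < 1 / F s x" using inverse_F_dist_crude[OF x s] i by linarith
        then have "F s x < d" using d F_pos[OF x, of s] by (simp add: field_simps)
        then show "\<bar>deriv \<xi> (F s x)\<bar> \<le> e'" using d(2)[of "F s x"] F_pos[OF x] by (simp add: less_imp_le)
      qed (use e' in simp)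
      with te show ?case by simp
    qed
  qed
  then have "((\<lambda>x. exp (ln (\<xi> (F t x)) - ln (\<xi> x))) \<longlongrightarrow> exp 0) (at_right 0)" by (rule tendsto_exp)
  moreover have "\<forall>\<^sub>F x in at_right 0. exp (ln (\<xi> (F t x)) - ln (\<xi> x)) = \<xi> (F t x) / \<xi> x"
    using eventually_at_right_less[of "0::real"]
    by eventually_elim (simp add: exp_diff pos F_pos)
  ultimately show ?thesis using tendsto_cong by fastforce
qed

definition \<xi>0 :: "real \<Rightarrow> real" where "\<xi>0 x = (if 0 < x then \<xi> x else 0)"

lemma xi_tendsto_0: "(\<xi> \<longlongrightarrow> 0) (at_right 0)"
proof (rule tendsto_sandwich[where f="\<lambda>_. 0" and h="\<lambda>x. 2 * x"])
  show "\<forall>\<^sub>F x in at_right 0. 0 \<le> \<xi> x" 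
    using eventually_at_right_less[of "0::real"] by eventually_elim (simp add: pos less_imp_le)
  show "\<forall>\<^sub>F x in at_right 0. \<xi> x \<le> 2 * x" using eventually_at_right_less[of "0::real"]
  proof eventually_elim
    case (elim x)
    then show ?case using le_exp[of x] exp_minus_inverse_le[of x] by linarith
  qed
qed (auto intro!: tendsto_eq_intros)

lemma C1_xi0: "C_r_on 1 \<xi>0 {0..}"
proof (rule C1_half_lineI[where g'="deriv \<xi>" and c=0])
  fix x :: real assume x: "0 < x"
  show "(\<xi>0 has_real_derivative deriv \<xi> x) (at x)"
    by (rule has_field_derivative_transform_within_open[OF DERIV_xi[OF x], where S="{0<..}"]) (use x in \<open>auto simp: \<xi>0_def\<close>)
next
  show "continuous_on {0<..} (deriv \<xi>)" by (rule smooth_on_cont[OF smooth_on_deriv[OF smooth]])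
  have "\<forall>\<^sub>F x in at_right 0. \<xi> x = \<xi>0 x" using eventually_at_right_less[of "0::real"] 
    by eventually_elim (simp add: \<xi>0_def)
  then show "(\<xi>0 \<longlongrightarrow> \<xi>0 0) (at_right 0)" using xi_tendsto_0 tendsto_cong by (fastforce simp: \<xi>0_def)
qed (rule deriv_tendsto_0)

lemma C1_F: "C_r_on 1 (F t) {0..}"
proof (rule C1_half_lineI[where g'="\<lambda>x. \<xi> (F t x) / \<xi> x" and c=1])
  have cF: "continuous_on {0<..} (F t)" by (intro continuous_at_imp_continuous_on ballI DERIV_isCont[OF DERIV_F]) simp
  have "continuous_on {0<..} (\<lambda>x. \<xi> (F t x))"
    by (rule continuous_on_compose2[OF smooth_on_cont[OF smooth] cF]) (auto simp: F_pos)
  then show "continuous_on {0<..} (\<lambda>x. \<xi> (F t x) / \<xi> x)"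
    by (rule continuous_on_divide[OF _ smooth_on_cont[OF smooth]]) (use pos in force)
qed (use DERIV_F F_tendsto_0 xi_F_ratio_tendsto in auto)

lemma flow_in_Diff1: "flow t \<in> Diff_half_line 1"
  by (rule flow_in_Diff[OF C1_F C1_F])

lemma is_flow_of_flow: "is_flow_of flow \<xi>0"
proof -
  have "((\<lambda>s. flow s x) has_real_derivative \<xi>0 (flow t x)) (at t)" if "0 \<le> x" for x t
  proof (cases "x = 0")
    case True
    then show ?thesis by (simp add: flow_eq \<xi>0_def)
  next
    case False
    then show ?thesis using DERIV_F_time[of x t] F_pos[of x t] that by (simp add: flow_eq \<xi>0_def)
  qed
  then show ?thesis unfolding is_flow_of_def by (auto simp: flow_def F_zero F_nonneg)
qed

lemma B_less_iff: "0 < x \<Longrightarrow> B s < x \<longleftrightarrow> s < A x"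
  using A_less_iff[OF B(1), of x s] B by simp

text \<open>In the coordinate \<open>A\<close> an element of the centralizer is a diffeomorphism \<open>P\<close> of the line commuting with the unit
  translation. Its derivative is periodic and can be read off at the fixed point \<open>0\<close> of \<open>g\<close>, hence is constant.\<close>

lemma centralizer_1_flow: "centralizer 1 (flow 1) = range flow"
proof
  show "range flow \<subseteq> centralizer 1 (flow 1)" by (auto simp: flow_in_centralizer_iff flow_in_Diff1)
  show "centralizer 1 (flow 1) \<subseteq> range flow"
  proof
    fix g assume "g \<in> centralizer 1 (flow 1)"
    then have gB: "g \<in> Bij {0..}" and gC: "C_r_on 1 g {0..}" and comm: "compose {0..} g (flow 1) = compose {0..} (flow 1) g"
      by (auto simp: centralizer_def Diff_half_line_def)
    have gbij: "bij_betw g {0..} {0..}" using gB by (simp add: Bij_def)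
    have gnn: "0 \<le> g x" if "0 \<le> x" for x using bij_betw_apply[OF gbij, of x] that by simp
    have gF: "g (F 1 x) = F 1 (g x)" if "0 \<le> x" for x
      using fun_cong[OF comm, of x] that gnn[OF that] F_nonneg[of 1 x] by (simp add: compose_def flow_eq)
    have g0: "g 0 = 0" using gF[of 0] F_1_neq[of "g 0"] gnn[of 0] by fastforce
    have gpos: "0 < g x" if "0 < x" for x
    proof -
      have "g x \<noteq> g 0" using gbij that by (auto simp: bij_betw_def inj_on_def)
      then show ?thesis using g0 gnn[of x] that by simp
    qed
    have "enat 1 \<le> 1" by (simp add: one_enat_def)
    then have "C_k_on 1 g {0..}" using gC unfolding C_r_on_def by blast
    then obtain g' where g': "\<And>x. 0 \<le> x \<Longrightarrow> (g has_real_derivative g' x) (at x within {0..})" "continuous_on {0..} g'"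
      by auto
    have Dg: "(g has_real_derivative g' x) (at x)" if "0 < x" for x
    proof -
      have "(g has_real_derivative g' x) (at x within {0<..})" by (rule DERIV_subset[OF g'(1)]) (use that in auto)
      then show ?thesis using that by (simp add: at_within_open[of x "{0<..}"])
    qed
    define P where "P s = A (g (B s))" for s
    define P' where "P' s = 1 / \<xi> (g (B s)) * (g' (B s) * \<xi> (B s))" for s
    have DP: "(P has_real_derivative P' s) (at s)" for s
      unfolding P_def P'_def
      by (intro DERIV_chain2[OF DERIV_A] DERIV_chain2[OF Dg] DERIV_B gpos B)
    have BF: "B (s + t) = F t (B s)" for s t by (simp add: F_def B)
    have P1: "P (s + 1) = P s + 1" for s
      unfolding P_def BF by (simp add: gF A_F gpos B less_imp_le)
    have Pn: "P (s - real n) = P s - real n" for s n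
    proof (induction n)
      case (Suc n)
      then show ?case using P1[of "s - real (Suc n)"] by simp
    qed simp
    have P'1: "P' (s + 1) = P' s" for s
    proof -
      have "((\<lambda>s. P (s + 1)) has_real_derivative P' (s + 1) * (1 + 0)) (at s)"
        by (rule DERIV_chain2[OF DP]) (intro derivative_intros)
      then have "((\<lambda>s. P s + 1) has_real_derivative P' (s + 1)) (at s)" by (simp add: P1)
      moreover have "((\<lambda>s. P s + 1) has_real_derivative P' s + 0) (at s)" by (intro derivative_intros DP)
      ultimately show ?thesis using DERIV_unique by fastforce
    qed
    have P'n: "P' (s - real n) = P' s" for s n
    proof (induction n)
      case (Suc n)
      then show ?case using P'1[of "s - real (Suc n)"] by simp
    qed simp
    \<comment> \<open>periodicity moves the evaluation point to \<open>s - n\<close>, that is, towards the fixed point\<close>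
    have P'const: "P' s = g' 0" for s
    proof -
      define X where "X n = B (s - real n)" for n :: nat
      have X0: "filterlim X (at_right 0) sequentially"
        unfolding filterlim_at
      proof (intro conjI)
        show "\<forall>\<^sub>F n in sequentially. X n \<in> {0<..} \<and> X n \<noteq> 0" using B(1) by (auto simp: X_def less_imp_neq[symmetric])
        show "X \<longlonglongrightarrow> 0"
        proof (rule tendstoI)
          fix e :: real assume e: "0 < e"
          obtain N where N: "s - A e < real N" using reals_Archimedean2 by blast
          have "dist (X n) 0 < e" if "N \<le> n" for n
          proof -
            have "s - real n < A e" using N that by linarith
            then show ?thesis using B_less_iff[OF e, of "s - real n"] B(1)[of "s - real n"] by (simp add: X_def)
          qed
          then show "\<forall>\<^sub>F n in sequentially. dist (X n) 0 < e" by (auto simp: eventually_sequentially)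
        qed
      qed
      \<comment> \<open>in the coordinate \<open>A\<close>, \<open>g\<close> displaces the whole orbit \<open>X\<close> by the same amount\<close>
      define d where "d = P s - s"
      have gX: "g (X n) = F d (X n)" for n
      proof (rule F_eqI[symmetric])
        show "A (g (X n)) = A (X n) + d" using Pn[of s n] by (simp add: X_def P_def[symmetric] B d_def)
      qed (auto simp: X_def B gpos)
      have "(g' \<longlongrightarrow> g' 0) (at_right 0)"
        using g'(2) by (simp add: continuous_on_def at_within_Ici_at_right[symmetric])
      then have "((\<lambda>x. g' x / (\<xi> (F d x) / \<xi> x)) \<longlongrightarrow> g' 0 / 1) (at_right 0)"
        by (intro tendsto_divide xi_F_ratio_tendsto) auto
      then have "((\<lambda>n. g' (X n) / (\<xi> (F d (X n)) / \<xi> (X n))) \<longlonglongrightarrow> g' 0 / 1)"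
        by (rule filterlim_compose[OF _ X0])
      moreover have "g' (X n) / (\<xi> (F d (X n)) / \<xi> (X n)) = P' s" for n
      proof -
        have "P' s = P' (s - real n)" by (simp only: P'n)
        also have "\<dots> = g' (X n) / (\<xi> (F d (X n)) / \<xi> (X n))" 
          unfolding P'_def X_def[symmetric] gX by simp
        finally show ?thesis by simp
      qed
      ultimately have "(\<lambda>n. P' s) \<longlonglongrightarrow> g' 0" by simp
      then show ?thesis using LIMSEQ_const_iff by blast
    qed
    have "((\<lambda>s. P s - g' 0 * s) has_real_derivative P' s - g' 0 * 1) (at s)" for s
      by (intro DERIV_diff DERIV_cmult DERIV_ident DP)
    then have "\<forall>s. ((\<lambda>s. P s - g' 0 * s) has_real_derivative 0) (at s)" by (simp add: P'const)
    then have c: "P s - g' 0 * s = P 0 - g' 0 * 0" for s by (rule DERIV_isconst_all)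
    have "g' 0 = 1" using c[of 1] P1[of 0] by simp
    then have Ps: "P s = s + P 0" for s using c[of s] by simp
    have "g x = F (P 0) x" if "0 \<le> x" for x
    proof (cases "x = 0")
      case False
      then have x: "0 < x" using that by simp
      show ?thesis using Ps[of "A x"] x by (intro F_eqI[symmetric]) (auto simp: P_def B_A gpos)
    qed (simp add: g0)
    then have "g = flow (P 0)" using gB by (intro extensionalityI[of _ "{0..}"]) (auto simp: Bij_def flow_def)
    then show "g \<in> range flow" by blast
  qed
qed

lemma is_one_param_centralizer_flow: "is_one_param_centralizer flow (flow 1)"
proof -
  have "flow \<in> iso real_add_group (centralizer_group 1 (flow 1))"
  proof (rule isoI)
    show "flow \<in> hom real_add_group (centralizer_group 1 (flow 1))"
    proof (rule homI)
      fix s t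
      show "flow s \<in> carrier (centralizer_group 1 (flow 1))"
        by (simp add: centralizer_group_def centralizer_1_flow)
      show "flow (s \<otimes>\<^bsub>real_add_group\<^esub> t) = flow s \<otimes>\<^bsub>centralizer_group 1 (flow 1)\<^esub> flow t"
        by (simp add: centralizer_group_def real_add_group_def BijGroup_def flow_Bij flow_compose)
    qed
    show "bij_betw flow (carrier real_add_group) (carrier (centralizer_group 1 (flow 1)))"
      using inj_flow by (simp add: bij_betw_def centralizer_group_def real_add_group_def centralizer_1_flow)
  qed
  then show ?thesis unfolding is_one_param_centralizer_def using C1_xi0 is_flow_of_flow by blast
qed

end

section \<open>Cutoffs, humps and dips\<close>

text \<open>The functions \<open>p (1 / y) * exp (- 1 / y)\<close>, extended by \<open>0\<close>, form a class that is closed under differentiation;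
  this proves smoothness at \<open>0\<close>.\<close>

definition flat_exp :: "real poly \<Rightarrow> real \<Rightarrow> real" where
  "flat_exp p y = (if y \<le> 0 then 0 else poly p (1 / y) * exp (- (1 / y)))"

lemma flat_exp_tendsto_0: "(flat_exp p \<longlongrightarrow> 0) (at 0)"
proof -
  have "((\<lambda>u. \<Sum>i\<le>degree p. coeff p i * (u ^ i / exp u)) \<longlongrightarrow> (\<Sum>i\<le>degree p. coeff p i * 0)) at_top"
    by (intro tendsto_sum tendsto_mult tendsto_const tendsto_power_div_exp_0)
  moreover have "(\<lambda>u. \<Sum>i\<le>degree p. coeff p i * (u ^ i / exp u)) = (\<lambda>u. poly p u * exp (- u))"
    by (simp add: poly_altdef sum_distrib_right exp_minus divide_inverse mult.assoc)
  ultimately have l: "((\<lambda>u. poly p u * exp (- u)) \<longlongrightarrow> 0) at_top" by simp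
  have "((\<lambda>y. poly p (inverse y) * exp (- inverse y)) \<longlongrightarrow> 0) (at_right 0)"
    by (rule filterlim_compose[OF l filterlim_inverse_at_top_right])
  moreover have "\<forall>\<^sub>F y in at_right 0. poly p (inverse y) * exp (- inverse y) = flat_exp p y"
    using eventually_at_right_less[of "0::real"] by eventually_elim (simp add: flat_exp_def inverse_eq_divide)
  ultimately have r: "(flat_exp p \<longlongrightarrow> 0) (at_right 0)" using tendsto_cong by fastforce
  have "\<forall>\<^sub>F y in at_left 0. 0 = flat_exp p y"
    by (auto simp: eventually_at_filter flat_exp_def)
  then have "(flat_exp p \<longlongrightarrow> 0) (at_left 0)" using tendsto_cong[of "\<lambda>_. 0" "flat_exp p" "at_left 0" 0] by simp
  with r show ?thesis by (simp add: filterlim_split_at)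
qed

lemma DERIV_flat_exp: "(flat_exp p has_real_derivative flat_exp ([:0, 0, 1:] * (p - pderiv p)) y) (at y)"
proof -
  consider "y < 0" | "y = 0" | "0 < y" by linarith
  then show ?thesis
  proof cases
    case 1
    have "((\<lambda>_. 0) has_real_derivative 0) (at y)" by simp
    then have "(flat_exp p has_real_derivative 0) (at y)"
      by (rule has_field_derivative_transform_within_open[where S="{..<0}"]) (use 1 in \<open>auto simp: flat_exp_def\<close>)
    then show ?thesis using 1 by (simp add: flat_exp_def)
  next
    case 2
    have "(\<lambda>h. flat_exp ([:0, 1:] * p) h) = (\<lambda>h. flat_exp p h / h)"
      by (rule ext) (auto simp: flat_exp_def)
    then have "((\<lambda>h. flat_exp p h / h) \<longlongrightarrow> 0) (at 0)" using flat_exp_tendsto_0 by metis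
    then show ?thesis using 2 by (simp add: has_field_derivative_iff flat_exp_def)
  next
    case 3
    define d where "d = - ((1 / y) ^ 2)"
    have i: "((\<lambda>y. 1 / y) has_real_derivative d) (at y)"
      using DERIV_inverse[of y] 3 by (simp add: d_def inverse_eq_divide power2_eq_square numeral_2_eq_2)
    have "((\<lambda>y. poly p (1 / y) * exp (- (1 / y))) has_real_derivative
       (poly (pderiv p) (1 / y) * d) * exp (- (1 / y)) + (exp (- (1 / y)) * (- d)) * poly p (1 / y)) (at y)"
      by (intro DERIV_mult DERIV_chain2[OF poly_DERIV i] DERIV_chain2[OF DERIV_exp DERIV_minus[OF i]])
    then have "((\<lambda>y. poly p (1 / y) * exp (- (1 / y))) has_real_derivative flat_exp ([:0, 0, 1:] * (p - pderiv p)) y) (at y)"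
      using 3 by (simp add: flat_exp_def d_def algebra_simps power2_eq_square)
    then show ?thesis
      by (rule has_field_derivative_transform_within_open[where S="{0<..}"]) (use 3 in \<open>auto simp: flat_exp_def\<close>)
  qed
qed

lemma smooth_on_flat_exp: "smooth_on S (flat_exp p)"
proof (rule smooth_onI)
  fix x :: real and k :: nat
  have "\<exists>M. Ck_bdd k M (flat_exp p) (ball x 1)"
  proof (induction k arbitrary: p)
    have b: "\<exists>M. bdd_cont_fam M (\<lambda>_. flat_exp p) (ball x 1)" for p
    proof -
      have c: "continuous_on UNIV (flat_exp p)"
        by (intro continuous_at_imp_continuous_on ballI DERIV_isCont[OF DERIV_flat_exp])
      then have "compact (flat_exp p ` cball x 1)" by (intro compact_continuous_image) (auto intro: continuous_on_subset)
      then obtain M where "\<And>y. y \<in> cball x 1 \<Longrightarrow> \<bar>flat_exp p y\<bar> \<le> M"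
        by (metis compact_imp_bounded bounded_iff image_eqI real_norm_def)
      then have "bdd_cont_fam M (\<lambda>_. flat_exp p) (ball x 1)"
        using continuous_on_snd[OF continuous_on_subset[OF c]] ball_subset_cball[of x 1] unfolding bdd_cont_fam_def by blast
      then show ?thesis by blast
    qed
    {
      case 0 show ?case using b by simp
    next
      case (Suc k)
      obtain M where M: "bdd_cont_fam M (\<lambda>_. flat_exp p) (ball x 1)" using b by blast
      obtain L where L: "Ck_bdd k L (flat_exp ([:0, 0, 1:] * (p - pderiv p))) (ball x 1)" using Suc.IH by blast
      have "Ck_bdd (Suc k) (max M L) (flat_exp p) (ball x 1)"
        by (rule Ck_bdd_fam_SucI[OF bdd_cont_fam_mono[OF M] DERIV_flat_exp Ck_bdd_fam_mono[OF L]]) auto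
      then show ?case by blast
    }
  qed
  then show "\<exists>V M. open V \<and> x \<in> V \<and> Ck_bdd k M (flat_exp p) V" by (intro exI[of _ "ball x 1"]) auto
qed

definition smooth_step :: "real \<Rightarrow> real" where
  "smooth_step z = flat_exp 1 z / (flat_exp 1 z + flat_exp 1 (1 - z))"

lemma flat_exp_1_nonneg: "0 \<le> flat_exp 1 z" by (simp add: flat_exp_def)

lemma smooth_step_denominator: "0 < flat_exp 1 z + flat_exp 1 (1 - z)"
proof (cases "0 < z")
  case True
  then have "0 < flat_exp 1 z" by (simp add: flat_exp_def)
  then show ?thesis using flat_exp_1_nonneg[of "1 - z"] by linarith
next
  case False
  then have "0 < flat_exp 1 (1 - z)" by (simp add: flat_exp_def)
  then show ?thesis using flat_exp_1_nonneg[of z] by linarith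
qed

lemma smooth_on_smooth_step: "smooth_on UNIV smooth_step"
  unfolding smooth_step_def[abs_def]
proof (intro smooth_on_divide smooth_on_add smooth_on_flat_exp)
  show "smooth_on UNIV (\<lambda>z. flat_exp 1 (1 - z))"
    by (rule smooth_on_comp[OF smooth_on_flat_exp[of UNIV]]) (auto intro: smooth_intros)
  show "flat_exp 1 z + flat_exp 1 (1 - z) \<noteq> 0" for z using smooth_step_denominator[of z] by simp
qed

lemma smooth_step_bounds: "0 \<le> smooth_step z" "smooth_step z \<le> 1"
  using smooth_step_denominator[of z] flat_exp_1_nonneg[of z] flat_exp_1_nonneg[of "1 - z"]
  by (simp_all add: smooth_step_def)

lemma smooth_step_0: "z \<le> 0 \<Longrightarrow> smooth_step z = 0"
  by (simp add: smooth_step_def flat_exp_def)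

lemma smooth_step_1: "1 \<le> z \<Longrightarrow> smooth_step z = 1"
  using smooth_step_denominator[of z] by (simp add: smooth_step_def flat_exp_def)

definition bump :: "real \<Rightarrow> real \<Rightarrow> real \<Rightarrow> real" where
  "bump a b z = smooth_step (z - a) * smooth_step (b - z)"

lemma smooth_on_bump: "smooth_on S (bump a b)"
  unfolding bump_def[abs_def]
  by (intro smooth_on_mult; rule smooth_on_comp[OF smooth_on_smooth_step]) (auto intro: smooth_intros)

lemma bump_bounds: "0 \<le> bump a b z" "bump a b z \<le> 1"
  using smooth_step_bounds by (auto simp: bump_def intro: mult_le_one)

lemma bump_0: "z \<le> a \<or> b \<le> z \<Longrightarrow> bump a b z = 0"
  by (auto simp: bump_def smooth_step_0)

lemma bump_1: "a + 1 \<le> z \<Longrightarrow> z \<le> b - 1 \<Longrightarrow> bump a b z = 1"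
  by (simp add: bump_def smooth_step_1)

text \<open>The \<open>n\<close>-th hump is the interval \<open>{hump_start n..hump_start n + 10}\<close> in the coordinate \<open>1 / x\<close>. Within a hump,
  \<open>z = 1 / x - hump_start n\<close> serves as coordinate: the dip is contained in \<open>{3..7}\<close>, its bottom, where the
  dip field is constant, contains \<open>{4..6}\<close>, the oscillation has full amplitude on \<open>{2..8}\<close> and vanishes outside \<open>{1..9}\<close>. Neighbouring humps are
  thus separated by intervals on which the field is \<open>exp (- 1 / x)\<close>.\<close>

definition hump_start :: "nat \<Rightarrow> real" where "hump_start n = 10 * (real n + 1)"

definition zone :: "nat \<Rightarrow> real \<Rightarrow> real \<Rightarrow> real set" where
  "zone n a b = {x. 0 < x \<and> a < 1 / x - hump_start n \<and> 1 / x - hump_start n < b}"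

lemma hump_start_ge: "10 \<le> hump_start n" by (simp add: hump_start_def)

lemma hump_start_Suc: "hump_start (Suc n) = hump_start n + 10" by (simp add: hump_start_def)

lemma smooth_on_inv: "smooth_on {0<..} (\<lambda>x. 1 / x - r)"
  by (intro smooth_intros) auto

lemma zone_pos: "zone n a b \<subseteq> {0<..}" by (auto simp: zone_def)

lemma zone_mono: "a' \<le> a \<Longrightarrow> b \<le> b' \<Longrightarrow> zone n a b \<subseteq> zone n a' b'" by (auto simp: zone_def)

lemma zone_eq:
  assumes "- 10 < a" "a < b" shows "zone n a b = {1 / (hump_start n + b)<..<1 / (hump_start n + a)}"
proof -
  have p: "0 < hump_start n + a" "0 < hump_start n + b" using assms hump_start_ge[of n] by linarith+
  have "x \<in> zone n a b \<longleftrightarrow> x \<in> {1 / (hump_start n + b)<..<1 / (hump_start n + a)}" for x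
  proof (cases "0 < x")
    case True
    then show ?thesis using p by (auto simp: zone_def field_simps)
  next
    case False
    moreover have "0 < 1 / (hump_start n + b)" using p by simp
    ultimately show ?thesis by (auto simp: zone_def simp del: zero_less_divide_1_iff)
  qed
  then show ?thesis by blast
qed

lemma open_zone: "open (zone n a b)"
proof -
  have "open ({0<..} \<inter> (\<lambda>x. 1 / x - hump_start n) -` {a<..<b})"
    using smooth_on_cont[OF smooth_on_inv[of "hump_start n"]] continuous_on_open_vimage[of "{0<..}" "\<lambda>x. 1 / x - hump_start n"]
    by (metis inf_commute open_greaterThan open_greaterThanLessThan)
  also have "{0<..} \<inter> (\<lambda>x. 1 / x - hump_start n) -` {a<..<b} = zone n a b" by (auto simp: zone_def)
  finally show ?thesis .
qed

lemma smooth_on_bump_inv: "smooth_on {0<..} (\<lambda>x. bump a b (1 / x - r))"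
  by (rule smooth_on_comp[OF smooth_on_bump[of UNIV] smooth_on_inv]) simp

lemma smooth_on_base: "smooth_on {0<..} (\<lambda>x. exp (- 1 / x))"
  by (rule smooth_on_comp[OF smooth_on_exp[of UNIV]]) (auto intro!: smooth_intros)

lemma half_line_field_base: "half_line_field (\<lambda>x. exp (- 1 / x))"
  by unfold_locales (rule smooth_on_base, simp, simp)

text \<open>Convex combination of \<open>exp (- 1 / x)\<close> and the constant \<open>c\<close>, the latter prevailing at the bottom of the dip.\<close>

definition dip_field :: "nat \<Rightarrow> real \<Rightarrow> real \<Rightarrow> real" where
  "dip_field n c x = exp (- 1 / x) + (c - exp (- 1 / x)) * bump 3 7 (1 / x - hump_start n)"

lemma smooth_on_dip_field: "smooth_on {0<..} (dip_field n c)"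
  unfolding dip_field_def[abs_def] by (intro smooth_intros smooth_on_base smooth_on_bump_inv)

lemma dip_field_pos: assumes "0 < c" shows "0 < dip_field n c x"
proof -
  let ?k = "bump 3 7 (1 / x - hump_start n)"
  have "dip_field n c x = (1 - ?k) * exp (- 1 / x) + ?k * c" by (simp add: dip_field_def algebra_simps)
  moreover have "0 \<le> (1 - ?k) * exp (- 1 / x)" "0 \<le> ?k * c" using bump_bounds assms by auto
  moreover have "0 < (1 - ?k) * exp (- 1 / x) \<or> 0 < ?k * c"
    using bump_bounds(2)[of 3 7 "1 / x - hump_start n"] assms by (cases "?k = 1") auto
  ultimately show ?thesis by linarith
qed

lemma dip_field_le: assumes "c \<le> exp (- hump_start n - 10)" shows "dip_field n c x \<le> exp (- 1 / x)"
proof (cases "7 \<le> 1 / x - hump_start n")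
  case False
  then have "exp (- hump_start n - 10) \<le> exp (- 1 / x)" by simp
  with assms have "c - exp (- 1 / x) \<le> 0" by linarith
  then have "(c - exp (- 1 / x)) * bump 3 7 (1 / x - hump_start n) \<le> 0"
    by (rule mult_nonpos_nonneg) (rule bump_bounds)
  then show ?thesis by (simp add: dip_field_def)
qed (simp add: dip_field_def bump_0)

lemma dip_field_outer: "x \<in> zone n a 3 \<or> x \<in> zone n 7 b \<Longrightarrow> dip_field n c x = exp (- 1 / x)"
  by (auto simp: dip_field_def zone_def bump_0)

lemma half_line_field_dip_field: assumes "0 < c" "c \<le> exp (- hump_start n - 10)" shows "half_line_field (dip_field n c)"
proof
  show "dip_field n c x \<le> 2 * exp (- 1 / x)" for x using dip_field_le[OF assms(2), of x] exp_gt_zero[of "-1/x"] by linarith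
qed (auto simp: smooth_on_dip_field dip_field_pos assms)

text \<open>All powers at once, because the derivative of a power of \<open>1 / x\<close> is a multiple of the next power.\<close>

lemma Ck_bdd_inverse_power:
  assumes "1 \<le> R" "\<And>x. x \<in> S \<Longrightarrow> 0 < x \<and> 1 / x \<le> R"
  shows "Ck_bdd k (real (m + k) ^ k * R ^ (m + k)) (\<lambda>x. (1 / x) ^ m) S"
proof (induction k arbitrary: m)
  have c: "continuous_on S (\<lambda>x. (1 / x) ^ m)" for m
    by (intro continuous_intros) (use assms(2) in force)
  have b: "bdd_cont_fam (real (m + k) ^ k * R ^ (m + k)) (\<lambda>_ x. (1 / x) ^ m) S" if "0 < m \<or> k = 0" for m k
  proof -
    have "\<bar>(1 / x) ^ m\<bar> \<le> real (m + k) ^ k * R ^ (m + k)" if x: "x \<in> S" for x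
    proof -
      have "\<bar>(1 / x) ^ m\<bar> \<le> 1 * R ^ m" using assms(2)[OF x] by (simp add: power_mono)
      also have "\<dots> \<le> real (m + k) ^ k * R ^ (m + k)" 
        using assms(1) \<open>0 < m \<or> k = 0\<close> by (intro mult_mono power_increasing) (auto intro: one_le_power)
      finally show ?thesis .
    qed
    then show ?thesis using continuous_on_snd[OF c] by (simp add: bdd_cont_fam_def)
  qed
  {
    case 0
    show ?case using b[of m 0] by simp
  next
    case (Suc k)
    show ?case
    proof (cases "m = 0")
      case True
      have "1 * 1 \<le> real (Suc k) ^ Suc k * R ^ Suc k" using assms(1) by (intro mult_mono one_le_power) auto
      then show ?thesis using True by (simp add: Ck_bdd_fam_const del: power_Suc)
    next
      case False
      have D: "((\<lambda>x. (1 / x) ^ m) has_real_derivative (- real m) * (1 / x) ^ Suc m) (at x)" if "x \<in> S" for x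
      proof -
        have x: "0 < x" using assms(2)[OF that] by simp
        have "((\<lambda>y. 1 / y) has_real_derivative - ((1 / x) ^ 2)) (at x)"
          using DERIV_inverse[of x] x by (simp add: inverse_eq_divide power2_eq_square numeral_2_eq_2)
        then have "((\<lambda>x. (1 / x) ^ m) has_real_derivative real m * ((1 / x) ^ (m - Suc 0) * (- ((1 / x) ^ 2)))) (at x)"
          by (rule DERIV_power[THEN DERIV_cong]) simp
        moreover have "real m * ((1 / x) ^ (m - Suc 0) * (- ((1 / x) ^ 2))) = (- real m) * (1 / x) ^ Suc m"
        proof -
          have "real m * (y ^ (m - Suc 0) * (- (y ^ 2))) = (- real m) * y ^ Suc m" for y :: real
            using False by (cases m) (simp_all add: power2_eq_square algebra_simps)
          then show ?thesis .
        qed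
        ultimately show ?thesis by simp
      qed
      have "Ck_bdd k (\<bar>- real m\<bar> * (real (Suc m + k) ^ k * R ^ (Suc m + k))) (\<lambda>x. (- real m) * (1 / x) ^ Suc m) S"
        by (rule Ck_bdd_fam_cmult[OF Suc.IH])
      moreover have "\<bar>- real m\<bar> * (real (Suc m + k) ^ k * R ^ (Suc m + k)) \<le> real (m + Suc k) ^ Suc k * R ^ (m + Suc k)"
      proof -
        have "real m * (real (Suc m + k) ^ k * R ^ (Suc m + k)) \<le> real (m + Suc k) * (real (Suc m + k) ^ k * R ^ (Suc m + k))"
          using assms(1) by (intro mult_right_mono) auto
        then show ?thesis by (simp add: mult_ac)
      qed
      ultimately have "Ck_bdd k (real (m + Suc k) ^ Suc k * R ^ (m + Suc k)) (\<lambda>x. (- real m) * (1 / x) ^ Suc m) S"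
        by (rule Ck_bdd_fam_mono) simp
      then show ?thesis using Ck_bdd_fam_SucI[OF b[of m "Suc k"] D] False by simp
    qed
  }
qed

lemma filterlim_hump_start: "filterlim hump_start at_top sequentially"
proof (rule filterlim_at_top_mono[OF filterlim_real_sequentially])
  show "\<forall>\<^sub>F n in sequentially. real n \<le> hump_start n" by (simp add: hump_start_def)
qed

text \<open>In the coordinate \<open>z\<close> of the hump the field is \<open>exp (- hump_start n)\<close> times a profile from a bounded set, since
  \<open>c * exp (hump_start n) \<le> 1\<close>. Passing back to \<open>x\<close> costs a power of \<open>hump_start n\<close>, which the exponential beats. The
  bound \<open>e\<close> does not depend on \<open>c\<close>, so that \<open>c\<close> may be chosen afterwards.\<close>

lemma dip_field_Ck_small:
  obtains e where "e \<longlonglongrightarrow> 0" "\<And>n. 0 \<le> e n"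
    "\<And>n c. 0 < c \<Longrightarrow> c \<le> exp (- hump_start n - 10) \<Longrightarrow> Ck_bdd k (e n) (dip_field n c) (zone n (-1) 11)"
proof -
  \<comment> \<open>the two profiles of which the field is a combination, on a neighbourhood of a hump\<close>
  let ?g1 = "\<lambda>z. exp (- z) * (1 - bump 3 7 z)" and ?g2 = "bump 3 7"
  have s1: "smooth_on UNIV ?g1"
    by (intro smooth_intros smooth_on_bump smooth_on_comp[OF smooth_on_exp[of UNIV]]) auto
  obtain M1 V1 where M1: "1 \<le> M1" "{-1..11} \<subseteq> V1" "Ck_bdd k M1 ?g1 V1"
    using smooth_on_compact_Ck_bdd[OF s1, of "{-1..11}"] by (metis compact_Icc subset_UNIV)
  obtain M2 V2 where M2: "1 \<le> M2" "{-1..11} \<subseteq> V2" "Ck_bdd k M2 ?g2 V2"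
    using smooth_on_compact_Ck_bdd[OF smooth_on_bump[of UNIV], of "{-1..11}"] by (metis compact_Icc subset_UNIV)
  define R where "R n = hump_start n + 11" for n
  have R1: "1 \<le> R n" for n using hump_start_ge[of n] by (simp add: R_def)
  \<comment> \<open>bounds the derivatives of the change of coordinates \<open>1 / x - hump_start n\<close>\<close>
  define L where "L n = real (1 + k) ^ k * R n ^ (1 + k) + hump_start n" for n
  have L_le: "L n \<le> (real (1 + k) ^ k + 1) * R n ^ (1 + k)" for n
  proof -
    have "hump_start n \<le> R n ^ 1" by (simp add: R_def)
    also have "\<dots> \<le> R n ^ (1 + k)" by (rule power_increasing) (auto simp: R1)
    finally show ?thesis by (simp add: L_def algebra_simps)
  qed
  have L1: "1 \<le> L n" for n
  proof -
    have "1 \<le> hump_start n" using hump_start_ge[of n] by simp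
    moreover have "0 \<le> real (1 + k) ^ k * R n ^ (1 + k)" using R1[of n] by simp
    ultimately show ?thesis unfolding L_def by linarith
  qed
  define C where "C = (2 ^ k * (real (1 + k) ^ k + 1)) ^ k * (M1 + M2) * exp 11"
  define e where "e n = C * (R n ^ ((1 + k) * k) / exp (R n))" for n
  have lim: "e \<longlonglongrightarrow> 0"
  proof -
    have "filterlim R at_top sequentially"
      by (rule filterlim_at_top_mono[OF filterlim_hump_start]) (simp add: R_def)
    then have "(\<lambda>n. R n ^ ((1 + k) * k) / exp (R n)) \<longlonglongrightarrow> 0"
      by (rule filterlim_compose[OF tendsto_power_div_exp_0])
    then have "(\<lambda>n. C * (R n ^ ((1 + k) * k) / exp (R n))) \<longlonglongrightarrow> C * 0" by (intro tendsto_intros)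
    then show ?thesis by (simp add: e_def[abs_def])
  qed
  have C0: "0 \<le> C" using M1 M2 by (simp add: C_def)
  have e0: "0 \<le> e n" for n using C0 R1[of n] by (simp add: e_def)
  have main: "Ck_bdd k (e n) (dip_field n c) (zone n (-1) 11)" if c: "0 < c" "c \<le> exp (- hump_start n - 10)" for n c
  proof -
    let ?S = "zone n (-1) 11" and ?a = "c * exp (hump_start n)"
    have "?a \<le> exp (- hump_start n - 10) * exp (hump_start n)" using c by (intro mult_right_mono) auto
    also have "\<dots> = exp (- 10)" by (simp add: exp_add[symmetric])
    also have "\<dots> \<le> 1" by simp
    finally have a: "0 \<le> ?a" "?a \<le> 1" using c by auto
    have "Ck_bdd k (M1 + \<bar>?a\<bar> * M2) (\<lambda>z. ?g1 z + ?a * ?g2 z) {-1..11}"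
      by (intro Ck_bdd_fam_add Ck_bdd_fam_cmult) (rule Ck_bdd_fam_mono[OF M1(3) _ M1(2)] Ck_bdd_fam_mono[OF M2(3) _ M2(2)], simp)+
    moreover have "M1 + \<bar>?a\<bar> * M2 \<le> M1 + M2"
      using a M2(1) mult_right_mono[of ?a 1 M2] by simp
    ultimately have g: "Ck_bdd k (M1 + M2) (\<lambda>z. ?g1 z + ?a * ?g2 z) {-1..11}" by (rule Ck_bdd_fam_mono) simp
    have "Ck_bdd k (real (1 + k) ^ k * R n ^ (1 + k)) (\<lambda>x. (1 / x) ^ 1) ?S"
      by (rule Ck_bdd_inverse_power[OF R1]) (auto simp: zone_def R_def)
    then have "Ck_bdd k (real (1 + k) ^ k * R n ^ (1 + k) + hump_start n) (\<lambda>x. (1 / x) ^ 1 + (- hump_start n)) ?S"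
      by (rule Ck_bdd_fam_add[OF _ Ck_bdd_fam_const]) (use hump_start_ge[of n] in simp)
    then have i: "Ck_bdd k (L n) (\<lambda>x. 1 / x - hump_start n) ?S" by (simp add: L_def)
    have comp: "Ck_bdd k ((2 ^ k * L n) ^ k * (M1 + M2)) (\<lambda>x. ?g1 (1 / x - hump_start n) + ?a * ?g2 (1 / x - hump_start n)) ?S"
      by (rule Ck_bdd_fam_comp[OF g i]) (use M1 M2 L1 in \<open>auto simp: zone_def\<close>)
    have "Ck_bdd k (\<bar>exp (- hump_start n)\<bar> * ((2 ^ k * L n) ^ k * (M1 + M2)))
       (\<lambda>x. exp (- hump_start n) * (?g1 (1 / x - hump_start n) + ?a * ?g2 (1 / x - hump_start n))) ?S"
      by (rule Ck_bdd_fam_cmult[OF comp])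
    moreover have "(\<lambda>x. exp (- hump_start n) * (?g1 (1 / x - hump_start n) + ?a * ?g2 (1 / x - hump_start n))) = dip_field n c"
    proof
      fix x
      have "exp (- hump_start n) * exp (- (1 / x - hump_start n)) = exp (- 1 / x)" by (simp add: exp_add[symmetric])
      moreover have "exp (- hump_start n) * ?a = c" by (simp add: exp_minus)
      ultimately show "exp (- hump_start n) * (?g1 (1 / x - hump_start n) + ?a * ?g2 (1 / x - hump_start n)) = dip_field n c x"
        unfolding dip_field_def by (simp only: distrib_left mult.assoc[symmetric]) (simp add: algebra_simps)
    qed
    moreover have "\<bar>exp (- hump_start n)\<bar> * ((2 ^ k * L n) ^ k * (M1 + M2)) \<le> e n"
    proof -
      have "(2 ^ k * L n) ^ k \<le> (2 ^ k * ((real (1 + k) ^ k + 1) * R n ^ (1 + k))) ^ k"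
        using L_le[of n] L1[of n] by (intro power_mono mult_left_mono) auto
      also have "\<dots> = (2 ^ k * (real (1 + k) ^ k + 1)) ^ k * R n ^ ((1 + k) * k)"
        by (simp only: power_mult_distrib power_mult[symmetric] mult.assoc[symmetric])
      finally have p: "(2 ^ k * L n) ^ k \<le> (2 ^ k * (real (1 + k) ^ k + 1)) ^ k * R n ^ ((1 + k) * k)" .
      have "exp (- hump_start n) * ((2 ^ k * L n) ^ k * (M1 + M2)) 
          \<le> exp (- hump_start n) * ((2 ^ k * (real (1 + k) ^ k + 1)) ^ k * R n ^ ((1 + k) * k) * (M1 + M2))"
        using p M1 M2 by (intro mult_left_mono mult_right_mono) auto
      also have "\<dots> = e n"
      proof -
        have eq: "exp (- hump_start n) = exp 11 / exp (R n)" by (simp add: R_def exp_diff[symmetric])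
        show ?thesis unfolding eq by (simp add: e_def C_def)
      qed
      finally show ?thesis by simp
    qed
    ultimately show ?thesis using Ck_bdd_fam_mono[OF _ _ order_refl] by metis
  qed
  show ?thesis using that[OF lim e0 main] .
qed

section \<open>The field on a single hump\<close>

text \<open>Normalized to vanish at \<open>z = 5\<close>, a point of the bottom of the dip; the phase of the oscillation is counted from
  there.\<close>

definition dip_abel :: "nat \<Rightarrow> real \<Rightarrow> real \<Rightarrow> real" where
  "dip_abel n c x = half_line_field.A (dip_field n c) x - half_line_field.A (dip_field n c) (1 / (hump_start n + 5))"

definition cutoff :: "nat \<Rightarrow> real \<Rightarrow> real" where "cutoff n x = bump 1 9 (1 / x - hump_start n)"

text \<open>This is \<open>dip_field * v'\<close> for the oscillation \<open>v = c * cutoff * sin (2 * pi * N * dip_abel)\<close>. Thus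
  \<open>dip_field / (1 + modulation)\<close> is the field with Abel function \<open>dip_abel + v\<close>.\<close>

definition modulation :: "nat \<Rightarrow> real \<Rightarrow> real \<Rightarrow> real \<Rightarrow> real" where
  "modulation n c N x = c * (dip_field n c x * deriv (cutoff n) x * sin (2 * pi * N * dip_abel n c x)
     + 2 * pi * N * cutoff n x * cos (2 * pi * N * dip_abel n c x))"

definition hump_field :: "nat \<Rightarrow> real \<Rightarrow> real \<Rightarrow> real \<Rightarrow> real" where
  "hump_field n c N x = dip_field n c x / (1 + modulation n c N x)"

lemma smooth_on_cutoff: "smooth_on {0<..} (cutoff n)"
  unfolding cutoff_def[abs_def] by (rule smooth_on_bump_inv)

lemma cutoff_core: assumes "x \<in> zone n 2 8" shows "cutoff n x = 1" "deriv (cutoff n) x = 0"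
proof -
  have 1: "cutoff n y = 1" if "y \<in> zone n 2 8" for y using that by (auto simp: cutoff_def zone_def intro!: bump_1)
  show "cutoff n x = 1" by (rule 1[OF assms])
  have "((\<lambda>_. 1) has_real_derivative 0) (at x)" by simp
  then have "(cutoff n has_real_derivative 0) (at x)"
    by (rule has_field_derivative_transform_within_open[OF _ open_zone assms]) (simp add: 1)
  then show "deriv (cutoff n) x = 0" by (rule DERIV_imp_deriv)
qed

lemma cutoff_far: assumes "x \<in> zone n a 1 \<or> x \<in> zone n 9 b" shows "cutoff n x = 0" "deriv (cutoff n) x = 0"
proof -
  let ?S = "zone n a 1 \<union> zone n 9 b"
  have 1: "cutoff n y = 0" if "y \<in> ?S" for y using that by (auto simp: cutoff_def zone_def intro!: bump_0)
  show "cutoff n x = 0" using 1 assms by blast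
  have "((\<lambda>_. 0) has_real_derivative 0) (at x)" by simp
  then have "(cutoff n has_real_derivative 0) (at x)"
    by (rule has_field_derivative_transform_within_open[where S="?S"]) (use assms 1 in \<open>auto simp: open_zone open_Un\<close>)
  then show "deriv (cutoff n) x = 0" by (rule DERIV_imp_deriv)
qed

context
  fixes n :: nat and c :: real
  assumes c: "0 < c" "c \<le> exp (- hump_start n - 10)"
begin

interpretation B: half_line_field "dip_field n c" by (rule half_line_field_dip_field[OF c])

lemma DERIV_dip_abel: "0 < x \<Longrightarrow> (dip_abel n c has_real_derivative 1 / dip_field n c x) (at x)"
  unfolding dip_abel_def[abs_def] using DERIV_diff[OF B.DERIV_A DERIV_const, of x] by simp

lemma smooth_on_dip_abel: "smooth_on {0<..} (dip_abel n c)"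
proof (rule smooth_on_antideriv)
  show "smooth_on {0<..} (\<lambda>x. 1 / dip_field n c x)" 
    by (intro smooth_intros smooth_on_dip_field) (use dip_field_pos[OF c(1)] in \<open>simp add: less_imp_neq[symmetric]\<close>)
qed (auto intro: DERIV_dip_abel)

lemma smooth_on_trig_dip_abel: "smooth_on {0<..} (\<lambda>x. sin (r * dip_abel n c x))" "smooth_on {0<..} (\<lambda>x. cos (r * dip_abel n c x))"
  by (intro smooth_on_sin_comp smooth_on_cos_comp smooth_on_mult smooth_on_const smooth_on_dip_abel)+

lemma smooth_on_modulation: "smooth_on {0<..} (modulation n c N)"
  unfolding modulation_def[abs_def]
  by (intro smooth_on_mult smooth_on_add smooth_on_const smooth_on_dip_field smooth_on_deriv smooth_on_cutoff smooth_on_trig_dip_abel)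

lemma dip_abel_base: "dip_abel n c (1 / (hump_start n + 5)) = 0" by (simp add: dip_abel_def)

lemma dip_abel_A: "half_line_field.A (dip_field n c) y = half_line_field.A (dip_field n c) x + t \<longleftrightarrow> dip_abel n c y = dip_abel n c x + t"
  by (auto simp: dip_abel_def)

end

lemma modulation_core: "x \<in> zone n 2 8 \<Longrightarrow> modulation n c N x = c * (2 * pi * N) * cos (2 * pi * N * dip_abel n c x)"
  by (simp add: modulation_def cutoff_core)

lemma modulation_far: "x \<in> zone n a 1 \<or> x \<in> zone n 9 b \<Longrightarrow> modulation n c N x = 0"
  using cutoff_far[of x n a b] by (simp add: modulation_def)

text \<open>Outside the dip the field is \<open>exp (- 1 / x)\<close>, and \<open>c\<close> enters the argument of sine and cosine only through an
  additive constant, which the addition theorems split off. Hence \<open>M\<close> does not depend on \<open>c\<close>, and a small \<open>c\<close> makes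
  the modulation as small as needed.\<close>

lemma modulation_outer_bound:
  assumes ab: "-1 \<le> a" "a < b" "b \<le> 11" "b \<le> 3 \<or> 7 \<le> a"
  obtains M where "1 \<le> M" "\<And>c. 0 < c \<Longrightarrow> c \<le> exp (- hump_start n - 10) \<Longrightarrow> Ck_bdd k (c * M) (modulation n c N) (zone n a b)"
proof -
  interpret B: half_line_field "\<lambda>x. exp (- 1 / x)" by (rule half_line_field_base)
  let ?b = "\<lambda>x::real. exp (- 1 / x)" and ?r = "2 * pi * N"
  have sA: "smooth_on {0<..} B.A"
  proof (rule smooth_on_antideriv)
    show "smooth_on {0<..} (\<lambda>x. 1 / ?b x)" by (intro smooth_intros smooth_on_base) simp
  qed (rule open_greaterThan, rule B.DERIV_A, simp)
  have st: "smooth_on {0<..} (\<lambda>x. sin (?r * B.A x))" "smooth_on {0<..} (\<lambda>x. cos (?r * B.A x))"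
    by (intro smooth_on_sin_comp smooth_on_cos_comp smooth_on_mult smooth_on_const sA)+
  \<comment> \<open>the modulation divided by \<open>c\<close>, for phase shift zero and for a quarter period\<close>
  define W1 where "W1 x = ?b x * deriv (cutoff n) x * sin (?r * B.A x) + ?r * cutoff n x * cos (?r * B.A x)" for x
  define W2 where "W2 x = ?b x * deriv (cutoff n) x * cos (?r * B.A x) - ?r * cutoff n x * sin (?r * B.A x)" for x
  have sW: "smooth_on {0<..} W1" "smooth_on {0<..} W2"
    unfolding W1_def[abs_def] W2_def[abs_def]
    by (intro smooth_on_mult smooth_on_add smooth_on_diff smooth_on_const smooth_on_base smooth_on_deriv smooth_on_cutoff st)+
  let ?K = "{1 / (hump_start n + b)..1 / (hump_start n + a)}"
  have Zeq: "zone n a b = {1 / (hump_start n + b)<..<1 / (hump_start n + a)}" using ab by (intro zone_eq) auto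
  then have ZK: "zone n a b \<subseteq> ?K" by auto
  have p: "0 < 1 / (hump_start n + b)" using ab hump_start_ge[of n] by simp
  have K: "compact ?K" "?K \<subseteq> {0<..}"
    by (rule compact_Icc) (rule subsetI, simp only: atLeastAtMost_iff greaterThan_iff, use p in linarith)
  obtain M1 V1 where M1: "1 \<le> M1" "?K \<subseteq> V1" "Ck_bdd k M1 W1 V1"
    using smooth_on_compact_Ck_bdd[OF sW(1) K] by metis
  obtain M2 V2 where M2: "1 \<le> M2" "?K \<subseteq> V2" "Ck_bdd k M2 W2 V2"
    using smooth_on_compact_Ck_bdd[OF sW(2) K] by metis
  show ?thesis
  proof (rule that[of "M1 + M2"])
    show "1 \<le> M1 + M2" using M1 M2 by simp
    fix c :: real assume c: "0 < c" "c \<le> exp (- hump_start n - 10)"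
    have bb: "dip_field n c x = ?b x" if "x \<in> zone n a b" for x
      using ab that by (intro dip_field_outer[where a=a and b=b]) (auto simp: zone_def)
    have "\<exists>\<theta>. \<forall>x\<in>zone n a b. dip_abel n c x - B.A x = \<theta>"
    proof (rule has_field_derivative_zero_constant)
      show "convex (zone n a b)" unfolding Zeq by (rule convex_real_interval)
      fix x assume x: "x \<in> zone n a b"
      then have "0 < x" by (simp add: zone_def)
      then have "((\<lambda>x. dip_abel n c x - B.A x) has_field_derivative 1 / dip_field n c x - 1 / ?b x) (at x)"
        by (intro DERIV_diff DERIV_dip_abel c B.DERIV_A)
      then show "((\<lambda>x. dip_abel n c x - B.A x) has_field_derivative 0) (at x within zone n a b)"
        using bb[OF x] by (simp add: has_field_derivative_at_within)
    qed
    then obtain \<theta> where th: "\<And>x. x \<in> zone n a b \<Longrightarrow> dip_abel n c x = B.A x + \<theta>" by (metis diff_eq_eq add.commute)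
    let ?p = "?r * \<theta>"
    have eq: "c * cos ?p * W1 x + c * sin ?p * W2 x = modulation n c N x" if "x \<in> zone n a b" for x
      unfolding modulation_def W1_def W2_def th[OF that] bb[OF that] distrib_left[of ?r "B.A x" \<theta>] sin_add cos_add
      by (simp only: algebra_simps)
    have "Ck_bdd k (\<bar>c * cos ?p\<bar> * M1 + \<bar>c * sin ?p\<bar> * M2) (\<lambda>x. c * cos ?p * W1 x + c * sin ?p * W2 x) (zone n a b)"
      by (intro Ck_bdd_fam_add Ck_bdd_fam_cmult)
         (rule Ck_bdd_fam_mono[OF M1(3)] Ck_bdd_fam_mono[OF M2(3)], simp, use ZK M1(2) M2(2) in blast)+
    moreover have "\<bar>c * cos ?p\<bar> * M1 + \<bar>c * sin ?p\<bar> * M2 \<le> c * (M1 + M2)"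
    proof -
      have "\<bar>c * cos ?p\<bar> \<le> c" "\<bar>c * sin ?p\<bar> \<le> c" using c by (simp_all add: abs_mult mult_le_cancel_left2)
      then have "\<bar>c * cos ?p\<bar> * M1 \<le> c * M1" "\<bar>c * sin ?p\<bar> * M2 \<le> c * M2"
        using M1 M2 by (auto intro: mult_right_mono)
      then show ?thesis by (simp add: distrib_left)
    qed
    ultimately have "Ck_bdd k (c * (M1 + M2)) (\<lambda>x. c * cos ?p * W1 x + c * sin ?p * W2 x) (zone n a b)"
      by (rule Ck_bdd_fam_mono) simp
    then show "Ck_bdd k (c * (M1 + M2)) (modulation n c N) (zone n a b)"
      by (rule Ck_bdd_fam_cong[OF open_zone, rotated]) (rule eq)
  qed
qed

text \<open>In this order: the dip lowers the field; the bottom of the dip is long enough for the trajectory from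
  \<open>z = 5\<close> to stay in it for unit time; the modulated field keeps a small first derivative in the dip; and outside
  the dip the modulation does not affect the size of the first \<open>n\<close> derivatives.\<close>

definition good_amplitude :: "nat \<Rightarrow> real \<Rightarrow> real \<Rightarrow> bool" where
  "good_amplitude n N c \<longleftrightarrow> 0 < c \<and> c \<le> exp (- hump_start n - 10) \<and> c \<le> 1 / (hump_start n + 4) - 1 / (hump_start n + 5) \<and>
     c * (2 * pi * N) ^ 2 \<le> 1 / (real n + 2) \<and>
     Ck_bdd n (1 / 2) (modulation n c N) (zone n (-1) 3) \<and> Ck_bdd n (1 / 2) (modulation n c N) (zone n 7 11)"

lemma good_amplitude_exists: assumes "1 \<le> N" obtains c where "good_amplitude n N c"
proof -
  obtain M1 where M1: "1 \<le> M1" "\<And>c. 0 < c \<Longrightarrow> c \<le> exp (- hump_start n - 10) \<Longrightarrow> Ck_bdd n (c * M1) (modulation n c N) (zone n (-1) 3)"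
    using modulation_outer_bound[of "-1" 3 n n N] by auto
  obtain M2 where M2: "1 \<le> M2" "\<And>c. 0 < c \<Longrightarrow> c \<le> exp (- hump_start n - 10) \<Longrightarrow> Ck_bdd n (c * M2) (modulation n c N) (zone n 7 11)"
    using modulation_outer_bound[of 7 11 n n N] by auto
  define m where "m = 1 / (hump_start n + 4) - 1 / (hump_start n + 5)"
  have m: "0 < m" using hump_start_ge[of n] by (simp add: m_def frac_less2)
  define c where "c = Min {exp (- hump_start n - 10), m, 1 / (real n + 2) / (2 * pi * N) ^ 2, 1 / (2 * M1), 1 / (2 * M2)}"
  have N0: "0 < (2 * pi * N) ^ 2" using assms by simp
  have c0: "0 < c" using m M1(1) M2(1) N0 assms by (simp add: c_def)
  have cl: "c \<le> exp (- hump_start n - 10)" "c \<le> m" "c \<le> 1 / (real n + 2) / (2 * pi * N) ^ 2" "c \<le> 1 / (2 * M1)" "c \<le> 1 / (2 * M2)"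
    unfolding c_def by (auto intro!: Min_le)
  have "c * M1 \<le> 1 / 2" "c * M2 \<le> 1 / 2" using cl(4,5) M1(1) M2(1) by (simp_all add: field_simps)
  then have "Ck_bdd n (1 / 2) (modulation n c N) (zone n (-1) 3)" "Ck_bdd n (1 / 2) (modulation n c N) (zone n 7 11)"
    using Ck_bdd_fam_mono[OF M1(2)[OF c0 cl(1)] _ order_refl] Ck_bdd_fam_mono[OF M2(2)[OF c0 cl(1)] _ order_refl] by auto
  moreover have "c * (2 * pi * N) ^ 2 \<le> 1 / (real n + 2)" using cl(3) unfolding pos_le_divide_eq[OF N0] .
  ultimately show ?thesis using that c0 cl(1,2) unfolding good_amplitude_def m_def by blast
qed

lemma reciprocal_Ck_bdd:
  obtains C where "1 \<le> C" "\<And>v S. Ck_bdd k (1 / 2) v S \<Longrightarrow> Ck_bdd k C (\<lambda>x. 1 / (1 + v x)) S"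
proof -
  have s: "smooth_on {-3/4<..<3/4} (\<lambda>y. 1 / (1 + y))" by (intro smooth_intros) auto
  have sub: "{-1/2..1/2} \<subseteq> {-3/4<..<3/4::real}" by auto
  obtain M V where M: "1 \<le> M" "{-1/2..1/2} \<subseteq> V" "Ck_bdd k M (\<lambda>y. 1 / (1 + y)) V"
    using smooth_on_compact_Ck_bdd[OF s compact_Icc sub] by metis
  have C: "1 * M \<le> (2 ^ k * 1) ^ k * M" using M(1) by (intro mult_right_mono one_le_power) auto
  show ?thesis
  proof (rule that[of "(2 ^ k * 1) ^ k * M"])
    show "1 \<le> (2 ^ k * 1) ^ k * M" using C M(1) by linarith
    fix v S assume v: "Ck_bdd k (1 / 2) v S"
    have vi: "v x \<in> {-1/2..1/2}" if "x \<in> S" for x 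
      using abs_le_D1[OF Ck_bdd_bound[OF v that]] abs_le_D2[OF Ck_bdd_bound[OF v that]]
      unfolding atLeastAtMost_iff by (intro conjI) linarith+
    show "Ck_bdd k ((2 ^ k * 1) ^ k * M) (\<lambda>x. 1 / (1 + v x)) S"
      by (rule Ck_bdd_fam_comp[OF M(3) Ck_bdd_fam_mono[OF v _ order_refl]]) (use vi M in auto)
  qed
qed

context
  fixes n :: nat and N c :: real
  assumes good: "good_amplitude n N c" and N: "1 \<le> N"
begin

lemma amplitude: "0 < c" "c \<le> exp (- hump_start n - 10)"
  using good by (auto simp: good_amplitude_def)

lemma amplitude_frequency: "c * (2 * pi * N) \<le> 1 / 2"
proof -
  have "1 \<le> 2 * pi * N" using mult_mono[of 1 "2 * pi" 1 N] N pi_gt3 by simp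
  moreover have "0 \<le> c * (2 * pi * N)" using amplitude N by simp
  ultimately have "c * (2 * pi * N) * 1 \<le> c * (2 * pi * N) * (2 * pi * N)" by (rule mult_left_mono)
  also have "\<dots> \<le> 1 / (real n + 2)" using good by (simp add: good_amplitude_def power2_eq_square mult.assoc)
  also have "\<dots> \<le> 1 / 2" by (intro divide_left_mono) auto
  finally show ?thesis by simp
qed

lemma modulation_bound: assumes x: "0 < x" shows "\<bar>modulation n c N x\<bar> \<le> 1 / 2"
proof -
  let ?z = "1 / x - hump_start n"
  consider "?z < 1" | "-1 < ?z" "?z < 3" | "2 < ?z" "?z < 8" | "7 < ?z" "?z < 11" | "9 < ?z" by linarith
  then show ?thesis
  proof cases
    case 1
    then show ?thesis using modulation_far[of x n "?z - 1" 0] x by (simp add: zone_def)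
  next
    case 2
    then show ?thesis using good x by (intro Ck_bdd_bound[of n "1/2" "modulation n c N" "zone n (-1) 3"]) (auto simp: zone_def good_amplitude_def)
  next
    case 3
    then have "modulation n c N x = c * (2 * pi * N) * cos (2 * pi * N * dip_abel n c x)" using x by (intro modulation_core) (simp add: zone_def)
    moreover have "\<bar>c * (2 * pi * N) * cos (2 * pi * N * dip_abel n c x)\<bar> \<le> c * (2 * pi * N) * 1"
      unfolding abs_mult[of "c * (2 * pi * N)"] using amplitude N by (intro mult_mono) (auto simp: abs_mult)
    ultimately show ?thesis using amplitude_frequency by linarith
  next
    case 4
    then show ?thesis using good x by (intro Ck_bdd_bound[of n "1/2" "modulation n c N" "zone n 7 11"]) (auto simp: zone_def good_amplitude_def)
  next
    case 5
    then show ?thesis using modulation_far[of x n 0 "?z + 1"] x by (simp add: zone_def)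
  qed
qed

lemma one_plus_modulation: "0 < x \<Longrightarrow> 1 / 2 \<le> 1 + modulation n c N x"
  using modulation_bound[of x] by linarith

lemma smooth_on_hump_field: "smooth_on {0<..} (hump_field n c N)"
  unfolding hump_field_def[abs_def]
proof (intro smooth_on_divide smooth_on_add smooth_on_const smooth_on_dip_field smooth_on_modulation amplitude)
  fix x :: real assume "x \<in> {0<..}"
  then show "1 + modulation n c N x \<noteq> 0" using one_plus_modulation[of x] by auto
qed

lemma hump_field_pos: "0 < x \<Longrightarrow> 0 < hump_field n c N x"
  using one_plus_modulation[of x] dip_field_pos[OF amplitude(1)] unfolding hump_field_def by (intro divide_pos_pos) auto

lemma hump_field_le: assumes x: "0 < x" shows "hump_field n c N x \<le> 2 * exp (- 1 / x)"
proof -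
  have "hump_field n c N x \<le> exp (- 1 / x) / (1 / 2)"
    unfolding hump_field_def using one_plus_modulation[OF x] dip_field_le[OF amplitude(2)] dip_field_pos[OF amplitude(1), of n x]
    by (intro frac_le) auto
  then show ?thesis by simp
qed

lemma hump_field_far: "x \<in> zone n a 1 \<or> x \<in> zone n 9 b \<Longrightarrow> hump_field n c N x = exp (- 1 / x)"
proof -
  assume x: "x \<in> zone n a 1 \<or> x \<in> zone n 9 b"
  then have "dip_field n c x = exp (- 1 / x)" by (auto simp: dip_field_def zone_def bump_0)
  then show ?thesis using modulation_far[OF x] by (simp add: hump_field_def)
qed

text \<open>The derivative of the modulation is of order \<open>c * N\<^sup>2 / dip_field\<close>; multiplied by the field it is controlled by the
  choice of the amplitude, however small the field is.\<close>

lemma deriv_hump_field_core: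
  assumes x: "x \<in> zone n 2 8" shows "\<bar>deriv (hump_field n c N) x\<bar> \<le> 2 * \<bar>deriv (dip_field n c) x\<bar> + 4 / (real n + 2)"
proof -
  let ?r = "2 * pi * N"
  have x0: "0 < x" using x by (simp add: zone_def)
  let ?b = "dip_field n c x" and ?b' = "deriv (dip_field n c) x" and ?w = "modulation n c N x"
  define w' where "w' = c * ?r * (- sin (?r * dip_abel n c x) * (?r * (1 / ?b)))"
  have bp: "0 < ?b" by (rule dip_field_pos[OF amplitude(1)])
  have "((\<lambda>x. c * ?r * cos (?r * dip_abel n c x)) has_real_derivative w') (at x)"
    unfolding w'_def by (intro DERIV_cmult DERIV_chain2[OF DERIV_cos] DERIV_dip_abel amplitude x0)
  then have Dw: "(modulation n c N has_real_derivative w') (at x)"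
    by (rule has_field_derivative_transform_within_open[OF _ open_zone x]) (simp add: modulation_core)
  have Db: "(dip_field n c has_real_derivative ?b') (at x)" using smooth_on_DERIV[OF smooth_on_dip_field, of x] x0 by simp
  have w1: "1 / 2 \<le> 1 + ?w" by (rule one_plus_modulation[OF x0])
  have "(hump_field n c N has_real_derivative (?b' * (1 + ?w) - ?b * (0 + w')) / ((1 + ?w) * (1 + ?w))) (at x)"
    unfolding hump_field_def[abs_def] by (intro DERIV_divide Db DERIV_add DERIV_const Dw) (use w1 in auto)
  then have "deriv (hump_field n c N) x = (?b' * (1 + ?w) - ?b * w') / ((1 + ?w) * (1 + ?w))"
    by (simp add: DERIV_imp_deriv)
  also have "\<dots> = ?b' / (1 + ?w) - ?b * w' / ((1 + ?w) * (1 + ?w))"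
    using w1 by (simp add: diff_divide_distrib)
  finally have d: "deriv (hump_field n c N) x = ?b' / (1 + ?w) - ?b * w' / ((1 + ?w) * (1 + ?w))" .
  have "\<bar>?b' / (1 + ?w)\<bar> = \<bar>?b'\<bar> / (1 + ?w)" using w1 by (simp add: abs_divide)
  also have "\<dots> \<le> \<bar>?b'\<bar> / (1 / 2)" by (rule frac_le[OF abs_ge_zero order_refl _ w1]) simp
  finally have "\<bar>?b' / (1 + ?w)\<bar> \<le> \<bar>?b'\<bar> / (1 / 2)" .
  moreover have "\<bar>?b * w' / ((1 + ?w) * (1 + ?w))\<bar> \<le> (1 / (real n + 2)) / (1 / 2 * (1 / 2))"
  proof -
    have "?b * w' = - (c * ?r ^ 2 * sin (?r * dip_abel n c x))" using bp by (simp add: w'_def power2_eq_square)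
    then have "\<bar>?b * w'\<bar> = c * ?r ^ 2 * \<bar>sin (?r * dip_abel n c x)\<bar>" using amplitude by (simp add: abs_mult)
    also have "\<dots> \<le> c * ?r ^ 2 * 1" using amplitude by (intro mult_left_mono) auto
    also have "\<dots> \<le> 1 / (real n + 2)" using good by (simp add: good_amplitude_def)
    finally have "\<bar>?b * w'\<bar> \<le> 1 / (real n + 2)" .
    moreover have "1 / 2 * (1 / 2) \<le> (1 + ?w) * (1 + ?w)" using w1 by (intro mult_mono) auto
    ultimately have "\<bar>?b * w'\<bar> / ((1 + ?w) * (1 + ?w)) \<le> (1 / (real n + 2)) / (1 / 2 * (1 / 2))"
      by (intro frac_le) auto
    moreover have "0 \<le> (1 + ?w) * (1 + ?w)" by simp
    ultimately show ?thesis by (simp only: abs_divide abs_of_nonneg)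
  qed
  moreover have "\<bar>p - q\<bar> \<le> u + v" if "\<bar>p\<bar> \<le> u" "\<bar>q\<bar> \<le> v" for p q u v :: real using that by linarith
  ultimately have "\<bar>deriv (hump_field n c N) x\<bar> \<le> \<bar>?b'\<bar> / (1 / 2) + (1 / (real n + 2)) / (1 / 2 * (1 / 2))"
    unfolding d by blast
  then show ?thesis by (simp add: mult.commute)
qed

end

text \<open>Multiplication by \<open>1 / (1 + modulation)\<close> costs a constant factor that does not depend on the hump.\<close>

lemma hump_field_outer_Ck_bdd:
  obtains K where "1 \<le> K"
    "\<And>n N c e S. good_amplitude n N c \<Longrightarrow> k \<le> n \<Longrightarrow> 0 \<le> e \<Longrightarrow> S = zone n (-1) 3 \<or> S = zone n 7 11 \<Longrightarrow>
       Ck_bdd k e (dip_field n c) S \<Longrightarrow> Ck_bdd k (K * e) (hump_field n c N) S"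
proof -
  obtain C where C: "1 \<le> C" "\<And>v S. Ck_bdd k (1 / 2) v S \<Longrightarrow> Ck_bdd k C (\<lambda>x. 1 / (1 + v x)) S"
    using reciprocal_Ck_bdd[of k] by blast
  have "1 * 1 \<le> 2 ^ k * C" using C(1) by (intro mult_mono one_le_power) auto
  show ?thesis
  proof (rule that[of "2 ^ k * C"])
    show "1 \<le> 2 ^ k * C" using \<open>1 * 1 \<le> 2 ^ k * C\<close> by simp
    fix n N c e S assume g: "good_amplitude n N c" "k \<le> n" "0 \<le> e" "S = zone n (-1) 3 \<or> S = zone n 7 11" "Ck_bdd k e (dip_field n c) S"
    have "Ck_bdd n (1 / 2) (modulation n c N) S" using g by (auto simp: good_amplitude_def)
    then have "Ck_bdd k C (\<lambda>x. 1 / (1 + modulation n c N x)) S" by (intro C(2)) (rule Ck_bdd_fam_order[OF _ g(2)])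
    then have "Ck_bdd k (2 ^ k * C * e) (\<lambda>x. (1 / (1 + modulation n c N x)) * dip_field n c x) S"
      by (rule Ck_bdd_fam_mult[OF _ g(5)]) (use C(1) g(3) in auto)
    then show "Ck_bdd k (2 ^ k * C * e) (hump_field n c N) S" by (simp add: hump_field_def[abs_def])
  qed
qed

text \<open>Multiplied by a time at most \<open>\<eta>\<close>, the field has small derivatives up to order \<open>n + 1\<close> in the middle of the
  hump, so that the flow map for such a time is close to the identity.\<close>

definition good_window :: "nat \<Rightarrow> real \<Rightarrow> real \<Rightarrow> real \<Rightarrow> bool" where
  "good_window n N c \<eta> \<longleftrightarrow> 0 < \<eta> \<and> \<eta> \<le> 1 \<and> (\<exists>M\<ge>0. \<eta> * M \<le> 1 / (real n + 1) \<and> Ck_bdd n M (deriv (hump_field n c N)) (zone n 2 8))"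

lemma good_window_exists:
  assumes "good_amplitude n N c" "1 \<le> N" obtains \<eta> where "good_window n N c \<eta>"
proof -
  let ?K = "{1 / (hump_start n + 8)..1 / (hump_start n + 2)}"
  have p: "0 < 1 / (hump_start n + 8)" using hump_start_ge[of n] by simp
  have K: "compact ?K" "?K \<subseteq> {0<..}"
    by (rule compact_Icc) (rule subsetI, simp only: atLeastAtMost_iff greaterThan_iff, use p in linarith)
  have ZK: "zone n 2 8 \<subseteq> ?K" using zone_eq[of 2 8 n] by auto
  obtain M V where M: "1 \<le> M" "?K \<subseteq> V" "Ck_bdd n M (deriv (hump_field n c N)) V"
    using smooth_on_compact_Ck_bdd[OF smooth_on_deriv[OF smooth_on_hump_field[OF assms]] K] by metis
  have "Ck_bdd n M (deriv (hump_field n c N)) (zone n 2 8)" by (rule Ck_bdd_fam_mono[OF M(3)]) (use ZK M(2) in auto)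
  moreover have "1 / ((real n + 1) * M) * M \<le> 1 / (real n + 1)" using M(1) by simp
  moreover have "0 < 1 / ((real n + 1) * M)" using M(1) by simp
  moreover have "1 / ((real n + 1) * M) \<le> 1"
    using mult_mono[of 1 "real n + 1" 1 M] M(1) by simp
  moreover have "0 \<le> M" using M(1) by simp
  ultimately show ?thesis using that[of "1 / ((real n + 1) * M)"] unfolding good_window_def by blast
qed

section \<open>Gluing the humps\<close>

text \<open>The frequency on the \<open>n\<close>-th hump is \<open>3 ^ E n\<close>: powers of \<open>3\<close> are odd, which makes \<open>1 / 2\<close> a bad time, and each
  divides the next, which makes triadic rationals good.\<close>

locale oscillating_field =
  fixes E :: "nat \<Rightarrow> nat" and c \<eta> :: "nat \<Rightarrow> real"
  assumes amp: "good_amplitude n (3 ^ E n) (c n)"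
    and win: "good_window n (3 ^ E n) (c n) (\<eta> n)"
    and E_less: "E n < E (Suc n)"
    and sep: "2 / 3 ^ E (Suc n) \<le> \<eta> n"

text \<open>The order of the choices is the point: the frequency first, then an amplitude that is small with respect to
  it, then the window, which depends on both, and only then the next frequency.\<close>

lemma oscillating_field_exists: obtains E c \<eta> where "oscillating_field E c \<eta>"
proof -
  let ?P = "\<lambda>n p. good_amplitude n (3 ^ fst p) (fst (snd p)) \<and> good_window n (3 ^ fst p) (fst (snd p)) (snd (snd p))"
  let ?Q = "\<lambda>n p q. fst p < fst q \<and> 2 / 3 ^ fst q \<le> snd (snd p)"
  have ex: "\<exists>c \<eta>. good_amplitude n (3 ^ e) c \<and> good_window n (3 ^ e) c \<eta>" for n e :: nat
    by (meson good_amplitude_exists good_window_exists one_le_numeral one_le_power)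
  have "\<exists>f::nat \<Rightarrow> nat \<times> real \<times> real. \<forall>n. ?P n (f n) \<and> ?Q n (f n) (f (Suc n))"
  proof (rule dependent_nat_choice)
    obtain c \<eta> where "good_amplitude 0 (3 ^ 0) c \<and> good_window 0 (3 ^ 0) c \<eta>" using ex[of 0 0] by blast
    then show "\<exists>p::nat \<times> real \<times> real. ?P 0 p" by (intro exI[of _ "(0, c, \<eta>)"]) simp
    fix p :: "nat \<times> real \<times> real" and n assume "?P n p"
    then have e0: "0 < snd (snd p)" by (simp add: good_window_def)
    \<comment> \<open>one more factor \<open>3\<close> ensures that the exponents increase\<close>
    obtain j where j: "2 / snd (snd p) < 3 ^ j" using real_arch_pow[of 3 "2 / snd (snd p)"] by auto
    define e where "e = Suc (fst p) + j"
    have "(3::real) ^ j \<le> 3 ^ e" by (rule power_increasing) (auto simp: e_def)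
    with j have "2 / snd (snd p) < 3 ^ e" by linarith
    then have "2 / 3 ^ e \<le> snd (snd p)" using e0 by (simp add: field_simps)
    moreover obtain c \<eta> where "good_amplitude (Suc n) (3 ^ e) c \<and> good_window (Suc n) (3 ^ e) c \<eta>" using ex by blast
    ultimately show "\<exists>q. ?P (Suc n) q \<and> ?Q n p q" by (intro exI[of _ "(e, c, \<eta>)"]) (simp add: e_def)
  qed
  then obtain f where f: "\<And>n. ?P n (f n) \<and> ?Q n (f n) (f (Suc n))" by blast
  have "oscillating_field (\<lambda>n. fst (f n)) (\<lambda>n. fst (snd (f n))) (\<lambda>n. snd (snd (f n)))"
    by unfold_locales (use f in auto)
  then show ?thesis by (rule that)
qed

context oscillating_field
begin

abbreviation N :: "nat \<Rightarrow> real" where "N n \<equiv> 3 ^ E n"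

text \<open>Index of the hump containing \<open>x\<close>. Natural number subtraction assigns the points with \<open>1 / x < 10\<close> to the first hump,
  on whose outer part the field is \<open>exp (- 1 / x)\<close> anyway.\<close>

definition hump :: "real \<Rightarrow> nat" where "hump x = nat \<lfloor>1 / x / 10\<rfloor> - 1"

definition h :: "nat \<Rightarrow> real \<Rightarrow> real" where "h n = hump_field n (c n) (N n)"

definition \<xi> :: "real \<Rightarrow> real" where "\<xi> x = h (hump x) x"

lemma N1: "1 \<le> N n" by simp

lemmas hump_facts = amp N1

lemma h_far: "x \<in> zone n a 1 \<or> x \<in> zone n 9 b \<Longrightarrow> h n x = exp (- 1 / x)"
  unfolding h_def by (rule hump_field_far[OF hump_facts])

lemma hump_eq: assumes "10 * real k \<le> 1 / x" "1 / x < 10 * real k + 10" shows "hump x = k - 1"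
proof -
  define y where "y = 1 / x"
  have "\<lfloor>y / 10\<rfloor> = int k" by (rule floor_unique) (use assms[folded y_def] in auto)
  then show ?thesis by (simp add: hump_def y_def)
qed

text \<open>The range \<open>{- 1<..<11}\<close> of \<open>z\<close> overlaps the neighbouring humps; there both local definitions give
  \<open>exp (- 1 / x)\<close>. The overlaps make the local fields fit together smoothly.\<close>

lemma xi_eq: assumes x: "x \<in> zone n (-1) 11" shows "\<xi> x = h n x"
proof -
  have x0: "0 < x" and y: "10 * real n + 9 < 1 / x" "1 / x < 10 * real n + 21"
    using x by (auto simp: zone_def hump_start_def)
  consider "1 / x < 10 * real n + 10" | "10 * real n + 10 \<le> 1 / x" "1 / x < 10 * real n + 20" | "10 * real n + 20 \<le> 1 / x"
    by linarith
  then show ?thesis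
  proof cases
    case 1
    have e: "hump x = n - 1" by (rule hump_eq) (use 1 y in linarith)+
    show ?thesis
    proof (cases n)
      case 0
      then show ?thesis using e by (simp add: \<xi>_def)
    next
      case (Suc m)
      have z: "x \<in> zone n (-2) 1" "x \<in> zone m 9 11" using y 1 x0 by (auto simp: zone_def hump_start_def Suc)
      show ?thesis using h_far[OF disjI1[OF z(1)]] h_far[OF disjI2[OF z(2)]] e Suc by (simp add: \<xi>_def)
    qed
  next
    case 2
    have "hump x = Suc n - 1" by (rule hump_eq) (use 2 in simp_all)
    then show ?thesis by (simp add: \<xi>_def)
  next
    case 3
    have e: "hump x = Suc (Suc n) - 1" by (rule hump_eq) (use 3 y in simp_all)
    have z: "x \<in> zone (Suc n) (-1) 1" "x \<in> zone n 9 12" using y 3 x0 by (auto simp: zone_def hump_start_def)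
    show ?thesis using h_far[OF disjI1[OF z(1)]] h_far[OF disjI2[OF z(2)]] e by (simp add: \<xi>_def)
  qed
qed

lemma xi_eq_0: assumes "1 / 11 < x" shows "\<xi> x = h 0 x"
proof (cases "1 / x < 10")
  case True
  have "0 < 1 / x" using assms by simp
  then have "hump x = 0 - 1" by (intro hump_eq) (use True in linarith)+
  then show ?thesis by (simp add: \<xi>_def)
next
  case False
  have "1 / x < 11" using assms by (simp add: field_simps)
  then have "hump x = 1 - 1" by (intro hump_eq) (use False in linarith)+
  then show ?thesis by (simp add: \<xi>_def)
qed

lemma hump_cover: assumes "0 < x" "hump_start m \<le> 1 / x" obtains n where "m \<le> n" "0 \<le> 1 / x - hump_start n" "1 / x - hump_start n < 10"
proof -
  define y where "y = 1 / x"
  define n where "n = nat \<lfloor>(y - 10) / 10\<rfloor>"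
  have my: "10 * (real m + 1) \<le> y" using assms(2) by (simp only: y_def hump_start_def)
  have "0 \<le> (y - 10) / 10" using my by simp
  then have "real n = of_int \<lfloor>(y - 10) / 10\<rfloor>" by (simp add: n_def)
  then have "real n \<le> (y - 10) / 10" "(y - 10) / 10 < real n + 1" by linarith+
  then have a: "10 * real n + 10 \<le> y" "y < 10 * real n + 20" by (simp_all add: field_simps)
  have "10 * real m + 10 < 10 * real n + 20" using a(2) my by simp
  then have "m \<le> n" by simp
  moreover have "0 \<le> y - 10 * (real n + 1)" "y - 10 * (real n + 1) < 10" using a by simp_all
  ultimately show ?thesis using that by (simp only: y_def hump_start_def)
qed

lemma smooth_on_h: "smooth_on {0<..} (h n)"
  unfolding h_def by (rule smooth_on_hump_field[OF hump_facts])

lemma xi_local: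
  assumes x: "0 < x" obtains n T where "open T" "x \<in> T" "T \<subseteq> {0<..}" "\<And>y. y \<in> T \<Longrightarrow> \<xi> y = h n y"
proof (cases "1 / 11 < x")
  case True
  show ?thesis by (rule that[of "{1/11<..}" 0]) (use True in \<open>auto simp: xi_eq_0\<close>)
next
  case False
  have "hump_start 0 \<le> 1 / x" using False x by (simp add: hump_start_def field_simps)
  then obtain n where "0 \<le> 1 / x - hump_start n" "1 / x - hump_start n < 10" using hump_cover[OF x] by metis
  then have "x \<in> zone n (-1) 11" using x by (simp add: zone_def)
  then show ?thesis by (rule that[OF open_zone _ zone_pos]) (rule xi_eq)
qed

sublocale half_line_field \<xi>
proof
  show "smooth_on {0<..} \<xi>"
  proof (rule smooth_on_cong_local)
    fix x :: real assume "x \<in> {0<..}"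
    then have "0 < x" by simp
    then obtain n T where "open T" "x \<in> T" "T \<subseteq> {0<..}" "\<And>y. y \<in> T \<Longrightarrow> \<xi> y = h n y" using xi_local by metis
    then show "\<exists>h T. open T \<and> x \<in> T \<and> smooth_on T h \<and> (\<forall>y\<in>T. \<xi> y = h y)"
      using smooth_on_subset[OF smooth_on_h] by blast
  qed
  show "0 < \<xi> x" if "0 < x" for x
    unfolding \<xi>_def h_def by (rule hump_field_pos[OF hump_facts that])
  show "\<xi> x \<le> 2 * exp (- 1 / x)" if "0 < x" for x
    unfolding \<xi>_def h_def by (rule hump_field_le[OF hump_facts that])
qed

lemma c_bounds: "0 < c n" "c n \<le> exp (- hump_start n - 10)"
  using amp[of n] by (auto simp: good_amplitude_def)

lemma xi_core: "x \<in> zone n 2 8 \<Longrightarrow> \<xi> x = dip_field n (c n) x / (1 + c n * (2 * pi * N n) * cos (2 * pi * N n * dip_abel n (c n) x))"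
  using xi_eq[of x n] modulation_core[of x n "c n" "N n"] by (auto simp: h_def hump_field_def zone_def)

lemma xi_outer_Ck_small:
  obtains r where "r \<longlonglongrightarrow> 0" "\<And>n. 0 \<le> r n"
    "\<And>n. k \<le> n \<Longrightarrow> Ck_bdd k (r n) \<xi> (zone n (-1) 3) \<and> Ck_bdd k (r n) \<xi> (zone n 7 11)"
    "\<And>n. Ck_bdd k (r n) (dip_field n (c n)) (zone n (-1) 11)"
proof -
  obtain e where e: "e \<longlonglongrightarrow> 0" "\<And>n. 0 \<le> e n"
    "\<And>n c. 0 < c \<Longrightarrow> c \<le> exp (- hump_start n - 10) \<Longrightarrow> Ck_bdd k (e n) (dip_field n c) (zone n (-1) 11)"
    using dip_field_Ck_small[of k] by metis
  obtain K where K: "1 \<le> K"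
    "\<And>n N c e S. good_amplitude n N c \<Longrightarrow> k \<le> n \<Longrightarrow> 0 \<le> e \<Longrightarrow> S = zone n (-1) 3 \<or> S = zone n 7 11 \<Longrightarrow>
       Ck_bdd k e (dip_field n c) S \<Longrightarrow> Ck_bdd k (K * e) (hump_field n c N) S"
    using hump_field_outer_Ck_bdd[of k] by metis
  have be: "Ck_bdd k (e n) (dip_field n (c n)) (zone n (-1) 11)" for n using e(3) c_bounds by blast
  show ?thesis
  proof (rule that[of "\<lambda>n. K * e n"])
    have "(\<lambda>n. K * e n) \<longlonglongrightarrow> K * 0" by (intro tendsto_intros e(1))
    then show "(\<lambda>n. K * e n) \<longlonglongrightarrow> 0" by simp
    show "0 \<le> K * e n" for n using K(1) e(2)[of n] by simp
    have Ke: "e n \<le> K * e n" for n using mult_right_mono[OF K(1) e(2)[of n]] by simp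
    show "Ck_bdd k (K * e n) (dip_field n (c n)) (zone n (-1) 11)" for n by (rule Ck_bdd_fam_mono[OF be Ke order_refl])
    fix n assume "k \<le> n"
    have "Ck_bdd k (K * e n) \<xi> S" if S: "S = zone n (-1) 3 \<or> S = zone n 7 11" for S
    proof -
      have sub: "S \<subseteq> zone n (-1) 11" using S zone_mono[of "-1" "-1" 3 11 n] zone_mono[of "-1" 7 11 11 n] by auto
      have "Ck_bdd k (K * e n) (h n) S"
        unfolding h_def by (rule K(2)[OF amp \<open>k \<le> n\<close> e(2) S Ck_bdd_fam_mono[OF be order_refl sub]])
      then show ?thesis
        by (rule Ck_bdd_fam_cong[rotated 2]) (use S sub xi_eq open_zone in auto)
    qed
    then show "Ck_bdd k (K * e n) \<xi> (zone n (-1) 3) \<and> Ck_bdd k (K * e n) \<xi> (zone n 7 11)" by blast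
  qed
qed

lemma deriv_xi_eq: "x \<in> zone n (-1) 11 \<Longrightarrow> deriv \<xi> x = deriv (h n) x"
proof -
  assume x: "x \<in> zone n (-1) 11"
  then have "(h n has_real_derivative deriv (h n) x) (at x)" using smooth_on_DERIV[OF smooth_on_h, of x] by (simp add: zone_def)
  then have "(\<xi> has_real_derivative deriv (h n) x) (at x)"
    by (rule has_field_derivative_transform_within_open[OF _ open_zone x]) (simp add: xi_eq)
  then show ?thesis by (rule DERIV_imp_deriv)
qed

text \<open>Outside the dips \<open>\<xi>'\<close> is small because \<open>\<xi>\<close> is small in \<open>C\<^sup>1\<close>; inside, because the amplitudes decay faster than the
  squares of the frequencies grow.\<close>

sublocale half_line_C1_field \<xi>
proof
  obtain r where r: "r \<longlonglongrightarrow> 0" "\<And>n. 0 \<le> r n"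
    "\<And>n. 1 \<le> n \<Longrightarrow> Ck_bdd 1 (r n) \<xi> (zone n (-1) 3) \<and> Ck_bdd 1 (r n) \<xi> (zone n 7 11)"
    "\<And>n. Ck_bdd 1 (r n) (dip_field n (c n)) (zone n (-1) 11)" using xi_outer_Ck_small[of 1] by metis
  define s where "s n = 2 * r n + 4 / (real n + 2)" for n
  have s: "s \<longlonglongrightarrow> 0"
  proof -
    have "(\<lambda>n. 4 / (real n + 2)) \<longlonglongrightarrow> 0" by real_asymp
    then have "(\<lambda>n. 2 * r n + 4 / (real n + 2)) \<longlonglongrightarrow> 2 * 0 + 0" by (intro tendsto_intros r(1))
    then show ?thesis by (simp add: s_def[abs_def])
  qed
  have bound: "\<bar>deriv \<xi> x\<bar> \<le> s n" if n: "1 \<le> n" and x: "0 < x" "0 \<le> 1 / x - hump_start n" "1 / x - hump_start n < 10" for n x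
  proof -
    have rs: "r n \<le> s n" using r(2)[of n] by (simp add: s_def)
    have D1: "\<bar>deriv g x\<bar> \<le> e" if "Ck_bdd 1 e g S" "open S" "x \<in> S" for g e S
      by (rule Ck_bdd_bound[OF Ck_bdd_deriv[OF that(2) that(1)[unfolded One_nat_def]] that(3)])
    consider "x \<in> zone n (-1) 3" | "x \<in> zone n 2 8" | "x \<in> zone n 7 11" using x by (fastforce simp: zone_def)
    then show ?thesis
    proof cases
      case 1
      then show ?thesis using D1[of "r n" \<xi> "zone n (-1) 3"] r(3)[OF n] open_zone rs by fastforce
    next
      case 3
      then show ?thesis using D1[of "r n" \<xi> "zone n 7 11"] r(3)[OF n] open_zone rs by fastforce
    next
      case 2
      have x': "x \<in> zone n (-1) 11" using 2 zone_mono[of "-1" 2 8 11 n] by auto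
      have "\<bar>deriv \<xi> x\<bar> \<le> 2 * \<bar>deriv (dip_field n (c n)) x\<bar> + 4 / (real n + 2)"
        unfolding deriv_xi_eq[OF x'] h_def by (rule deriv_hump_field_core[OF hump_facts 2])
      moreover have "\<bar>deriv (dip_field n (c n)) x\<bar> \<le> r n" by (rule D1[OF r(4) open_zone x'])
      ultimately show ?thesis by (simp add: s_def)
    qed
  qed
  show "(deriv \<xi> \<longlongrightarrow> 0) (at_right 0)"
  proof (rule tendstoI)
    fix e :: real assume e: "0 < e"
    have "\<forall>\<^sub>F n in sequentially. dist (s n) 0 < e" using s e by (rule tendstoD)
    then obtain m where m: "\<And>n. m \<le> n \<Longrightarrow> \<bar>s n\<bar> < e" by (auto simp: eventually_sequentially)
    have p: "0 < hump_start (Suc m)" using hump_start_ge[of "Suc m"] by linarith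
    then have "\<forall>\<^sub>F x in at_right 0. x \<in> {0<..<1 / hump_start (Suc m)}" by (intro eventually_at_right_real) simp
    then show "\<forall>\<^sub>F x in at_right 0. dist (deriv \<xi> x) 0 < e"
    proof eventually_elim
      case (elim x)
      then have x: "0 < x" "hump_start (Suc m) \<le> 1 / x" using p by (auto simp: field_simps)
      obtain n where n: "Suc m \<le> n" "0 \<le> 1 / x - hump_start n" "1 / x - hump_start n < 10" by (rule hump_cover[OF x])
      then have "\<bar>deriv \<xi> x\<bar> \<le> s n" by (intro bound x) auto
      also have "\<dots> < e" using m[of n] n by simp
      finally show ?case by simp
    qed
  qed
qed

end

section \<open>Good times have smooth flow maps\<close>

text \<open>The abstract estimate for the field \<open>t * f\<close>, whose time-\<open>s\<close> map is the time-\<open>t * s\<close> map of \<open>f\<close>.\<close>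

lemma flow_time_near_identity:
  fixes k :: nat
  obtains C where "1 \<le> C"
    "\<And>f t e S U. half_line_field f \<Longrightarrow> open S \<Longrightarrow> S \<subseteq> {0<..} \<Longrightarrow> U \<subseteq> {..1} \<Longrightarrow> Ck_bdd k e (deriv f) U \<Longrightarrow> 0 \<le> e \<Longrightarrow>
       \<bar>t\<bar> * e \<le> 1 \<Longrightarrow> (\<And>s x. \<bar>s\<bar> \<le> \<bar>t\<bar> \<Longrightarrow> x \<in> S \<Longrightarrow> half_line_field.F f s x \<in> U) \<Longrightarrow>
       Ck_bdd k (C * (\<bar>t\<bar> * e)) (\<lambda>x. deriv (half_line_field.F f t) x - 1) S \<and> Ck_bdd k C (half_line_field.F f t) S"
proof -
  obtain C where C: "1 \<le> C"
    "\<And>\<zeta>' \<Phi> S U e. variational_flow \<zeta>' \<Phi> 1 S U \<Longrightarrow> Ck_bdd k e \<zeta>' U \<Longrightarrow> 0 \<le> e \<Longrightarrow> e \<le> 1 \<Longrightarrow>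
           Ck_bdd k (C * e) (\<lambda>x. deriv (\<Phi> 1) x - 1) S \<and> Ck_bdd k C (\<Phi> 1) S"
    using flow_near_identity[of 1 1 k] by auto
  show ?thesis
  proof (rule that[OF C(1)])
    fix f t e S U
    assume f: "half_line_field f" and S: "open S" "S \<subseteq> {0<..}" and U: "U \<subseteq> {..1}" and b: "Ck_bdd k e (deriv f) U"
      and e: "0 \<le> e" "\<bar>t\<bar> * e \<le> 1" and F: "\<And>s x. \<bar>s\<bar> \<le> \<bar>t\<bar> \<Longrightarrow> x \<in> S \<Longrightarrow> half_line_field.F f s x \<in> U"
    interpret half_line_field f by (rule f)
    have "variational_flow (\<lambda>y. t * deriv f y) (\<lambda>s. F (t * s)) 1 S U"
      by (rule variational_flow_F[OF S _ U]) (rule F, auto simp: abs_mult mult_left_le)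
    from C(2)[OF this Ck_bdd_fam_cmult[OF b]] show
      "Ck_bdd k (C * (\<bar>t\<bar> * e)) (\<lambda>x. deriv (F t) x - 1) S \<and> Ck_bdd k C (F t) S"
      using e by simp
  qed
qed

text \<open>Uniform over all fields of the locale, since it is needed both for the final field and for the dip fields.\<close>

lemma drift_small:
  fixes T :: real
  obtains n1 where "\<And>n f t x. n1 \<le> n \<Longrightarrow> half_line_field f \<Longrightarrow> \<bar>t\<bar> \<le> T \<Longrightarrow> 0 < x \<Longrightarrow> hump_start n \<le> 1 / x \<Longrightarrow>
    \<bar>1 / half_line_field.F f t x - 1 / x\<bar> \<le> 1 / 4"
proof -
  define T' where "T' = max T 0"
  define e where "e = 1 / (4 * (T' + 1))"
  have T': "0 \<le> T'" "T \<le> T'" by (auto simp: T'_def)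
  then have e: "0 < e" "T' * e \<le> 1 / 4" by (auto simp: e_def field_simps)
  have "((\<lambda>y::real. 2 * (y ^ 2 / exp y)) \<longlongrightarrow> 2 * 0) at_top"
    by (intro tendsto_intros tendsto_power_div_exp_0)
  then have "\<forall>\<^sub>F y::real in at_top. dist (2 * (y ^ 2 / exp y)) 0 < e" using e(1) by (intro tendstoD) simp_all
  then obtain Y0 where Y0: "\<And>y. Y0 \<le> y \<Longrightarrow> \<bar>2 * (y ^ 2 / exp y)\<bar> < e" by (auto simp: eventually_at_top_linorder)
  have Y0': "2 * y ^ 2 * exp (- y) \<le> e" if "Y0 \<le> y" for y
    using abs_less_iff[THEN iffD1, OF Y0[OF that]] by (simp add: exp_minus divide_inverse)
  obtain n1 where n1: "Y0 + 2 * T' \<le> real n1" using real_arch_simple by blast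
  show ?thesis
  proof (rule that[of n1])
    fix n f t x assume n: "n1 \<le> n" and f: "half_line_field f" and t: "\<bar>t\<bar> \<le> T" and x: "0 < x" "hump_start n \<le> 1 / x"
    interpret half_line_field f by (rule f)
    have "real n1 \<le> hump_start n" using n by (simp add: hump_start_def)
    then have "Y0 + 2 * T' \<le> 1 / x" using n1 x(2) by linarith
    then have "\<bar>1 / F t x - 1 / x\<bar> \<le> T' * e"
      using inverse_F_dist_fine[OF x(1) order_trans[OF t T'(2)] _ Y0'] by blast
    with e(2) show "\<bar>1 / F t x - 1 / x\<bar> \<le> 1 / 4" by linarith
  qed
qed

lemma zone_drift:
  assumes "x \<in> zone n a b" "0 < y" "\<bar>1 / y - 1 / x\<bar> \<le> 1 / 4" shows "y \<in> zone n (a - 1 / 4) (b + 1 / 4)"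
proof -
  define u v where "u = 1 / x" and "v = 1 / y"
  have "a < u - hump_start n" "u - hump_start n < b" "\<bar>v - u\<bar> \<le> 1 / 4" using assms by (auto simp: zone_def u_def v_def)
  then have "a - 1 / 4 < v - hump_start n" "v - hump_start n < b + 1 / 4" by linarith+
  then show ?thesis using assms(2) by (simp add: zone_def v_def)
qed

lemma zone_le_1: assumes "0 \<le> a" shows "zone n a b \<subseteq> {..1}"
proof
  fix x assume "x \<in> zone n a b"
  then have x: "0 < x" and "hump_start n + a < 1 / x" by (auto simp: zone_def)
  then have "1 < 1 / x" using hump_start_ge[of n] assms by linarith
  then show "x \<in> {..1}" using x by simp
qed

context oscillating_field
begin

lemma half_line_field_xi: "half_line_field \<xi>" by unfold_locales

lemma half_line_field_dip_field_n: "half_line_field (dip_field n (c n))" by (rule half_line_field_dip_field[OF c_bounds])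

text \<open>Between the dips of two consecutive humps the field is small with its derivatives. The margin \<open>1 / 4\<close> on both
  sides keeps trajectories in that region.\<close>

lemma outer_flow_Ck_small:
  assumes "0 < \<epsilon>"
  shows "\<forall>\<^sub>F n in sequentially. Ck_bdd k \<epsilon> (\<lambda>x. deriv (F t) x - 1) (zone n (29/4) (51/4))"
proof -
  obtain C where C: "1 \<le> C"
    "\<And>f t e S U. half_line_field f \<Longrightarrow> open S \<Longrightarrow> S \<subseteq> {0<..} \<Longrightarrow> U \<subseteq> {..1} \<Longrightarrow> Ck_bdd k e (deriv f) U \<Longrightarrow> 0 \<le> e \<Longrightarrow>
       \<bar>t\<bar> * e \<le> 1 \<Longrightarrow> (\<And>s x. \<bar>s\<bar> \<le> \<bar>t\<bar> \<Longrightarrow> x \<in> S \<Longrightarrow> half_line_field.F f s x \<in> U) \<Longrightarrow>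
       Ck_bdd k (C * (\<bar>t\<bar> * e)) (\<lambda>x. deriv (half_line_field.F f t) x - 1) S \<and> Ck_bdd k C (half_line_field.F f t) S"
    using flow_time_near_identity[of k] by blast
  obtain r where r: "r \<longlonglongrightarrow> 0" "\<And>n. 0 \<le> r n"
    "\<And>n. Suc k \<le> n \<Longrightarrow> Ck_bdd (Suc k) (r n) \<xi> (zone n (-1) 3) \<and> Ck_bdd (Suc k) (r n) \<xi> (zone n 7 11)"
    using xi_outer_Ck_small[of "Suc k"] by metis
  obtain n1 where n1: "\<And>n f s x. n1 \<le> n \<Longrightarrow> half_line_field f \<Longrightarrow> \<bar>s\<bar> \<le> \<bar>t\<bar> \<Longrightarrow> 0 < x \<Longrightarrow> hump_start n \<le> 1 / x \<Longrightarrow>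
    \<bar>1 / half_line_field.F f s x - 1 / x\<bar> \<le> 1 / 4" using drift_small[of "\<bar>t\<bar>"] by blast
  define e where "e = min 1 (\<epsilon> / C) / (\<bar>t\<bar> + 1)"
  have t1: "0 < \<bar>t\<bar> + 1" by (intro add_nonneg_pos) auto
  have m0: "0 < min 1 (\<epsilon> / C)" using assms C(1) by simp
  then have e0: "0 < e" using t1 by (simp add: e_def)
  have "\<bar>t\<bar> * e \<le> (\<bar>t\<bar> + 1) * e" using e0 by (intro mult_right_mono) auto
  also have "\<dots> = min 1 (\<epsilon> / C)" using t1 by (simp add: e_def)
  finally have te: "\<bar>t\<bar> * e \<le> 1" "\<bar>t\<bar> * e \<le> \<epsilon> / C" by simp_all
  have Cte: "C * (\<bar>t\<bar> * e) \<le> \<epsilon>" using mult_left_mono[OF te(2), of C] C(1) by simp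
  have "\<forall>\<^sub>F n in sequentially. dist (r n) 0 < e" using r(1) e0 by (rule tendstoD)
  then obtain n2 where n2: "\<And>n. n2 \<le> n \<Longrightarrow> r n \<le> e" by (force simp: eventually_sequentially)
  have "Ck_bdd k \<epsilon> (\<lambda>x. deriv (F t) x - 1) (zone n (29/4) (51/4))" if n: "Suc k + n1 + n2 \<le> n" for n
  proof -
    let ?U = "zone n 7 11 \<union> zone (Suc n) (-1) 3"
    have U: "?U = zone n 7 13" by (auto simp: zone_def hump_start_Suc)
    have "Ck_bdd (Suc k) e \<xi> (zone n 7 11)" "Ck_bdd (Suc k) e \<xi> (zone (Suc n) (-1) 3)"
      using r(3)[of n] r(3)[of "Suc n"] n2[of n] n2[of "Suc n"] n Ck_bdd_fam_mono order_refl by (metis add_leE le_SucI)+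
    then have "Ck_bdd (Suc k) e \<xi> ?U" by (intro Ck_bdd_Un open_zone)
    then have d: "Ck_bdd k e (deriv \<xi>) (zone n 7 13)" unfolding U by (rule Ck_bdd_deriv[OF open_zone])
    have "F s x \<in> zone n 7 13" if s: "\<bar>s\<bar> \<le> \<bar>t\<bar>" and x: "x \<in> zone n (29/4) (51/4)" for s x
    proof -
      have x0: "0 < x" "hump_start n \<le> 1 / x" using x by (auto simp: zone_def)
      have "\<bar>1 / F s x - 1 / x\<bar> \<le> 1 / 4" by (rule n1[OF _ half_line_field_xi s x0]) (use n in simp)
      from zone_drift[OF x F_pos[OF x0(1)] this] show ?thesis by simp
    qed
    then have "Ck_bdd k (C * (\<bar>t\<bar> * e)) (\<lambda>x. deriv (F t) x - 1) (zone n (29/4) (51/4))"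
      using C(2)[OF half_line_field_xi open_zone zone_pos zone_le_1 d _ te(1)] e0 by simp
    then show ?thesis by (rule Ck_bdd_fam_mono[OF _ Cte order_refl])
  qed
  then show ?thesis by (auto simp: eventually_sequentially)
qed

text \<open>Where the oscillation has full amplitude, \<open>A\<close> is \<open>dip_abel\<close> plus the oscillation, up to a constant.\<close>

lemma A_core:
  assumes "x \<in> zone n 2 8" "y \<in> zone n 2 8"
  shows "A y - A x = (dip_abel n (c n) y + c n * sin (2 * pi * N n * dip_abel n (c n) y)) - (dip_abel n (c n) x + c n * sin (2 * pi * N n * dip_abel n (c n) x))"
proof -
  let ?r = "2 * pi * N n" and ?t = "dip_abel n (c n)"
  have "\<exists>d. \<forall>x\<in>zone n 2 8. A x - (?t x + c n * sin (?r * ?t x)) = d"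
  proof (rule has_field_derivative_zero_constant)
    show "convex (zone n 2 8)" using zone_eq[of 2 8 n] by (simp add: convex_real_interval)
    fix x assume x: "x \<in> zone n 2 8"
    then have x0: "0 < x" by (simp add: zone_def)
    let ?b = "dip_field n (c n) x"
    have "0 < ?b" by (rule dip_field_pos[OF c_bounds(1)])
    have "((\<lambda>x. A x - (?t x + c n * sin (?r * ?t x))) has_real_derivative
       1 / \<xi> x - (1 / ?b + c n * (cos (?r * ?t x) * (?r * (1 / ?b))))) (at x)"
      by (intro DERIV_diff DERIV_A DERIV_add DERIV_cmult DERIV_chain2[OF DERIV_sin] DERIV_dip_abel c_bounds x0)
    moreover have "1 / \<xi> x = 1 / ?b + c n * (cos (?r * ?t x) * (?r * (1 / ?b)))"
      unfolding xi_core[OF x] by (simp add: add_divide_distrib mult_ac)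
    ultimately show "((\<lambda>x. A x - (?t x + c n * sin (?r * ?t x))) has_field_derivative 0) (at x within zone n 2 8)"
      by (simp add: has_field_derivative_at_within)
  qed
  then obtain d where "\<And>x. x \<in> zone n 2 8 \<Longrightarrow> A x - (?t x + c n * sin (?r * ?t x)) = d" by blast
  from this[OF assms(1)] this[OF assms(2)] show ?thesis by linarith
qed

text \<open>A Diophantine condition: \<open>t\<close> is extremely close to multiples of the oscillation period \<open>1 / N n\<close>, for all large
  \<open>n\<close>.\<close>

definition good_time :: "real \<Rightarrow> bool" where
  "good_time t \<longleftrightarrow> (\<exists>n0. \<forall>n\<ge>n0. \<exists>m::int. \<bar>t - of_int m / N n\<bar> \<le> \<eta> n)"

text \<open>A multiple of the period shifts \<open>dip_abel\<close> without changing the oscillation, hence shifts \<open>A\<close> by the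
  same amount.\<close>

lemma core_flow_eq:
  fixes m :: int and n :: nat
  defines "q \<equiv> of_int m / N n"
  assumes x: "x \<in> zone n 2 8" and y: "half_line_field.F (dip_field n (c n)) q x \<in> zone n 2 8"
  shows "F q x = half_line_field.F (dip_field n (c n)) q x"
proof -
  interpret G: half_line_field "dip_field n (c n)" by (rule half_line_field_dip_field_n)
  have x0: "0 < x" using x by (simp add: zone_def)
  have tau: "dip_abel n (c n) (G.F q x) = dip_abel n (c n) x + q"
    by (rule iffD1[OF dip_abel_A[OF c_bounds] G.A_F[OF x0]])
  have "sin (2 * pi * N n * (dip_abel n (c n) x + q)) = sin (2 * pi * N n * dip_abel n (c n) x)"
  proof -
    have "2 * pi * N n * (dip_abel n (c n) x + q) = 2 * pi * N n * dip_abel n (c n) x + 2 * pi * of_int m"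
      by (simp add: q_def distrib_left)
    then show ?thesis by (simp add: sin_add)
  qed
  then have "A (G.F q x) = A x + q" using A_core[OF x y] tau by simp
  then show ?thesis using x0 G.F_pos[OF x0] by (intro F_eqI) auto
qed

text \<open>Write \<open>t = q + \<delta>\<close> with \<open>q\<close> a multiple of the period. The flow for time \<open>\<delta>\<close> is near the identity because \<open>\<delta>\<close> is tiny,
  and the flow for time \<open>q\<close> because it coincides with the flow of the dip field, which is small. It remains to
  compose.\<close>

lemma core_flow_Ck_small:
  assumes t: "good_time t" and eps: "0 < \<epsilon>"
  shows "\<forall>\<^sub>F n in sequentially. Ck_bdd k \<epsilon> (\<lambda>x. deriv (F t) x - 1) (zone n (5/2) (15/2))"
proof -
  obtain C where C: "1 \<le> C"
    "\<And>f t e S U. half_line_field f \<Longrightarrow> open S \<Longrightarrow> S \<subseteq> {0<..} \<Longrightarrow> U \<subseteq> {..1} \<Longrightarrow> Ck_bdd k e (deriv f) U \<Longrightarrow> 0 \<le> e \<Longrightarrow>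
       \<bar>t\<bar> * e \<le> 1 \<Longrightarrow> (\<And>s x. \<bar>s\<bar> \<le> \<bar>t\<bar> \<Longrightarrow> x \<in> S \<Longrightarrow> half_line_field.F f s x \<in> U) \<Longrightarrow>
       Ck_bdd k (C * (\<bar>t\<bar> * e)) (\<lambda>x. deriv (half_line_field.F f t) x - 1) S \<and> Ck_bdd k C (half_line_field.F f t) S"
    using flow_time_near_identity[of k] by blast
  obtain r where r: "r \<longlonglongrightarrow> 0" "\<And>n. 0 \<le> r n" "\<And>n. Ck_bdd (Suc k) (r n) (dip_field n (c n)) (zone n (-1) 11)"
    using xi_outer_Ck_small[of "Suc k"] by metis
  define T where "T = \<bar>t\<bar> + 1"
  have T1: "1 \<le> T" by (simp add: T_def)
  obtain n1 where n1: "\<And>n f s x. n1 \<le> n \<Longrightarrow> half_line_field f \<Longrightarrow> \<bar>s\<bar> \<le> T \<Longrightarrow> 0 < x \<Longrightarrow> hump_start n \<le> 1 / x \<Longrightarrow>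
    \<bar>1 / half_line_field.F f s x - 1 / x\<bar> \<le> 1 / 4" using drift_small[of T] by blast
  obtain n0 where n0: "\<And>n. n0 \<le> n \<Longrightarrow> \<exists>m::int. \<bar>t - of_int m / N n\<bar> \<le> \<eta> n" using t by (auto simp: good_time_def)
  \<comment> \<open>bounds for the two factors of the composition, and the constant from composing them\<close>
  define a b K where "a n = C * (1 / (real n + 1))" and "b n = C * (T * r n)" and "K = 2 ^ k * (2 ^ k * C) ^ k * (C + 1)" for n
  have ab0: "0 \<le> a n" "a n \<le> C" "0 \<le> b n" for n using C(1) T1 r(2)[of n] by (auto simp: a_def b_def divide_le_eq)
  have K0: "0 \<le> K" using C(1) by (simp add: K_def)
  have "(\<lambda>n. K * (C * (T * r n)) + C * (1 / (real n + 1))) \<longlonglongrightarrow> K * (C * (T * 0)) + C * 0"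
    by (intro tendsto_intros r(1)) real_asymp
  then have "(\<lambda>n. K * b n + a n) \<longlonglongrightarrow> 0" by (simp add: a_def b_def)
  then have "\<forall>\<^sub>F n in sequentially. dist (K * b n + a n) 0 < \<epsilon>" using eps by (rule tendstoD)
  then obtain n2 where n2: "\<And>n. n2 \<le> n \<Longrightarrow> K * b n + a n \<le> \<epsilon>" by (force simp: eventually_sequentially)
  have "(\<lambda>n. T * r n) \<longlonglongrightarrow> T * 0" by (intro tendsto_intros r(1))
  then have "\<forall>\<^sub>F n in sequentially. dist (T * r n) 0 < 1" by (intro tendstoD) simp_all
  then obtain n3 where n3: "\<And>n. n3 \<le> n \<Longrightarrow> T * r n \<le> 1" by (force simp: eventually_sequentially)
  have "Ck_bdd k \<epsilon> (\<lambda>x. deriv (F t) x - 1) (zone n (5/2) (15/2))" if n: "k + n0 + n1 + n2 + n3 \<le> n" for n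
  proof -
    interpret G: half_line_field "dip_field n (c n)" by (rule half_line_field_dip_field_n)
    let ?S = "zone n (5/2) (15/2)" and ?S2 = "zone n (9/4) (31/4)" and ?U = "zone n 2 8"
    obtain m :: int where m: "\<bar>t - of_int m / N n\<bar> \<le> \<eta> n" using n0[of n] n by auto
    define q \<delta> where "q = of_int m / N n" and "\<delta> = t - q"
    obtain M where M: "0 \<le> M" "\<eta> n * M \<le> 1 / (real n + 1)" "Ck_bdd n M (deriv (h n)) ?U"
      and eta: "0 < \<eta> n" "\<eta> n \<le> 1" using win[of n] by (auto simp: good_window_def h_def)
    have de: "\<bar>\<delta>\<bar> \<le> \<eta> n" using m by (simp add: \<delta>_def q_def)
    have dT: "\<bar>\<delta>\<bar> \<le> T" using de eta T1 by linarith
    have qT: "\<bar>q\<bar> \<le> T" using de eta unfolding \<delta>_def T_def by linarith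
    have drift: "half_line_field.F f s x \<in> zone n (a' - 1/4) (b' + 1/4)"
      if f: "half_line_field f" and s: "\<bar>s\<bar> \<le> T" and x: "x \<in> zone n a' b'" "0 \<le> a'" for f s x a' b'
    proof -
      have x0: "0 < x" "hump_start n \<le> 1 / x" using x by (auto simp: zone_def)
      have "\<bar>1 / half_line_field.F f s x - 1 / x\<bar> \<le> 1 / 4" by (rule n1[OF _ f s x0]) (use n in simp)
      from zone_drift[OF x(1) half_line_field.F_pos[OF f x0(1)] this] show ?thesis .
    qed
    have F1: "F s x \<in> ?S2" if "\<bar>s\<bar> \<le> \<bar>\<delta>\<bar>" "x \<in> ?S" for s x
      using drift[OF half_line_field_xi _ that(2)] that(1) dT by simp
    have G1: "G.F s x \<in> ?U" if "\<bar>s\<bar> \<le> \<bar>q\<bar>" "x \<in> ?S2" for s x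
      using drift[OF half_line_field_dip_field_n _ that(2)] that(1) qT by simp
    have sub: "?S2 \<subseteq> ?U" "?U \<subseteq> zone n (-1) 11" by (auto simp: zone_def)
    have "Ck_bdd k M (deriv (h n)) ?S2"
      by (rule Ck_bdd_fam_mono[OF Ck_bdd_fam_order[OF M(3)]]) (use n sub in auto)
    then have dxi: "Ck_bdd k M (deriv \<xi>) ?S2"
      by (rule Ck_bdd_fam_cong[OF open_zone, rotated]) (use deriv_xi_eq sub in force)
    have dM: "\<bar>\<delta>\<bar> * M \<le> 1 / (real n + 1)" using mult_right_mono[OF de M(1)] M(2) by linarith
    moreover have "1 / (real n + 1) \<le> 1" by simp
    ultimately have "\<bar>\<delta>\<bar> * M \<le> 1" by linarith
    from C(2)[OF half_line_field_xi open_zone zone_pos zone_le_1 dxi M(1) this] F1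
    have f1: "Ck_bdd k (C * (\<bar>\<delta>\<bar> * M)) (\<lambda>x. deriv (F \<delta>) x - 1) ?S" and f2: "Ck_bdd k C (F \<delta>) ?S" by auto
    have "C * (\<bar>\<delta>\<bar> * M) \<le> a n" unfolding a_def using dM C(1) by (intro mult_left_mono) auto
    then have f3: "Ck_bdd k (a n) (\<lambda>x. deriv (F \<delta>) x - 1) ?S" by (rule Ck_bdd_fam_mono[OF f1 _ order_refl])
    have db: "Ck_bdd k (r n) (deriv (dip_field n (c n))) ?U"
      by (rule Ck_bdd_fam_mono[OF Ck_bdd_deriv[OF open_zone r(3)] order_refl sub(2)])
    have qr: "\<bar>q\<bar> * r n \<le> T * r n" using mult_right_mono[OF qT r(2)] .
    also have "\<dots> \<le> 1" using n3[of n] n by simp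
    finally have "\<bar>q\<bar> * r n \<le> 1" .
    from C(2)[OF half_line_field_dip_field_n open_zone zone_pos zone_le_1 db r(2) this] G1
    have g1: "Ck_bdd k (C * (\<bar>q\<bar> * r n)) (\<lambda>x. deriv (G.F q) x - 1) ?S2" by auto
    have "C * (\<bar>q\<bar> * r n) \<le> b n" unfolding b_def using qr C(1) by (intro mult_left_mono) auto
    then have g2: "Ck_bdd k (b n) (\<lambda>x. deriv (G.F q) x - 1) ?S2" by (rule Ck_bdd_fam_mono[OF g1 _ order_refl])
    have FS2: "F \<delta> x \<in> ?S2" if "x \<in> ?S" for x using F1[of \<delta> x] that by simp
    have comp: "Ck_bdd k ((2 ^ k * C) ^ k * b n) (\<lambda>x. deriv (G.F q) (F \<delta> x) - 1) ?S"
      by (rule Ck_bdd_fam_comp[OF g2 f2 FS2 ab0(3) C(1)])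
    have f4: "Ck_bdd k (a n + 1) (\<lambda>x. (deriv (F \<delta>) x - 1) + 1) ?S"
      by (rule Ck_bdd_fam_add[OF f3 Ck_bdd_fam_const]) simp
    have "Ck_bdd k (2 ^ k * ((2 ^ k * C) ^ k * b n) * (a n + 1) + a n)
       (\<lambda>x. (deriv (G.F q) (F \<delta> x) - 1) * ((deriv (F \<delta>) x - 1) + 1) + (deriv (F \<delta>) x - 1)) ?S"
      by (rule Ck_bdd_fam_add[OF Ck_bdd_fam_mult[OF comp f4] f3]) (use ab0[of n] C(1) in auto)
    moreover have "2 ^ k * ((2 ^ k * C) ^ k * b n) * (a n + 1) + a n \<le> \<epsilon>"
    proof -
      have "2 ^ k * ((2 ^ k * C) ^ k * b n) * (a n + 1) \<le> 2 ^ k * ((2 ^ k * C) ^ k * b n) * (C + 1)"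
        using ab0[of n] C(1) by (intro mult_left_mono) auto
      also have "\<dots> = K * b n" by (simp add: K_def)
      finally show ?thesis using n2[of n] n by simp
    qed
    ultimately have "Ck_bdd k \<epsilon> (\<lambda>x. (deriv (G.F q) (F \<delta> x) - 1) * ((deriv (F \<delta>) x - 1) + 1) + (deriv (F \<delta>) x - 1)) ?S"
      by (rule Ck_bdd_fam_mono) simp
    then show ?thesis
    proof (rule Ck_bdd_fam_cong[OF open_zone, rotated])
      fix x assume x: "x \<in> ?S"
      then have x0: "0 < x" by (simp add: zone_def)
      have eq: "G.F q (F \<delta> y) = F t y" if "y \<in> ?S" for y
      proof -
        have "F \<delta> y \<in> ?U" "G.F q (F \<delta> y) \<in> ?U" using FS2[OF that] sub G1[of q "F \<delta> y"] by auto
        then have "F q (F \<delta> y) = G.F q (F \<delta> y)" unfolding q_def by (intro core_flow_eq)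
        then show ?thesis by (simp add: F_add[symmetric] \<delta>_def)
      qed
      have "((\<lambda>y. G.F q (F \<delta> y)) has_real_derivative deriv (G.F q) (F \<delta> x) * deriv (F \<delta>) x) (at x)"
        using G.DERIV_F[OF F_pos[OF x0], of q \<delta>] DERIV_F[OF x0, of \<delta>]
        by (intro DERIV_chain2) (simp_all add: G.deriv_F F_pos x0 deriv_F)
      then have "(F t has_real_derivative deriv (G.F q) (F \<delta> x) * deriv (F \<delta>) x) (at x)"
        by (rule has_field_derivative_transform_within_open[OF _ open_zone x eq])
      then show "(deriv (G.F q) (F \<delta> x) - 1) * ((deriv (F \<delta>) x - 1) + 1) + (deriv (F \<delta>) x - 1) = deriv (F t) x - 1"
        by (simp add: DERIV_imp_deriv algebra_simps)
    qed
  qed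
  then show ?thesis by (auto simp: eventually_sequentially)
qed

text \<open>The two kinds of regions treated above cover a neighbourhood of the boundary point.\<close>

lemma good_time_smooth:
  assumes "good_time t" shows "C_r_on r (F t) {0..}"
proof -
  have "C_k_on k (F t) {0..}" for k
  proof (rule C_k_on_extend_to_0[where c = 1])
    show "smooth_on {0<..} (F t)" by (rule smooth_on_F)
    show "(F t \<longlongrightarrow> F t 0) (at_right 0)" using F_tendsto_0 by simp
    fix k and \<epsilon> :: real assume "0 < \<epsilon>"
    then have "\<forall>\<^sub>F n in sequentially. Ck_bdd k \<epsilon> (\<lambda>x. deriv (F t) x - 1) (zone n (29/4) (51/4)) \<and>
        Ck_bdd k \<epsilon> (\<lambda>x. deriv (F t) x - 1) (zone n (5/2) (15/2))"
      by (intro eventually_conj outer_flow_Ck_small core_flow_Ck_small assms)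
    then obtain n1 where n1: "\<And>n. n1 \<le> n \<Longrightarrow> Ck_bdd k \<epsilon> (\<lambda>x. deriv (F t) x - 1) (zone n (29/4) (51/4)) \<and>
        Ck_bdd k \<epsilon> (\<lambda>x. deriv (F t) x - 1) (zone n (5/2) (15/2))" by (auto simp: eventually_sequentially)
    let ?V = "(\<Union>n\<in>{n1..}. zone n (29/4) (51/4)) \<union> (\<Union>n\<in>{n1..}. zone n (5/2) (15/2))"
    have V: "Ck_bdd k \<epsilon> (\<lambda>x. deriv (F t) x - 1) ?V"
      by (intro Ck_bdd_Un Ck_bdd_UN open_UN ballI open_zone) (use n1 in auto)
    have p: "0 < hump_start (Suc n1)" using hump_start_ge[of "Suc n1"] by linarith
    have "{0<..<1 / hump_start (Suc n1)} \<subseteq> ?V"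
    proof
      fix x assume "x \<in> {0<..<1 / hump_start (Suc n1)}"
      then have x: "0 < x" "hump_start (Suc n1) \<le> 1 / x" using p by (auto simp: field_simps)
      obtain n where n: "Suc n1 \<le> n" "0 \<le> 1 / x - hump_start n" "1 / x - hump_start n < 10" by (rule hump_cover[OF x])
      then obtain l where l: "n = Suc l" "n1 \<le> l" by (cases n) auto
      consider "1 / x - hump_start n < 11 / 4" | "5 / 2 < 1 / x - hump_start n" "1 / x - hump_start n < 15 / 2" | "29 / 4 < 1 / x - hump_start n" by linarith
      then show "x \<in> ?V"
      proof cases
        case 1
        then have "x \<in> zone l (29/4) (51/4)" using n x l by (simp add: zone_def hump_start_Suc)
        then show ?thesis using l by auto
      next
        case 2
        then have "x \<in> zone n (5/2) (15/2)" using x by (simp add: zone_def)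
        then show ?thesis using n by auto
      next
        case 3
        then have "x \<in> zone n (29/4) (51/4)" using x n by (simp add: zone_def)
        then show ?thesis using n by auto
      qed
    qed
    then have "Ck_bdd k \<epsilon> (\<lambda>x. deriv (F t) x - 1) {0<..<1 / hump_start (Suc n1)}" by (intro Ck_bdd_fam_mono[OF V order_refl])
    then show "\<exists>d>0. Ck_bdd k \<epsilon> (\<lambda>x. deriv (F t) x - 1) {0<..<d}" using p by (intro exI[of _ "1 / hump_start (Suc n1)"]) simp
  qed
  then show ?thesis by (simp add: C_r_on_def)
qed

end

section \<open>Density, uncountability and a bad time\<close>

context oscillating_field
begin

lemma good_time_minus: assumes "good_time t" shows "good_time (- t)"
proof -
  obtain n0 where n0: "\<And>n. n0 \<le> n \<Longrightarrow> \<exists>m::int. \<bar>t - of_int m / N n\<bar> \<le> \<eta> n" using assms by (auto simp: good_time_def)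
  have "\<exists>m::int. \<bar>- t - of_int m / N n\<bar> \<le> \<eta> n" if n: "n0 \<le> n" for n
  proof -
    obtain m :: int where "\<bar>t - of_int m / N n\<bar> \<le> \<eta> n" using n0[OF n] by blast
    moreover have "- t - of_int (- m) / N n = - (t - of_int m / N n)" by simp
    ultimately show ?thesis by (metis abs_minus_cancel)
  qed
  then show ?thesis by (auto simp: good_time_def)
qed

lemma good_time_flow: "good_time t \<Longrightarrow> flow t \<in> Diff_half_line r"
  by (intro flow_in_Diff good_time_smooth good_time_minus)

lemma eta_pos: "0 < \<eta> n" using win[of n] by (simp add: good_window_def)

lemma E_mono: "strict_mono E" using E_less by (simp add: strict_mono_Suc_iff)

lemma E_ge: "n \<le> E n" using strict_mono_imp_increasing[OF E_mono] .

lemma good_time_triadic: "good_time (of_int i / 3 ^ j)"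
proof -
  have "\<exists>m::int. \<bar>of_int i / 3 ^ j - of_int m / N n\<bar> \<le> \<eta> n" if "j \<le> n" for n
  proof -
    have "j \<le> E n" using that E_ge[of n] by simp
    then have "N n = 3 ^ j * 3 ^ (E n - j)" by (simp add: power_add[symmetric])
    then have "of_int i / 3 ^ j - of_int (i * 3 ^ (E n - j)) / N n = 0" by simp
    then show ?thesis using eta_pos[of n] by (metis abs_zero less_imp_le)
  qed
  then show ?thesis by (auto simp: good_time_def)
qed

lemma good_time_one: "good_time 1" using good_time_triadic[of 1 0] by simp

lemma closure_good_time: "closure {t. good_time t} = UNIV"
proof -
  have "t \<in> closure {t. good_time t}" for t
    unfolding closure_approachable
  proof (intro allI impI)
    fix e :: real assume e: "0 < e"
    obtain j where j: "1 / e < 3 ^ j" using real_arch_pow[of 3 "1 / e"] by auto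
    let ?i = "\<lfloor>t * 3 ^ j\<rfloor>"
    have "\<bar>of_int ?i - t * 3 ^ j\<bar> \<le> 1" by linarith
    then have "\<bar>of_int ?i - t * 3 ^ j\<bar> / 3 ^ j \<le> 1 / 3 ^ j" by (intro divide_right_mono) auto
    moreover have "of_int ?i / 3 ^ j - t = (of_int ?i - t * 3 ^ j) / 3 ^ j" by (simp add: diff_divide_distrib)
    ultimately have "\<bar>of_int ?i / 3 ^ j - t\<bar> \<le> 1 / 3 ^ j" by (simp add: abs_divide)
    also have "1 / 3 ^ j < e" using j e by (simp add: field_simps)
    finally have "dist (of_int ?i / 3 ^ j) t < e" by (simp add: dist_real_def)
    then show "\<exists>y\<in>{t. good_time t}. dist y t < e" using good_time_triadic by blast
  qed
  then show ?thesis by blast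
qed

text \<open>Subset sums of the reciprocal frequencies; up to the \<open>n\<close>-th term they are multiples of \<open>1 / N n\<close>, and the
  rest is dominated by the first omitted term.\<close>

definition lacunary_sum :: "nat set \<Rightarrow> real" where
  "lacunary_sum I = (\<Sum>n. if n \<in> I then 1 / N n else 0)"

lemma N_tail: "1 / N (i + n) \<le> (1 / 3) ^ i / N n"
proof -
  have "E n + i \<le> E (i + n)"
  proof (induction i)
    case (Suc i)
    then show ?case using E_less[of "i + n"] by simp
  qed simp
  then have "(3::real) ^ (E n + i) \<le> N (i + n)" by (intro power_increasing) auto
  then have "1 / N (i + n) \<le> 1 / 3 ^ (E n + i)" by (intro divide_left_mono) auto
  then show ?thesis by (simp add: power_add power_one_over mult.commute)
qed

lemma lacunary_tail:
  shows "summable (\<lambda>i. if i + n \<in> I then 1 / N (i + n) else 0)"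
    and "0 \<le> (\<Sum>i. if i + n \<in> I then 1 / N (i + n) else 0)"
    and "(\<Sum>i. if i + n \<in> I then 1 / N (i + n) else 0) \<le> (3 / 2) / N n"
proof -
  let ?f = "\<lambda>i. if i + n \<in> I then 1 / N (i + n) else 0"
  have g: "summable (\<lambda>i. (1 / 3) ^ i / N n)" by (intro summable_divide summable_geometric) simp
  have le: "0 \<le> ?f i" "?f i \<le> (1 / 3) ^ i / N n" for i using N_tail[of i n] by auto
  show s: "summable ?f" by (rule summable_comparison_test'[OF g, of 0]) (use le in simp)
  show "0 \<le> suminf ?f" by (rule suminf_nonneg[OF s le(1)])
  have "suminf ?f \<le> (\<Sum>i. (1 / 3) ^ i / N n)" by (rule suminf_le[OF le(2) s g])
  also have "\<dots> = (3 / 2) / N n" by (subst suminf_divide) (simp_all add: suminf_geometric)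
  finally show "suminf ?f \<le> (3 / 2) / N n" .
qed

lemma lacunary_sum_split:
  "lacunary_sum I = (\<Sum>i. if i + n \<in> I then 1 / N (i + n) else 0) + (\<Sum>i<n. if i \<in> I then 1 / N i else 0)"
  using suminf_split_initial_segment[OF lacunary_tail(1)[of 0 I, unfolded add_0_right], of n]
  by (simp add: lacunary_sum_def)

lemma good_time_lacunary_sum: "good_time (lacunary_sum I)"
proof -
  have "\<exists>m::int. \<bar>lacunary_sum I - of_int m / N n\<bar> \<le> \<eta> n" for n
  proof -
    \<comment> \<open>numerator of the partial sum with denominator \<open>N n\<close>\<close>
    let ?m = "\<Sum>i<Suc n. if i \<in> I then 3 ^ (E n - E i) else (0::int)"
    have "of_int ?m / N n = (\<Sum>i<Suc n. of_int (if i \<in> I then 3 ^ (E n - E i) else 0) / N n)"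
      by (simp only: of_int_sum sum_divide_distrib)
    also have "\<dots> = (\<Sum>i<Suc n. if i \<in> I then 1 / N i else 0)"
    proof (rule sum.cong[OF refl])
      fix i assume "i \<in> {..<Suc n}"
      then have "E i \<le> E n" using E_mono by (simp add: strict_mono_less_eq)
      then have "N n = N i * 3 ^ (E n - E i)" by (simp add: power_add[symmetric])
      then show "of_int (if i \<in> I then 3 ^ (E n - E i) else 0) / N n = (if i \<in> I then 1 / N i else 0)" by simp
    qed
    finally have "lacunary_sum I - of_int ?m / N n = (\<Sum>i. if i + Suc n \<in> I then 1 / N (i + Suc n) else 0)"
      using lacunary_sum_split[of I "Suc n"] by simp
    moreover have "(3 / 2) / N (Suc n) \<le> 2 / N (Suc n)" by (intro divide_right_mono) auto
    ultimately have "\<bar>lacunary_sum I - of_int ?m / N n\<bar> \<le> \<eta> n"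
      using lacunary_tail(2,3)[of "Suc n" I] sep[of n] by linarith
    then show ?thesis by blast
  qed
  then show ?thesis by (auto simp: good_time_def)
qed

text \<open>Frequencies grow at least by the factor \<open>3\<close>, so the first index at which two sets differ is not compensated by
  the later ones, as for Cantor sets.\<close>

lemma inj_lacunary_sum: "inj lacunary_sum"
proof (rule injI, rule ccontr)
  fix I J assume eq: "lacunary_sum I = lacunary_sum J" and ne: "I \<noteq> J"
  define n where "n = (LEAST n. n \<in> I \<longleftrightarrow> n \<notin> J)"
  have ex: "\<exists>n. n \<in> I \<longleftrightarrow> n \<notin> J" using ne by blast
  have n: "n \<in> I \<longleftrightarrow> n \<notin> J" unfolding n_def by (rule LeastI_ex[OF ex])
  have l: "i \<in> I \<longleftrightarrow> i \<in> J" if "i < n" for i using not_less_Least[of i] that unfolding n_def by blast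
  \<comment> \<open>tails after the first index that distinguishes the two sets\<close>
  define t where "t K = (\<Sum>i. if i + Suc n \<in> K then 1 / N (i + Suc n) else 0)" for K
  have "(\<Sum>i<n. if i \<in> I then 1 / N i else 0) = (\<Sum>i<n. if i \<in> J then 1 / N i else 0)"
    by (rule sum.cong) (use l in auto)
  then have "t I + (if n \<in> I then 1 / N n else 0) = t J + (if n \<in> J then 1 / N n else 0)"
    using eq unfolding lacunary_sum_split[of _ "Suc n"] t_def[symmetric] by simp
  then have "\<bar>t I - t J\<bar> = 1 / N n"
  proof (cases "n \<in> I")
    case True
    then have "t J = t I + 1 / N n" using n \<open>t I + _ = _\<close> by simp
    then show ?thesis by simp
  next
    case False
    then have "t I = t J + 1 / N n" using n \<open>t I + _ = _\<close> by simp
    then show ?thesis by simp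
  qed
  moreover have "\<bar>t I - t J\<bar> \<le> (3 / 2) / N (Suc n)"
    using lacunary_tail(2,3)[of "Suc n" I] lacunary_tail(2,3)[of "Suc n" J] unfolding t_def[symmetric] by linarith
  moreover have "(3 / 2) / N (Suc n) < 1 / N n"
  proof -
    have "(3::real) ^ Suc (E n) \<le> N (Suc n)" using E_less[of n] by (intro power_increasing) auto
    then have "3 * N n \<le> N (Suc n)" by simp
    then have "(3 / 2) / N (Suc n) \<le> (3 / 2) / (3 * N n)" by (intro divide_left_mono) auto
    also have "\<dots> < 1 / N n" by (simp add: field_simps)
    finally show ?thesis .
  qed
  ultimately show False by linarith
qed

lemma uncountable_good_time: "uncountable {t. good_time t}"
proof
  assume "countable {t. good_time t}"
  then have "countable (range lacunary_sum)" by (rule countable_subset[rotated]) (auto intro: good_time_lacunary_sum)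
  then have "countable (UNIV :: nat set set)" using inj_lacunary_sum countable_image_inj_on by blast
  then have "from_nat_into (UNIV :: nat set set) ` UNIV = Pow UNIV" by (simp add: range_from_nat_into)
  then show False using Cantors_theorem[of "UNIV :: nat set"] by blast
qed

text \<open>At the bottom of the dip the field is \<open>c / (1 + q * cos (2 * pi * N * dip_abel))\<close> with \<open>q = 2 * pi * N * c\<close>. Starting at a
  crest of the cosine, time \<open>1 / 2\<close> leads to a trough and another \<open>1 / 2\<close> to a crest again, because \<open>N\<close> is odd. The
  derivatives of the flow at the first two points are quotients of these extreme values of the field; they differ by
  order \<open>q\<close>, whereas the points are only \<open>c / 2\<close> apart.\<close>

lemma flow_half_not_C2: "\<not> C_r_on 2 (F (1 / 2)) {0..}"
proof
  assume "C_r_on 2 (F (1 / 2)) {0..}"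
  moreover have "enat (Suc (Suc 0)) \<le> 2" by (simp add: numeral_eq_enat numeral_2_eq_2)
  ultimately have "C_k_on (Suc (Suc 0)) (F (1 / 2)) {0..}" unfolding C_r_on_def by blast
  then obtain f' f'' where f': "\<forall>x\<in>{0..}. (F (1 / 2) has_real_derivative f' x) (at x within {0..})"
    and f'': "\<forall>x\<in>{0..}. (f' has_real_derivative f'' x) (at x within {0..})" "continuous_on {0..} f''"
    by auto
  have f'eq: "f' x = \<xi> (F (1 / 2) x) / \<xi> x" if x: "0 < x" for x
  proof -
    have "(F (1 / 2) has_real_derivative f' x) (at x within {0<..})"
      by (rule DERIV_subset[OF bspec[OF f']]) (use x in auto)
    then have "(F (1 / 2) has_real_derivative f' x) (at x)" using x by (simp add: at_within_open[of x "{0<..}"])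
    then show ?thesis using DERIV_F[OF x] DERIV_unique by blast
  qed
  have "compact (f'' ` {0..1})" by (intro compact_continuous_image continuous_on_subset[OF f''(2)]) auto
  then obtain K where K: "\<And>x. x \<in> {0..1} \<Longrightarrow> \<bar>f'' x\<bar> \<le> K"
    by (metis compact_imp_bounded bounded_iff image_eqI real_norm_def)
  \<comment> \<open>a \<open>C\<^sup>2\<close> map has a Lipschitz derivative near \<open>0\<close>\<close>
  have lip: "\<bar>f' y - f' x\<bar> \<le> K * \<bar>y - x\<bar>" if "x \<in> {0..1}" "y \<in> {0..1}" for x y
  proof -
    have "norm (f' y - f' x) \<le> K * norm (y - x)"
    proof (rule field_differentiable_bound[where S = "{0..1}"])
      fix z :: real assume z: "z \<in> {0..1}"
      show "(f' has_field_derivative f'' z) (at z within {0..1})"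
        by (rule DERIV_subset[OF bspec[OF f''(1)]]) (use z in auto)
      show "norm (f'' z) \<le> K" using K[OF z] by simp
    qed (use that in auto)
    then show ?thesis by simp
  qed
  have "16 * pi * N n \<le> K" for n
  proof -
    let ?c = "c n"
    define x0 where "x0 = 1 / (hump_start n + 5)"
    define q where "q = ?c * (2 * pi * N n)"
    have c: "0 < ?c" "?c \<le> 1 / (hump_start n + 4) - 1 / (hump_start n + 5)" using amp[of n] by (auto simp: good_amplitude_def)
    have Yp: "0 < hump_start n + 4" "0 < hump_start n + 5" using hump_start_ge[of n] by linarith+
    have x0: "0 < x0" using Yp by (simp add: x0_def)
    define I where "I = {x0..1 / (hump_start n + 4)}"
    have Iz: "4 \<le> 1 / x - hump_start n" "1 / x - hump_start n \<le> 5" "0 < x" if "x \<in> I" for x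
    proof -
      have x: "x0 \<le> x" "x \<le> 1 / (hump_start n + 4)" using that by (auto simp: I_def)
      then show xp: "0 < x" using x0 by linarith
      show "4 \<le> 1 / x - hump_start n" "1 / x - hump_start n \<le> 5" using x xp Yp by (simp_all add: x0_def field_simps)
    qed
    have IZ: "x \<in> zone n 2 8" if "x \<in> I" for x using Iz[OF that] by (simp add: zone_def)
    have dip_field_c: "dip_field n ?c x = ?c" if "x \<in> I" for x using Iz[OF that] by (simp add: dip_field_def bump_1)
    \<comment> \<open>on \<open>I\<close> the dip field is the constant \<open>c n\<close>, so \<open>dip_abel\<close> is affine\<close>
    have "\<exists>d. \<forall>x\<in>I. dip_abel n ?c x - x / ?c = d"
    proof (rule has_field_derivative_zero_constant)
      show "convex I" by (simp add: I_def)
      fix x assume x: "x \<in> I"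
      have "((\<lambda>x. dip_abel n ?c x - x / ?c) has_real_derivative 1 / dip_field n ?c x - 1 / ?c) (at x)"
        by (intro DERIV_diff DERIV_dip_abel c_bounds Iz[OF x] DERIV_cdivide DERIV_ident)
      then show "((\<lambda>x. dip_abel n ?c x - x / ?c) has_field_derivative 0) (at x within I)"
        using dip_field_c[OF x] by (simp add: has_field_derivative_at_within)
    qed
    then obtain d where d: "\<And>x. x \<in> I \<Longrightarrow> dip_abel n ?c x - x / ?c = d" by blast
    have mem: "x0 \<in> I" "x0 + ?c / 2 \<in> I" "x0 + ?c \<in> I" using c by (auto simp: I_def x0_def)
    have t0: "dip_abel n ?c x0 = 0" unfolding x0_def by (rule dip_abel_base[OF c_bounds])
    have t1: "dip_abel n ?c (x0 + ?c / 2) = 1 / 2" using d[OF mem(1)] d[OF mem(2)] t0 c(1) by (simp add: add_divide_distrib)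
    have t2: "dip_abel n ?c (x0 + ?c) = 1" using d[OF mem(1)] d[OF mem(3)] t0 c(1) by (simp add: add_divide_distrib)
    have sn: "sin (2 * pi * N n * (1 / 2)) = 0" "sin (2 * pi * N n * 1) = 0"
      using sin_npi[of "3 ^ E n"] sin_npi[of "2 * 3 ^ E n"] by (simp_all add: mult_ac)
    have cs: "cos (2 * pi * N n * (1 / 2)) = -1" "cos (2 * pi * N n * 1) = 1"
      using cos_npi[of "3 ^ E n"] cos_npi[of "2 * 3 ^ E n"] by (simp_all add: mult_ac)
    have F0: "F (1 / 2) x0 = x0 + ?c / 2"
      using A_core[OF IZ[OF mem(1)] IZ[OF mem(2)]] t0 t1 sn Iz[OF mem(1)] Iz[OF mem(2)] by (intro F_eqI) simp_all
    have F1: "F (1 / 2) (x0 + ?c / 2) = x0 + ?c"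
      using A_core[OF IZ[OF mem(2)] IZ[OF mem(3)]] t1 t2 sn Iz[OF mem(2)] Iz[OF mem(3)] by (intro F_eqI) simp_all
    have q: "0 < q" "q \<le> 1 / 2" using c amplitude_frequency[OF amp N1, of n] by (simp_all add: q_def)
    have xi: "\<xi> x0 = ?c / (1 + q)" "\<xi> (x0 + ?c / 2) = ?c / (1 - q)" "\<xi> (x0 + ?c) = ?c / (1 + q)"
      using xi_core[OF IZ[OF mem(1)]] xi_core[OF IZ[OF mem(2)]] xi_core[OF IZ[OF mem(3)]] 
      unfolding dip_field_c[OF mem(1)] dip_field_c[OF mem(2)] dip_field_c[OF mem(3)] t0 t1 t2 cs
      by (simp_all add: q_def)
    have "f' x0 = (1 + q) / (1 - q)" using f'eq[OF x0] F0 xi c(1) by simp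
    moreover have "f' (x0 + ?c / 2) = (1 - q) / (1 + q)" using f'eq[OF Iz(3)[OF mem(2)]] F1 xi c(1) by simp
    moreover have "(1 + q) / (1 - q) - (1 - q) / (1 + q) \<ge> 4 * q"
    proof -
      have "(1 + q) / (1 - q) - (1 - q) / (1 + q) = 4 * q / ((1 - q) * (1 + q))"
        using q by (simp add: diff_frac_eq) (simp add: algebra_simps)
      moreover have "4 * q / 1 \<le> 4 * q / ((1 - q) * (1 + q))"
      proof (rule divide_left_mono)
        show "(1 - q) * (1 + q) \<le> 1" by (simp add: algebra_simps)
        have "0 < (1 - q) * (1 + q)" using q by (intro mult_pos_pos) auto
        then show "0 < 1 * ((1 - q) * (1 + q))" by simp
      qed (use q in simp)
      ultimately show ?thesis by simp
    qed
    ultimately have "4 * q \<le> \<bar>f' x0 - f' (x0 + ?c / 2)\<bar>" by linarith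
    also have "\<dots> \<le> K * \<bar>x0 - (x0 + ?c / 2)\<bar>"
    proof (rule lip)
      have "1 / (hump_start n + 4) \<le> 1" using hump_start_ge[of n] by simp
      then show "x0 \<in> {0..1}" "x0 + ?c / 2 \<in> {0..1}" using mem x0 c(1) by (auto simp: I_def)
    qed
    also have "\<dots> = K * ?c / 2" using c(1) by simp
    finally have "(16 * pi * N n) * ?c \<le> K * ?c" by (simp add: q_def mult_ac)
    then show ?thesis using c(1) by simp
  qed
  note bound = this
  obtain n where n: "K < real n" using reals_Archimedean2 by blast
  have "n < 3 ^ E n" by (rule le_less_trans[OF E_ge power_gt_expt]) simp
  then have "real n < N n" by (metis of_nat_less_iff of_nat_numeral of_nat_power)
  also have "\<dots> \<le> 16 * pi * N n" using pi_gt3 by simp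
  finally show False using bound[of n] n by linarith
qed

end

theorem theorem1:
  shows "\<exists>f \<in> Diff_half_line \<infinity>.
    {x \<in> {0..}. f x = x} = {0} \<and>
    (\<exists>\<phi>. is_one_param_centralizer \<phi> f \<and>
      (\<forall>r::enat. 2 \<le> r \<longrightarrow>
        subgroup (centralizer r f) (centralizer_group 1 f) \<and>
        centralizer r f \<noteq> centralizer 1 f \<and>
        closure {t. \<phi> t \<in> centralizer r f} = UNIV \<and>
        uncountable (centralizer r f)))"
proof -
  obtain E c \<eta> where "oscillating_field E c \<eta>" by (rule oscillating_field_exists)
  then interpret oscillating_field E c \<eta> .
  have good: "flow t \<in> centralizer r (flow 1)" if "good_time t" for t r
    by (simp add: flow_in_centralizer_iff good_time_flow that)
  show ?thesis
  proof (intro bexI[of _ "flow 1"] conjI exI[of _ flow] allI impI)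
    show "flow 1 \<in> Diff_half_line \<infinity>" by (rule good_time_flow[OF good_time_one])
    show "{x \<in> {0..}. flow 1 x = x} = {0}"
    proof (intro equalityI subsetI)
      fix x assume "x \<in> {x \<in> {0..}. flow 1 x = x}"
      then have "0 \<le> x" "F 1 x = x" by (auto simp: flow_eq)
      then show "x \<in> {0}" using F_1_neq[of x] by (cases "x = 0") auto
    qed (simp add: flow_eq)
    show "is_one_param_centralizer flow (flow 1)" by (rule is_one_param_centralizer_flow)
    fix r :: enat assume r: "2 \<le> r"
    have r1: "1 \<le> r" using r by (rule order_trans[rotated]) (simp add: one_enat_def numeral_eq_enat)
    show "subgroup (centralizer r (flow 1)) (centralizer_group 1 (flow 1))"
      by (rule subgroup_centralizer_group[OF flow_Bij r1])
    show "centralizer r (flow 1) \<noteq> centralizer 1 (flow 1)"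
    proof
      assume "centralizer r (flow 1) = centralizer 1 (flow 1)"
      then have "flow (1 / 2) \<in> centralizer r (flow 1)" by (simp add: centralizer_1_flow)
      then have "C_r_on r (F (1 / 2)) {0..}" by (simp add: flow_in_centralizer_iff Diff_flowD)
      then have "C_r_on 2 (F (1 / 2)) {0..}" using r unfolding C_r_on_def by (meson order_trans)
      then show False using flow_half_not_C2 by contradiction
    qed
    show "closure {t. flow t \<in> centralizer r (flow 1)} = UNIV"
      using closure_mono[of "{t. good_time t}" "{t. flow t \<in> centralizer r (flow 1)}"] good closure_good_time by blast
    show "uncountable (centralizer r (flow 1))"
    proof
      assume "countable (centralizer r (flow 1))"
      then have "countable (flow ` {t. good_time t})" by (rule countable_subset[rotated]) (use good in blast)
      then have "countable {t. good_time t}" using inj_flow by (meson countable_image_inj_on inj_on_subset subset_UNIV)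
      then show False using uncountable_good_time by contradiction
    qed
  qed
qed

end
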